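(* Let $\Omega=\mathbb{D}(\mathbb{R}_+)$ be the space of càdlàg functions $\mathbb{R}_+\to\mathbb{R}$, let $X$ be the canonical process $X_t(\omega)=\omega(t)$, and let $\mathcal{F}_t=\sigma(X_s:s\in[0,t])$ and $\mathcal{F}=\sigma(X_t:t\ge0)$. Let $\alpha^+,\alpha^-,\lambda_1^+,\lambda_1^-,\lambda_2^+,\lambda_2^-\in(0,\infty)$ and $\beta^+,\beta^-\in[0,1)$. Let $\mathbb{P}$ and $\mathbb{Q}$ be probability measures on $(\Omega,\mathcal{F})$ such that $X\sim\mathrm{TS}(\alpha^+,\beta^+,\lambda_1^+;\alpha^-,\beta^-,\lambda_1^-)$ under $\mathbb{P}$ and $X\sim\mathrm{TS}(\alpha^+,\beta^+,\lambda_2^+;\alpha^-,\beta^-,\lambda_2^-)$ under $\mathbb{Q}$. Then $\mathbb{Q}$ is the bilateral Esscher transform $$\mathbb{Q}=\mathbb{P}^{(\lambda_1^+-\lambda_2^+,\ \lambda_1^--\lambda_2^-)},$$ that is, for all $t\ge0$, $$\frac{d\mathbb{Q}}{d\mathbb{P}}\bigg|_{\mathcal{F}_t}=\exp\big((\lambda_1^+-\lambda_2^+)X_t^+-\Psi^+(\lambda_1^+-\lambda_2^+)t\big)\times\exp\big((\lambda_1^--\lambda_2^-)X_t^--\Psi^-(\lambda_1^--\lambda_2^-)t\big).$$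
   Context: For $\alpha,\lambda\in(0,\infty)$ and $\beta\in[0,1)$, the one-sided tempered stable distribution $\mathrm{TS}(\alpha,\beta,\lambda)$ is the infinitely divisible distribution on $\mathbb{R}$ with characteristic function $\varphi(z)=\exp\big(\int_{\mathbb{R}}(e^{izx}-1)F(dx)\big)$, where $F(dx)=\frac{\alpha}{x^{1+\beta}}e^{-\lambda x}\mathbf{1}_{(0,\infty)}(x)\,dx$. The tempered stable distribution $\mathrm{TS}(\alpha^+,\beta^+,\lambda^+;\alpha^-,\beta^-,\lambda^-)$ is the law of the difference of independent random variables with distributions $\mathrm{TS}(\alpha^+,\beta^+,\lambda^+)$ and $\mathrm{TS}(\alpha^-,\beta^-,\lambda^-)$. "$X\sim\mathrm{TS}(\cdots)$" for a process means that $X$ is a Lévy process such that $X_1$ has this distribution. A tempered stable process has finite-variation pure-jump paths, $X_t=\sum_{s\le t}\Delta X_s$, and decomposes as $X=X^+-X^-$ with $X_t^+=\sum_{s\le t}(\Delta X_s)^+$ and $X_t^-=\sum_{s\le t}(\Delta X_s)^-$; under $\mathbb{P}$ these are independent subordinators, $X^+\sim\mathrm{TS}(\alpha^+,\beta^+,\lambda_1^+)$ and $X^-\sim\mathrm{TS}(\alpha^-,\beta^-,\lambda_1^-)$. $\Psi^\pm(z)=\ln\mathbb{E}_{\mathbb{P}}[e^{zX_1^\pm}]$ denote their cumulant generating functions under $\mathbb{P}$, which are finite for $z<\lambda_1^\pm$: $\Psi^\pm(z)=\alpha^\pm\Gamma(-\beta^\pm)[(\lambda_1^\pm-z)^{\beta^\pm}-(\lambda_1^\pm)^{\beta^\pm}]$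 if $\beta^\pm\in(0,1)$, and $\Psi^\pm(z)=\alpha^\pm\ln\frac{\lambda_1^\pm}{\lambda_1^\pm-z}$ if $\beta^\pm=0$. For $\theta^+\in(-\infty,\lambda_1^+)$ and $\theta^-\in(-\infty,\lambda_1^-)$ the bilateral Esscher transform $\mathbb{P}^{(\theta^+,\theta^-)}$ is the locally equivalent probability measure defined by $$\frac{d\mathbb{P}^{(\theta^+,\theta^-)}}{d\mathbb{P}}\bigg|_{\mathcal{F}_t}:=\exp\big(\theta^+X_t^+-\Psi^+(\theta^+)t\big)\times\exp\big(\theta^-X_t^--\Psi^-(\theta^-)t\big),\quad t\ge0.$$ *)

theory Defs
  imports "HOL-Probability.Probability"
begin

definition ts_levy_measure :: "real \<Rightarrow> real \<Rightarrow> real \<Rightarrow> real measure" where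
  "ts_levy_measure \<alpha> \<beta> lam =
     density lborel
       (\<lambda>x. ennreal (\<alpha> / x powr (1 + \<beta>) * exp (- lam * x) * indicator {0<..} x))"

text \<open>Infinite divisibility is not listed separately: the characteristic function already
  determines the distribution.\<close>

definition one_sided_tempered_stable :: "real \<Rightarrow> real \<Rightarrow> real \<Rightarrow> real measure \<Rightarrow> bool" where
  "one_sided_tempered_stable \<alpha> \<beta> lam \<mu> \<longleftrightarrow>
     real_distribution \<mu> \<and>
     (\<forall>z. char \<mu> z = exp (CLINT x|ts_levy_measure \<alpha> \<beta> lam. (iexp (z * x) - 1)))"

definition tempered_stable ::
  "real \<Rightarrow> real \<Rightarrow> real \<Rightarrow> real \<Rightarrow> real \<Rightarrow> real \<Rightarrow> real measure \<Rightarrow> bool" where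
  "tempered_stable \<alpha>p \<beta>p lamp \<alpha>m \<beta>m lamm \<mu> \<longleftrightarrow>
     (\<exists>\<mu>p \<mu>m. one_sided_tempered_stable \<alpha>p \<beta>p lamp \<mu>p \<and>
              one_sided_tempered_stable \<alpha>m \<beta>m lamm \<mu>m \<and>
              \<mu> = distr (\<mu>p \<Otimes>\<^sub>M \<mu>m) borel (\<lambda>(x, y). x - y))"

definition cadlag :: "(real \<Rightarrow> real) \<Rightarrow> bool" where
  "cadlag \<omega> \<longleftrightarrow>
     (\<forall>t\<ge>0. continuous (at_right t) \<omega>) \<and> (\<forall>t>0. \<exists>l. (\<omega> \<longlongrightarrow> l) (at_left t))"

definition levy_process :: "'a measure \<Rightarrow> (real \<Rightarrow> 'a \<Rightarrow> real) \<Rightarrow> bool" where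
  "levy_process M X \<longleftrightarrow>
     prob_space M \<and>
     (\<forall>t\<ge>0. X t \<in> borel_measurable M) \<and>
     (\<forall>\<omega>\<in>space M. cadlag (\<lambda>t. X t \<omega>)) \<and>
     (AE \<omega> in M. X 0 \<omega> = 0) \<and>
     (\<forall>(n::nat) (t :: nat \<Rightarrow> real). 0 \<le> t 0 \<and> mono t \<longrightarrow>
        prob_space.indep_vars M (\<lambda>_. borel) (\<lambda>i \<omega>. X (t (Suc i)) \<omega> - X (t i) \<omega>) {..<n}) \<and>
     (\<forall>s\<ge>0. \<forall>h\<ge>0.
        distr M borel (\<lambda>\<omega>. X (s + h) \<omega> - X s \<omega>) = distr M borel (X h))"

definition tempered_stable_process ::
  "real \<Rightarrow> real \<Rightarrow> real \<Rightarrow> real \<Rightarrow> real \<Rightarrow> real \<Rightarrow> 'a measure \<Rightarrow> (real \<Rightarrow> 'a \<Rightarrow> real) \<Rightarrow> bool" where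
  "tempered_stable_process \<alpha>p \<beta>p lamp \<alpha>m \<beta>m lamm M X \<longleftrightarrow>
     levy_process M X \<and> tempered_stable \<alpha>p \<beta>p lamp \<alpha>m \<beta>m lamm (distr M borel (X 1))"

text \<open>A function on the half line is encoded as a function on the reals that is \<open>undefined\<close> at
  negative arguments, so that distinct elements of \<open>skorokhod_space\<close> differ at some
  nonnegative time.\<close>

definition skorokhod_space :: "(real \<Rightarrow> real) set" where
  "skorokhod_space = {\<omega> \<in> extensional {0..}. cadlag \<omega>}"

definition canonical :: "real \<Rightarrow> (real \<Rightarrow> real) \<Rightarrow> real" where
  "canonical t \<omega> = \<omega> t"

definition path_sigma :: "(real \<Rightarrow> real) measure" where
  "path_sigma = sigma skorokhod_space
     {canonical s -` B \<inter> skorokhod_space | s B. 0 \<le> s \<and> B \<in> sets borel}"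

definition path_filtration :: "real \<Rightarrow> (real \<Rightarrow> real) measure" where
  "path_filtration t = sigma skorokhod_space
     {canonical s -` B \<inter> skorokhod_space | s B. s \<in> {0..t} \<and> B \<in> sets borel}"

definition jump :: "(real \<Rightarrow> real) \<Rightarrow> real \<Rightarrow> real" where
  "jump \<omega> s = \<omega> s - Lim (at_left s) \<omega>"

text \<open>There is no jump at time \<open>0\<close>. On paths whose jumps are not summable the sums below take
  the value \<open>0\<close>; such paths form a null set for a tempered stable process.\<close>

definition jumps_pos :: "real \<Rightarrow> (real \<Rightarrow> real) \<Rightarrow> real" where
  "jumps_pos t \<omega> = (\<Sum>\<^sub>\<infinity>s\<in>{0<..t}. max 0 (jump \<omega> s))"

definition jumps_neg :: "real \<Rightarrow> (real \<Rightarrow> real) \<Rightarrow> real" where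
  "jumps_neg t \<omega> = (\<Sum>\<^sub>\<infinity>s\<in>{0<..t}. max 0 (- jump \<omega> s))"

definition cumulant_gen :: "'a measure \<Rightarrow> ('a \<Rightarrow> real) \<Rightarrow> real \<Rightarrow> real" where
  "cumulant_gen M Y z = ln (LINT \<omega>|M. exp (z * Y \<omega>))"

definition esscher_density ::
  "(real \<Rightarrow> real) measure \<Rightarrow> real \<Rightarrow> real \<Rightarrow> real \<Rightarrow> (real \<Rightarrow> real) \<Rightarrow> real" where
  "esscher_density P \<theta>p \<theta>m t \<omega> =
     exp (\<theta>p * jumps_pos t \<omega> - cumulant_gen P (jumps_pos 1) \<theta>p * t) *
     exp (\<theta>m * jumps_neg t \<omega> - cumulant_gen P (jumps_neg 1) \<theta>m * t)"

definition has_density_on ::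
  "'a measure \<Rightarrow> 'a measure \<Rightarrow> 'a measure \<Rightarrow> ('a \<Rightarrow> real) \<Rightarrow> bool" where
  "has_density_on F P Q Z \<longleftrightarrow>
     Z \<in> borel_measurable F \<and>
     restr_to_subalg Q F = density (restr_to_subalg P F) (\<lambda>\<omega>. ennreal (Z \<omega>))"

text \<open>The density is strictly positive, so local equivalence to \<open>P\<close> is automatic. Uniqueness
  holds because the union of the filtration is an intersection-stable generator of
  \<open>path_sigma\<close>.\<close>

definition bilateral_esscher ::
  "(real \<Rightarrow> real) measure \<Rightarrow> real \<Rightarrow> real \<Rightarrow> (real \<Rightarrow> real) measure" where
  "bilateral_esscher P \<theta>p \<theta>m =
     (THE Q. prob_space Q \<and> sets Q = sets path_sigma \<and>
             (\<forall>t\<ge>0. has_density_on (path_filtration t) P Q (esscher_density P \<theta>p \<theta>m t)))"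

end

theory Submission
  imports Defs
begin

text \<open>For a continuous \<open>h\<close> that vanishes near \<open>0\<close> and has compact support, the sums of \<open>h\<close> over the increments
  of a cadlag path along a fine equidistant partition converge to the sum of \<open>h\<close> over its jumps. The
  increments are i.i.d. and \<open>n E u(X (d/n)) \<longlongrightarrow> d \<integral>u dF\<close> for such \<open>u\<close>, which gives
  \<open>E exp (i z X\<^sub>d - \<Sum>h(\<Delta>X\<^sub>s)) = exp (d \<integral>(exp (i z x - h x) - 1) F(dx))\<close>. Letting \<open>h\<close> increase to
  \<open>c x\<^sup>+ + c' x\<^sup>-\<close> with nonnegative real parts of \<open>c, c'\<close> yields the joint law of \<open>X\<close> and its two jump sums.

  The signs of \<open>\<lambda>\<^sub>1 - \<lambda>\<^sub>2\<close> are arbitrary, but both \<open>P\<close> and \<open>Q\<close> can be tilted, with nonpositive exponents, to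
  the common parameter \<open>max \<lambda>\<^sub>1 \<lambda>\<^sub>2\<close>. The tilted measures have independent increments with equal
  characteristic functions, hence agree on \<open>F\<^sub>t\<close>; the density of \<open>Q\<close> is the quotient of the two tilts.
  The same comparison for the law of one jump sum alone identifies the cumulants.\<close>

section \<open>Increments and jumps of cadlag paths\<close>

text \<open>The hypotheses speak of the law of \<open>X 1\<close> and of increments, whereas the
  density is a functional of the jumps. No Poisson random measure is built: grid sums turn jump
  functionals into functions of increments, and every law is obtained as a limit of transforms.
  Cutting \<open>h\<close> off near 0 leaves finitely many relevant jumps on each path. Cutting it
  off at infinity keeps it bounded, so that a continuity theorem applies to \<open>n\<close> times
  the law of \<open>X (d / n)\<close>, once a weight has removed the mass that piles up at 0.
  Undoing the cut-off calls for dominating functions: the constant 1 on the probability side, whence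
  the nonnegative real parts, and a multiple of |x| on the Levy side, whence the integrability of x
  under \<open>F\<close>. A density with a positive exponent has no such bound; it never occurs
  inside a limit, but only as a quotient of two bounded tilts. Both tilts can reach a common measure
  because the weight exp(-p x) merely adds \<open>p\<close> to the tempering parameter.\<close>

text \<open>One radius serves both sides. By the definition of \<open>jump\<close>,
  \<open>\<omega> s - jump \<omega> s\<close> is the left limit; at \<open>s = 0\<close> the last
  clause is vacuous, so the left limit that is unspecified there does no harm.\<close>

lemma cadlag_local:
  assumes "cadlag \<omega>" "0 \<le> s" "0 < e"
  obtains d where "d > 0" "\<And>u. s \<le> u \<Longrightarrow> u < s + d \<Longrightarrow> \<bar>\<omega> u - \<omega> s\<bar> < e"
    "\<And>u. 0 \<le> u \<Longrightarrow> s - d < u \<Longrightarrow> u < s \<Longrightarrow> \<bar>\<omega> u - (\<omega> s - jump \<omega> s)\<bar> < e"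
proof -
  have "continuous (at_right s) \<omega>"
    using assms unfolding cadlag_def by auto
  then have "((\<lambda>u. \<omega> u) \<longlongrightarrow> \<omega> s) (at_right s)"
    by (simp add: continuous_within)
  then have "\<forall>\<^sub>F u in at_right s. dist (\<omega> u) (\<omega> s) < e"
    using \<open>0 < e\<close> by (rule tendstoD)
  then obtain b where b: "b > s" "\<And>u. s < u \<Longrightarrow> u < b \<Longrightarrow> \<bar>\<omega> u - \<omega> s\<bar> < e"
    by (auto simp: eventually_at_right_field dist_real_def)
  have "\<exists>c<s. \<forall>u. 0 \<le> u \<and> c < u \<and> u < s \<longrightarrow> \<bar>\<omega> u - (\<omega> s - jump \<omega> s)\<bar> < e"
  proof (cases "s = 0")
    case True
    then show ?thesis by (intro exI[of _ "-1"]) auto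
  next
    case False
    with assms obtain l where l: "(\<omega> \<longlongrightarrow> l) (at_left s)"
      unfolding cadlag_def by force
    then have "Lim (at_left s) \<omega> = l"
      by (intro tendsto_Lim) (auto simp: trivial_limit_at_left_real)
    moreover have "\<forall>\<^sub>F u in at_left s. dist (\<omega> u) l < e"
      using l \<open>0 < e\<close> by (rule tendstoD)
    ultimately show ?thesis
      by (auto simp: eventually_at_left_field dist_real_def jump_def)
  qed
  then obtain c where c: "c < s" "\<And>u. 0 \<le> u \<Longrightarrow> c < u \<Longrightarrow> u < s \<Longrightarrow> \<bar>\<omega> u - (\<omega> s - jump \<omega> s)\<bar> < e"
    by blast
  show ?thesis
  proof (rule that[of "min (b - s) (s - c)"])
    fix u assume "s \<le> u" "u < s + min (b - s) (s - c)"
    then show "\<bar>\<omega> u - \<omega> s\<bar> < e"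
      using b(2)[of u] \<open>0 < e\<close> by (cases "u = s") auto
  qed (use b c in auto)
qed

lemma cadlag_local_radii:
  assumes "cadlag \<omega>" "0 \<le> a" "0 < e"
  obtains d where "\<And>s. s \<in> {a..b} \<Longrightarrow> d s > 0"
    "\<And>s u. s \<in> {a..b} \<Longrightarrow> s \<le> u \<Longrightarrow> u < s + d s \<Longrightarrow> \<bar>\<omega> u - \<omega> s\<bar> < e"
    "\<And>s u. s \<in> {a..b} \<Longrightarrow> 0 \<le> u \<Longrightarrow> s - d s < u \<Longrightarrow> u < s \<Longrightarrow> \<bar>\<omega> u - (\<omega> s - jump \<omega> s)\<bar> < e"
proof -
  have "\<forall>s\<in>{a..b}. \<exists>d>0. (\<forall>u. s \<le> u \<and> u < s + d \<longrightarrow> \<bar>\<omega> u - \<omega> s\<bar> < e) \<and>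
     (\<forall>u. 0 \<le> u \<and> s - d < u \<and> u < s \<longrightarrow> \<bar>\<omega> u - (\<omega> s - jump \<omega> s)\<bar> < e)"
  proof
    fix s assume "s \<in> {a..b}"
    with assms have "0 \<le> s" "0 < e" by auto
    from cadlag_local[OF assms(1) this] show "\<exists>d>0. (\<forall>u. s \<le> u \<and> u < s + d \<longrightarrow> \<bar>\<omega> u - \<omega> s\<bar> < e) \<and>
     (\<forall>u. 0 \<le> u \<and> s - d < u \<and> u < s \<longrightarrow> \<bar>\<omega> u - (\<omega> s - jump \<omega> s)\<bar> < e)"
      by metis
  qed
  then obtain d where "\<And>s. s \<in> {a..b} \<Longrightarrow> d s > 0"
    "\<And>s u. s \<in> {a..b} \<Longrightarrow> s \<le> u \<Longrightarrow> u < s + d s \<Longrightarrow> \<bar>\<omega> u - \<omega> s\<bar> < e"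
    "\<And>s u. s \<in> {a..b} \<Longrightarrow> 0 \<le> u \<Longrightarrow> s - d s < u \<Longrightarrow> u < s \<Longrightarrow> \<bar>\<omega> u - (\<omega> s - jump \<omega> s)\<bar> < e"
    by metis
  then show ?thesis using that by blast
qed

text \<open>Compactness: finitely many balls cover \<open>{a..b}\<close>, and at a point of such a
  ball other than its centre both the value and the left limit are close to one and the same
  one-sided limit at the centre. Big jumps therefore sit at the finitely many centres.\<close>

lemma cadlag_big_jumps_finite:
  assumes "cadlag \<omega>" "0 \<le> a" "0 < e"
  shows "finite {s\<in>{a<..b}. e \<le> \<bar>jump \<omega> s\<bar>}"
proof -
  have "0 < e/4" using assms by simp
  from cadlag_local_radii[OF assms(1,2) this] obtain d where d: "\<And>s. s \<in> {a..b} \<Longrightarrow> d s > 0"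
    "\<And>s u. s \<in> {a..b} \<Longrightarrow> s \<le> u \<Longrightarrow> u < s + d s \<Longrightarrow> \<bar>\<omega> u - \<omega> s\<bar> < e/4"
    "\<And>s u. s \<in> {a..b} \<Longrightarrow> 0 \<le> u \<Longrightarrow> s - d s < u \<Longrightarrow> u < s \<Longrightarrow> \<bar>\<omega> u - (\<omega> s - jump \<omega> s)\<bar> < e/4"
    by blast
  obtain D where D: "D \<subseteq> {a..b}" "finite D" "{a..b} \<subseteq> (\<Union>s\<in>D. ball s (d s))"
  proof (rule compactE_image[of "{a..b}" "{a..b}" "\<lambda>s. ball s (d s)"])
    show "{a..b} \<subseteq> (\<Union>s\<in>{a..b}. ball s (d s))" using d(1) by force
  qed auto
  have "{s\<in>{a<..b}. e \<le> \<bar>jump \<omega> s\<bar>} \<subseteq> D"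
  proof safe
    fix r assume r: "r \<in> {a<..b}" "e \<le> \<bar>jump \<omega> r\<bar>"
    then have "r \<in> {a..b}" by simp
    with D(3) obtain s where s: "s \<in> D" "\<bar>s - r\<bar> < d s"
      by (auto simp: dist_real_def subset_iff)
    with D have sab: "s \<in> {a..b}" by auto
    have "0 \<le> r" "0 < e/4" using r assms by auto
    from cadlag_local[OF assms(1) this] obtain d' where d': "d' > 0"
      "\<And>u. 0 \<le> u \<Longrightarrow> r - d' < u \<Longrightarrow> u < r \<Longrightarrow> \<bar>\<omega> u - (\<omega> r - jump \<omega> r)\<bar> < e/4"
      by metis
    have "r = s"
    proof (rule ccontr)
      assume "r \<noteq> s"
      \<comment> \<open>Every \<open>u\<close> strictly between \<open>m\<close> and
        \<open>r\<close> is near enough to \<open>r\<close> for \<open>\<omega> u\<close> to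
        approximate the left limit at \<open>r\<close>, and it lies in the ball around
        \<open>s\<close>, on the same side of \<open>s\<close> as \<open>r\<close>.\<close>
      define m where "m = Max {a, r - d', if r < s then s - d s else s}"
      define u where "u = (m + r) / 2"
      have m: "a \<le> m" "r - d' \<le> m" "(if r < s then s - d s else s) \<le> m"
        unfolding m_def by (intro Max_ge; simp)+
      have "m < r"
        using r d' s \<open>r \<noteq> s\<close> unfolding m_def by (auto simp: abs_if split: if_splits)
      then have u: "u < r" "m < u" unfolding u_def by auto
      have "0 \<le> u" using u m assms by linarith
      have 1: "\<bar>\<omega> u - (\<omega> r - jump \<omega> r)\<bar> < e/4"
        using u m \<open>0 \<le> u\<close> by (intro d') auto
      have "\<bar>\<omega> u - \<omega> r\<bar> < e/2"
      proof (cases "r < s")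
        case True
        then have "s - d s \<le> m" using m by simp
        then have "\<bar>\<omega> u - (\<omega> s - jump \<omega> s)\<bar> < e/4" "\<bar>\<omega> r - (\<omega> s - jump \<omega> s)\<bar> < e/4"
          using u True \<open>0 \<le> u\<close> \<open>0 \<le> r\<close> by - (rule d(3)[OF sab]; linarith)+
        then show ?thesis by linarith
      next
        case False
        then have "s \<le> m" using m by simp
        then have "\<bar>\<omega> u - \<omega> s\<bar> < e/4" "\<bar>\<omega> r - \<omega> s\<bar> < e/4"
          using u False s by - (rule d(2)[OF sab]; linarith)+
        then show ?thesis by linarith
      qed
      with 1 r(2) \<open>0 < e/4\<close> show False by linarith
    qed
    then show "r \<in> D" using s by simp
  qed
  then show ?thesis using D finite_subset by blast
qed

text \<open>A Lebesgue number of the cover by the local radii puts each short \<open>{u..v}\<close>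
  into the ball of a single \<open>s\<close>. The increment collects the jump at \<open>s\<close>,
  if \<open>u < s\<close> and \<open>s \<le> v\<close>, and two errors of \<open>e/4\<close>; the
  factor 2 leaves room for these.\<close>

lemma cadlag_small_increments:
  assumes "cadlag \<omega>" "0 \<le> a" "0 < e"
  obtains \<delta> where "0 < \<delta>"
    "\<And>u v. \<lbrakk>a \<le> u; u \<le> v; v \<le> b; v - u < \<delta>; \<forall>s\<in>{u<..v}. \<bar>jump \<omega> s\<bar> < e\<rbrakk> \<Longrightarrow> \<bar>\<omega> v - \<omega> u\<bar> < 2 * e"
proof (cases "a \<le> b")
  case True
  have "0 < e/4" using assms by simp
  from cadlag_local_radii[OF assms(1,2) this] obtain d where d: "\<And>s. s \<in> {a..b} \<Longrightarrow> d s > 0"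
    "\<And>s u. s \<in> {a..b} \<Longrightarrow> s \<le> u \<Longrightarrow> u < s + d s \<Longrightarrow> \<bar>\<omega> u - \<omega> s\<bar> < e/4"
    "\<And>s u. s \<in> {a..b} \<Longrightarrow> 0 \<le> u \<Longrightarrow> s - d s < u \<Longrightarrow> u < s \<Longrightarrow> \<bar>\<omega> u - (\<omega> s - jump \<omega> s)\<bar> < e/4"
    by blast
  obtain \<delta> where \<delta>: "0 < \<delta>"
    "\<And>T. T \<subseteq> {a..b} \<Longrightarrow> diameter T < \<delta> \<Longrightarrow> \<exists>B \<in> (\<lambda>s. ball s (d s)) ` {a..b}. T \<subseteq> B"
  proof (rule Lebesgue_number_lemma[of "{a..b}" "(\<lambda>s. ball s (d s)) ` {a..b}"])
    show "{a..b} \<subseteq> \<Union> ((\<lambda>s. ball s (d s)) ` {a..b})" using d(1) by force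
  qed (use True in auto)
  show ?thesis
  proof (rule that[OF \<delta>(1)])
    fix u v assume uv: "a \<le> u" "u \<le> v" "v \<le> b" "v - u < \<delta>" "\<forall>s\<in>{u<..v}. \<bar>jump \<omega> s\<bar> < e"
    have "\<exists>B \<in> (\<lambda>s. ball s (d s)) ` {a..b}. {u..v} \<subseteq> B"
      using uv by (intro \<delta>) (auto simp: diameter_closed_interval)
    then obtain s where s: "s \<in> {a..b}" "{u..v} \<subseteq> ball s (d s)" by auto
    have "u \<in> ball s (d s)" "v \<in> ball s (d s)" using s(2) uv(2) by auto
    then have us: "\<bar>s - u\<bar> < d s" and vs: "\<bar>s - v\<bar> < d s"
      by (auto simp: dist_real_def)
    have "0 \<le> u" "0 \<le> v" using uv assms by auto
    consider "v < s" | "s \<le> u" | "u < s" "s \<le> v" by linarith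
    then show "\<bar>\<omega> v - \<omega> u\<bar> < 2 * e"
    proof cases
      case 1
      then have "\<bar>\<omega> u - (\<omega> s - jump \<omega> s)\<bar> < e/4" "\<bar>\<omega> v - (\<omega> s - jump \<omega> s)\<bar> < e/4"
        using us vs uv(2) \<open>0 \<le> u\<close> \<open>0 \<le> v\<close> by - (rule d(3)[OF s(1)]; linarith)+
      then show ?thesis using assms(3) by linarith
    next
      case 2
      then have "\<bar>\<omega> u - \<omega> s\<bar> < e/4" "\<bar>\<omega> v - \<omega> s\<bar> < e/4"
        using us vs uv(2) by - (rule d(2)[OF s(1)]; linarith)+
      then show ?thesis using assms(3) by linarith
    next
      case 3
      then have "\<bar>jump \<omega> s\<bar> < e" using uv(5) by auto
      moreover have "\<bar>\<omega> u - (\<omega> s - jump \<omega> s)\<bar> < e/4" "\<bar>\<omega> v - \<omega> s\<bar> < e/4"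
        using us vs 3 \<open>0 \<le> u\<close> by - ((rule d(3)[OF s(1)] | rule d(2)[OF s(1)]); linarith)+
      ultimately show ?thesis by linarith
    qed
  qed
next
  case False
  then show ?thesis by (intro that[of 1]) auto
qed

lemma cadlag_tendsto_right:
  assumes "cadlag \<omega>" "0 \<le> s" and r: "r \<longlonglongrightarrow> s" "\<forall>\<^sub>F n in sequentially. s \<le> r n"
  shows "(\<lambda>n. \<omega> (r n)) \<longlonglongrightarrow> \<omega> s"
proof (rule tendstoI)
  fix e :: real assume "0 < e"
  from cadlag_local[OF assms(1,2) this] obtain d where d: "d > 0"
    "\<And>u. s \<le> u \<Longrightarrow> u < s + d \<Longrightarrow> \<bar>\<omega> u - \<omega> s\<bar> < e" by metis
  have "\<forall>\<^sub>F n in sequentially. r n < s + d"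
    using r(1) d by (auto intro: order_tendstoD)
  with r(2) show "\<forall>\<^sub>F n in sequentially. dist (\<omega> (r n)) (\<omega> s) < e"
    by eventually_elim (auto simp: dist_real_def d)
qed

lemma cadlag_tendsto_left:
  assumes "cadlag \<omega>" "0 < s" and r: "r \<longlonglongrightarrow> s" "\<forall>\<^sub>F n in sequentially. r n < s"
  shows "(\<lambda>n. \<omega> (r n)) \<longlonglongrightarrow> \<omega> s - jump \<omega> s"
proof (rule tendstoI)
  fix e :: real assume "0 < e"
  with cadlag_local[OF assms(1), of s e] assms(2) obtain d where d: "d > 0"
    "\<And>u. 0 \<le> u \<Longrightarrow> s - d < u \<Longrightarrow> u < s \<Longrightarrow> \<bar>\<omega> u - (\<omega> s - jump \<omega> s)\<bar> < e" by (metis less_imp_le)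
  have "\<forall>\<^sub>F n in sequentially. s - d < r n" "\<forall>\<^sub>F n in sequentially. 0 < r n"
    using r(1) d assms(2) by (auto intro: order_tendstoD)
  with r(2) show "\<forall>\<^sub>F n in sequentially. dist (\<omega> (r n)) (\<omega> s - jump \<omega> s) < e"
    by eventually_elim (auto simp: dist_real_def intro!: d(2))
qed

definition grid :: "real \<Rightarrow> real \<Rightarrow> nat \<Rightarrow> nat \<Rightarrow> real" where
  "grid a b n i = a + (b - a) * (real i / real n)"

text \<open>In a fine grid each cell holds at most one jump of size at least \<open>e/2\<close>. A
  cell without one has an increment below \<open>e\<close>, since
  \<open>cadlag_small_increments\<close> loses a factor 2, and there \<open>h\<close> vanishes
  exactly. So the sum finally has one term per big jump, and each term converges by continuity of
  \<open>h\<close>.\<close>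

lemma sum_increments_tendsto:
  fixes h :: "real \<Rightarrow> 'b::real_normed_vector"
  assumes \<omega>: "cadlag \<omega>" and ab: "0 \<le> a" "a \<le> b" and e: "0 < e"
    and h: "continuous_on UNIV h" "\<And>x. \<bar>x\<bar> \<le> e \<Longrightarrow> h x = 0"
  shows "(\<lambda>n. \<Sum>i<n. h (\<omega> (grid a b n (Suc i)) - \<omega> (grid a b n i)))
     \<longlonglongrightarrow> (\<Sum>s | s \<in> {a<..b} \<and> e/2 \<le> \<bar>jump \<omega> s\<bar>. h (jump \<omega> s))"
proof (cases "a = b")
  case True
  then show ?thesis using h(2)[of 0] e by (simp add: grid_def)
next
  case False
  with ab have "a < b" by simp
  define S where "S = {s\<in>{a<..b}. e/2 \<le> \<bar>jump \<omega> s\<bar>}"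
  have S: "finite S" unfolding S_def using \<omega> ab e by (intro cadlag_big_jumps_finite) auto
  \<comment> \<open>Index of the cell that contains \<open>s\<close>. Cells are open on the left and
    closed on the right, as a jump at a grid point belongs to the increment that ends there; hence
    the ceiling minus one, and \<open>s = b\<close> falls into the last cell.\<close>
  define N where "N n s = nat \<lceil>(s - a) * real n / (b - a)\<rceil> - 1" for n :: nat and s :: real
  define l where "l n s = grid a b n (N n s)" for n s
  define r where "r n s = grid a b n (Suc (N n s))" for n s
  have N: "N n s < n" "l n s < s" "s \<le> r n s" if "s \<in> S" "0 < n" for n s
  proof -
    define x where "x = (s - a) * real n / (b - a)"
    have "0 < x" "x \<le> n" using that \<open>a < b\<close> unfolding S_def x_def by (auto simp: field_simps)
    then have c: "0 < \<lceil>x\<rceil>" "\<lceil>x\<rceil> \<le> int n" by (auto simp: ceiling_le_iff)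
    then show "N n s < n" unfolding N_def x_def[symmetric] by linarith
    have s: "s = a + (b - a) * (x / n)" using that \<open>a < b\<close> unfolding x_def by (simp add: field_simps)
    have i: "real (N n s) < x" "x \<le> real (Suc (N n s))"
      using c unfolding N_def x_def[symmetric] by linarith+
    have "(b - a) * (real (N n s) / n) < (b - a) * (x / n)"
      using i(1) \<open>a < b\<close> that by (intro mult_strict_left_mono divide_strict_right_mono) auto
    then show "l n s < s" using s unfolding l_def grid_def by linarith
    have "(b - a) * (x / n) \<le> (b - a) * (real (Suc (N n s)) / n)"
      using i(2) \<open>a < b\<close> that by (intro mult_left_mono divide_right_mono) auto
    then show "s \<le> r n s" using s unfolding r_def grid_def by linarith
  qed
  have rl: "r n s - l n s = (b - a) / n" if "0 < n" for n s
    unfolding r_def l_def grid_def using that by (simp add: field_simps)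
  have inv: "(\<lambda>n::nat. (b - a) / real n) \<longlonglongrightarrow> 0"
    by (rule lim_const_over_n)
  have ev0: "\<forall>\<^sub>F n in sequentially. 0 < n" by (rule eventually_gt_at_top)
  have lim_l: "(\<lambda>n. l n s) \<longlonglongrightarrow> s" if "s \<in> S" for s
  proof (rule tendsto_sandwich[of "\<lambda>n::nat. s - (b - a) / real n" _ _ "\<lambda>n. s"])
    have "s - (b - a) / n \<le> l n s" "l n s \<le> s" if "0 < n" for n
      using N[OF \<open>s \<in> S\<close> that] rl[OF that, of s] by linarith+
    then show "\<forall>\<^sub>F n in sequentially. s - (b - a) / real n \<le> l n s" "\<forall>\<^sub>F n in sequentially. l n s \<le> s"
      by (auto intro!: eventually_mono[OF ev0])
  qed (use tendsto_diff[OF tendsto_const inv, of s] in simp_all)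
  have lim_r: "(\<lambda>n. r n s) \<longlonglongrightarrow> s" if "s \<in> S" for s
  proof (rule tendsto_sandwich[of "\<lambda>n. s" _ _ "\<lambda>n::nat. s + (b - a) / real n"])
    have "r n s \<le> s + (b - a) / n" "s \<le> r n s" if "0 < n" for n
      using N[OF \<open>s \<in> S\<close> that] rl[OF that, of s] by linarith+
    then show "\<forall>\<^sub>F n in sequentially. r n s \<le> s + (b - a) / real n" "\<forall>\<^sub>F n in sequentially. s \<le> r n s"
      by (auto intro!: eventually_mono[OF ev0])
  qed (use tendsto_add[OF tendsto_const inv, of s] in simp_all)
  have "(\<lambda>n. h (\<omega> (r n s) - \<omega> (l n s))) \<longlonglongrightarrow> h (jump \<omega> s)" if "s \<in> S" for s
  proof -
    have s0: "0 < s" using that ab unfolding S_def by auto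
    have "(\<lambda>n. \<omega> (r n s)) \<longlonglongrightarrow> \<omega> s"
      by (rule cadlag_tendsto_right[OF \<omega> _ lim_r[OF that]])
        (use s0 N[OF that] in \<open>auto intro!: eventually_mono[OF ev0]\<close>)
    moreover have "(\<lambda>n. \<omega> (l n s)) \<longlonglongrightarrow> \<omega> s - jump \<omega> s"
      by (rule cadlag_tendsto_left[OF \<omega> s0 lim_l[OF that]])
        (use N[OF that] in \<open>auto intro!: eventually_mono[OF ev0]\<close>)
    ultimately have "(\<lambda>n. \<omega> (r n s) - \<omega> (l n s)) \<longlonglongrightarrow> \<omega> s - (\<omega> s - jump \<omega> s)"
      by (rule tendsto_diff)
    then have "(\<lambda>n. h (\<omega> (r n s) - \<omega> (l n s))) \<longlonglongrightarrow> h (\<omega> s - (\<omega> s - jump \<omega> s))"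
      by (rule continuous_on_tendsto_compose[OF h(1)]) auto
    then show ?thesis by simp
  qed
  then have lim: "(\<lambda>n. \<Sum>s\<in>S. h (\<omega> (r n s) - \<omega> (l n s))) \<longlonglongrightarrow> (\<Sum>s\<in>S. h (jump \<omega> s))"
    by (intro tendsto_sum)
  obtain \<delta> where \<delta>: "0 < \<delta>"
    "\<And>u v. \<lbrakk>a \<le> u; u \<le> v; v \<le> b; v - u < \<delta>; \<forall>s\<in>{u<..v}. \<bar>jump \<omega> s\<bar> < e/2\<rbrakk> \<Longrightarrow> \<bar>\<omega> v - \<omega> u\<bar> < 2 * (e/2)"
    using cadlag_small_increments[OF \<omega> ab(1), of "e/2"] e by (metis half_gt_zero)
  have ev1: "\<forall>\<^sub>F n in sequentially. (b - a) / n < \<delta>"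
    using inv \<delta>(1) by (rule order_tendstoD)
  \<comment> \<open>A mesh below every gap between points of \<open>S\<close> makes
    \<open>N n\<close> injective on \<open>S\<close>.\<close>
  have ev2: "\<forall>\<^sub>F n in sequentially. \<forall>s\<in>S. \<forall>s'\<in>S. s < s' \<longrightarrow> (b - a) / n < s' - s"
    unfolding eventually_ball_finite_distrib[OF S]
  proof (intro ballI)
    fix s s' show "\<forall>\<^sub>F n in sequentially. s < s' \<longrightarrow> (b - a) / n < s' - s"
      by (cases "s < s'") (auto intro!: order_tendstoD(2)[OF inv])
  qed
  have "\<forall>\<^sub>F n in sequentially. (\<Sum>i<n. h (\<omega> (grid a b n (Suc i)) - \<omega> (grid a b n i)))
     = (\<Sum>s\<in>S. h (\<omega> (r n s) - \<omega> (l n s)))"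
    using ev0 ev1 ev2
  proof eventually_elim
    case (elim n)
    have inj: "inj_on (N n) S"
    proof (rule inj_onI, rule ccontr)
      have *: False if "s \<in> S" "s' \<in> S" "N n s = N n s'" "s < s'" for s s'
      proof -
        have "l n s = l n s'" "r n s = r n s'" using that unfolding l_def r_def by auto
        with N[OF that(1) elim(1)] N[OF that(2) elim(1)] rl[of n s] elim(1) have "s' - s \<le> (b - a) / n"
          by linarith
        moreover have "(b - a) / n < s' - s" using elim(3) that by blast
        ultimately show False by linarith
      qed
      fix s s' assume "s \<in> S" "s' \<in> S" "N n s = N n s'" "s \<noteq> s'"
      then show False using *[of s s'] *[of s' s] by (cases s s' rule: linorder_cases) auto
    qed
    have zero: "h (\<omega> (grid a b n (Suc i)) - \<omega> (grid a b n i)) = 0" if i: "i < n" "i \<notin> N n ` S" for i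
    proof -
      have "\<bar>\<omega> (grid a b n (Suc i)) - \<omega> (grid a b n i)\<bar> < 2 * (e/2)"
      proof (rule \<delta>(2))
        show "a \<le> grid a b n i" using \<open>a < b\<close> by (simp add: grid_def)
        show "grid a b n i \<le> grid a b n (Suc i)" using \<open>a < b\<close> by (simp add: grid_def divide_right_mono)
        have "(b - a) * (real (Suc i) / n) \<le> (b - a) * 1"
          using \<open>a < b\<close> i by (intro mult_left_mono) (auto simp: field_simps)
        then show "grid a b n (Suc i) \<le> b" unfolding grid_def mult_1_right by linarith
        have "grid a b n (Suc i) - grid a b n i = (b - a) / n"
          using elim(1) by (simp add: grid_def field_simps)
        then show "grid a b n (Suc i) - grid a b n i < \<delta>"
          using elim(2) by linarith
        show "\<forall>s\<in>{grid a b n i<..grid a b n (Suc i)}. \<bar>jump \<omega> s\<bar> < e / 2"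
        proof (rule ballI, rule ccontr)
          fix s assume s: "s \<in> {grid a b n i<..grid a b n (Suc i)}" "\<not> \<bar>jump \<omega> s\<bar> < e / 2"
          then have "s \<in> S"
            using \<open>a \<le> grid a b n i\<close> \<open>grid a b n (Suc i) \<le> b\<close> unfolding S_def by auto
          define x where "x = (s - a) * real n / (b - a)"
          have sx: "s = a + (b - a) * (x / n)" using elim(1) \<open>a < b\<close> unfolding x_def by (simp add: field_simps)
          have "real i < x" "x \<le> real (Suc i)"
            using s(1) \<open>a < b\<close> elim(1) unfolding grid_def x_def by (auto simp: field_simps)
          then have "\<lceil>x\<rceil> = int (Suc i)" by (intro ceiling_unique) auto
          then have "N n s = i" unfolding N_def x_def[symmetric] by simp
          with \<open>s \<in> S\<close> i(2) show False by auto
        qed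
      qed
      then show ?thesis by (intro h(2)) simp
    qed
    have "(\<Sum>i<n. h (\<omega> (grid a b n (Suc i)) - \<omega> (grid a b n i))) =
       (\<Sum>i\<in>N n ` S. h (\<omega> (grid a b n (Suc i)) - \<omega> (grid a b n i)))"
      by (rule sum.mono_neutral_right) (use zero N(1)[OF _ elim(1)] in auto)
    also have "\<dots> = (\<Sum>s\<in>S. h (\<omega> (r n s) - \<omega> (l n s)))"
      by (simp add: sum.reindex[OF inj] r_def l_def)
    finally show ?case .
  qed
  from tendsto_cong[THEN iffD2, OF this lim] show ?thesis
    unfolding S_def by (simp add: conj_commute conj_left_commute)
qed

section \<open>Small increments of a pure jump process of finite variation\<close>

lemma norm_iexp_minus_1_le: "cmod (iexp x - 1) \<le> \<bar>x\<bar>"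
  using iexp_approx1[of x 0] by simp

text \<open>Source of the dominating functions: for exponents in the left half plane the integrands
  against \<open>F\<close> are bounded by multiples of |x|, the size that
  \<open>integrable_F\<close> controls. The factor 2 pays for treating modulus and phase
  separately.\<close>

lemma norm_exp_minus_1_le:
  fixes w :: complex
  assumes "Re w \<le> 0"
  shows "cmod (exp w - 1) \<le> 2 * cmod w"
proof -
  have "exp w = of_real (exp (Re w)) * iexp (Im w)"
    by (simp only: exp_eq_polar[of w] cis_conv_exp)
  then have "exp w - 1 = of_real (exp (Re w)) * (iexp (Im w) - 1) + of_real (exp (Re w) - 1)"
    by (simp add: algebra_simps)
  also have "cmod \<dots> \<le> exp (Re w) * cmod (iexp (Im w) - 1) + \<bar>exp (Re w) - 1\<bar>"
    by (intro order_trans[OF norm_triangle_ineq]) (simp only: norm_mult norm_of_real abs_exp_cancel order_refl)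
  also have "\<dots> \<le> 1 * \<bar>Im w\<bar> + \<bar>Re w\<bar>"
  proof (intro add_mono mult_mono norm_iexp_minus_1_le)
    show "\<bar>exp (Re w) - 1\<bar> \<le> \<bar>Re w\<bar>"
    proof -
      have "exp (Re w) - 1 \<le> 0" using assms by simp
      then show ?thesis
        using exp_ge_add_one_self[of "Re w"] assms by linarith
    qed
  qed (use assms in auto)
  also have "\<dots> \<le> 2 * cmod w"
    using abs_Re_le_cmod[of w] abs_Im_le_cmod[of w] by simp
  finally show ?thesis .
qed

lemma tendsto_n_exp_minus_1:
  fixes c :: complex
  shows "(\<lambda>n. of_nat n * (exp (c / of_nat n) - 1)) \<longlonglongrightarrow> c"
proof (cases "c = 0")
  case False
  have "((\<lambda>y. (exp y - 1) / y) \<longlongrightarrow> 1) (at (0::complex))"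
    using DERIV_exp[of "0::complex"] by (simp add: has_field_derivative_iff)
  moreover have "filterlim (\<lambda>n. c / of_nat n) (at 0) sequentially"
    unfolding filterlim_at using False
    by (auto intro!: lim_const_over_n eventually_mono[OF eventually_gt_at_top[of 0]])
  ultimately have "(\<lambda>n. (exp (c / of_nat n) - 1) / (c / of_nat n)) \<longlonglongrightarrow> 1"
    by (rule filterlim_compose)
  from tendsto_mult[OF tendsto_const[of c] this] have "(\<lambda>n. c * ((exp (c / of_nat n) - 1) / (c / of_nat n))) \<longlonglongrightarrow> c"
    by simp
  then show ?thesis
    by (rule Lim_transform_eventually)
      (use False in \<open>auto intro!: eventually_mono[OF eventually_gt_at_top[of 0]] simp: field_simps\<close>)
qed simp

text \<open>The limit of (1 + c/n)^n without logarithms: \<open>a n\<close> and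
  \<open>exp (c / of_nat n)\<close> both lie in the closed unit disc, where n-th powers differ by at
  most \<open>n\<close> times the difference of the bases. For the second one this uses that
  \<open>c\<close> inherits a nonpositive real part from \<open>a n - 1\<close>.\<close>

lemma tendsto_power_exp:
  fixes a :: "nat \<Rightarrow> complex"
  assumes a: "\<And>n. cmod (a n) \<le> 1"
    and lim: "(\<lambda>n. of_nat n * (a n - 1)) \<longlonglongrightarrow> c"
  shows "(\<lambda>n. a n ^ n) \<longlonglongrightarrow> exp c"
proof -
  have c: "Re c \<le> 0"
  proof (rule LIMSEQ_le_const2[OF tendsto_Re[OF lim]], intro exI allI impI)
    fix n
    have "Re (a n) \<le> 1" using a[of n] complex_Re_le_cmod[of "a n"] by linarith
    then show "Re (of_nat n * (a n - 1)) \<le> 0" by (simp add: mult_nonneg_nonpos)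
  qed
  have "(\<lambda>n. of_nat n * (a n - 1) - of_nat n * (exp (c / of_nat n) - 1)) \<longlonglongrightarrow> c - c"
    by (intro tendsto_diff lim tendsto_n_exp_minus_1)
  then have lim0: "(\<lambda>n. cmod (of_nat n * (a n - exp (c / of_nat n)))) \<longlonglongrightarrow> 0"
    by (simp add: algebra_simps tendsto_norm_zero)
  have "(\<lambda>n. a n ^ n - exp c) \<longlonglongrightarrow> 0"
  proof (rule Lim_null_comparison[OF _ lim0])
    show "\<forall>\<^sub>F n in sequentially. cmod (a n ^ n - exp c) \<le> cmod (of_nat n * (a n - exp (c / of_nat n)))"
      using eventually_gt_at_top[of 0]
    proof eventually_elim
      case (elim n)
      have "exp c = exp (c / of_nat n) ^ n"
        using elim by (simp add: exp_of_nat_mult[symmetric])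
      moreover have "cmod (exp (c / of_nat n)) \<le> 1"
        using c by (simp add: divide_nonpos_nonneg)
      ultimately have "cmod (a n ^ n - exp c) \<le> real n * cmod (a n - exp (c / of_nat n))"
        using norm_power_diff[OF a[of n], of "exp (c / of_nat n)" n] by simp
      then show ?case by (simp add: norm_mult)
    qed
  qed
  then show ?thesis by (simp add: LIM_zero_iff)
qed

text \<open>Levy's continuity theorem after division by the total masses, which converge by the case
  \<open>y = 0\<close>. When the limiting mass is 0 one cannot normalise, but then the integrals of
  the bounded \<open>v\<close> tend to 0 by themselves.\<close>

lemma levy_continuity_finite:
  fixes \<mu> :: "nat \<Rightarrow> real measure" and v :: "real \<Rightarrow> complex"
  assumes \<mu>: "\<And>n. finite_measure (\<mu> n)" "\<And>n. sets (\<mu> n) = sets borel"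
    and \<nu>: "finite_measure \<nu>" "sets \<nu> = sets borel"
    and lim: "\<And>y. (\<lambda>n. CLINT x|\<mu> n. iexp (y * x)) \<longlonglongrightarrow> (CLINT x|\<nu>. iexp (y * x))"
    and v: "\<And>x. isCont v x" "\<And>x. cmod (v x) \<le> B"
  shows "(\<lambda>n. CLINT x|\<mu> n. v x) \<longlonglongrightarrow> (CLINT x|\<nu>. v x)"
proof -
  have B: "0 \<le> B" using v(2)[of 0] norm_ge_zero order_trans by blast
  have vm: "v \<in> borel_measurable borel"
    by (intro borel_measurable_continuous_onI continuous_at_imp_continuous_on) (auto simp: v)
  note [measurable_cong] = \<mu>(2) \<nu>(2)
  have [measurable]: "v \<in> borel_measurable (\<mu> n)" "v \<in> borel_measurable \<nu>" for n
    using vm by measurable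
  define m where "m n = measure (\<mu> n) (space (\<mu> n))" for n
  define c where "c = measure \<nu> (space \<nu>)"
  have "(\<lambda>n. complex_of_real (m n)) \<longlonglongrightarrow> complex_of_real c"
    using lim[of 0] by (simp add: m_def c_def scaleR_conv_of_real)
  then have m_lim: "m \<longlonglongrightarrow> c" by (simp add: tendsto_of_real_iff)
  have bnd: "cmod (CLINT x|\<eta>. v x) \<le> B * measure \<eta> (space \<eta>)"
    if "finite_measure \<eta>" "sets \<eta> = sets borel" for \<eta>
  proof -
    interpret finite_measure \<eta> by fact
    note [measurable_cong] = that(2)
    have [measurable]: "v \<in> borel_measurable \<eta>" using vm by measurable
    have "cmod (CLINT x|\<eta>. v x) \<le> (LINT x|\<eta>. B)"
      by (intro order_trans[OF integral_norm_bound] integral_mono integrable_const_bound[where B=B])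
        (auto simp: v B)
    then show ?thesis by (simp add: mult.commute)
  qed
  show ?thesis
  proof (cases "c = 0")
    case True
    then have "(CLINT x|\<nu>. v x) = 0" using bnd[OF \<nu>] by (simp add: c_def)
    moreover have "(\<lambda>n. CLINT x|\<mu> n. v x) \<longlonglongrightarrow> 0"
    proof (rule Lim_null_comparison)
      show "\<forall>\<^sub>F n in sequentially. cmod (CLINT x|\<mu> n. v x) \<le> B * m n"
        unfolding m_def by (intro always_eventually allI bnd \<mu>)
      show "(\<lambda>n. B * m n) \<longlonglongrightarrow> 0"
        using tendsto_mult[OF tendsto_const m_lim, of B] True by simp
    qed
    ultimately show ?thesis by simp
  next
    case False
    then have "c > 0" using measure_nonneg[of \<nu> "space \<nu>"] unfolding c_def by linarith
    define N where "N \<eta> = density \<eta> (\<lambda>x. ennreal (1 / measure \<eta> (space \<eta>)))" for \<eta> :: "real measure"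
    have N_distr: "real_distribution (N \<eta>)" if "finite_measure \<eta>" "sets \<eta> = sets borel" "measure \<eta> (space \<eta>) > 0" for \<eta>
    proof -
      interpret finite_measure \<eta> by fact
      have "emeasure (N \<eta>) (space (N \<eta>)) = ennreal (1 / measure \<eta> (space \<eta>)) * emeasure \<eta> (space \<eta>)"
        unfolding N_def by (simp add: emeasure_density)
      also have "\<dots> = 1"
        using that(3) by (simp add: emeasure_eq_measure ennreal_mult''[symmetric])
      finally have "prob_space (N \<eta>)" by (rule prob_spaceI)
      then show ?thesis
        unfolding real_distribution_def real_distribution_axioms_def using that(2) by (simp add: N_def)
    qed
    have N_int: "(CLINT x|N \<eta>. f x) = (CLINT x|\<eta>. f x) / of_real (measure \<eta> (space \<eta>))"
      if "sets \<eta> = sets borel" "f \<in> borel_measurable borel" for \<eta> and f :: "real \<Rightarrow> complex"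
    proof -
      note [measurable_cong] = that(1)
      have [measurable]: "f \<in> borel_measurable \<eta>" using that(2) by measurable
      show ?thesis
        unfolding N_def by (subst integral_density) (auto simp: scaleR_conv_of_real)
    qed
    \<comment> \<open>A measure of mass 0 has no normalisation. For such \<open>n\<close>, of which
      there are finitely many, the normalised limit is substituted, so that every
      \<open>\<rho> n\<close> is a probability measure.\<close>
    define \<rho> where "\<rho> n = (if m n > 0 then N (\<mu> n) else N \<nu>)" for n
    have ev: "\<forall>\<^sub>F n in sequentially. m n > 0"
      using m_lim \<open>c > 0\<close> by (rule order_tendstoD)
    have lim_m: "(\<lambda>n. of_real (m n) :: complex) \<longlonglongrightarrow> of_real c" using m_lim by (rule tendsto_of_real)
    have "weak_conv_m \<rho> (N \<nu>)"
    proof (rule levy_continuity)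
      show "real_distribution (\<rho> n)" for n
        unfolding \<rho>_def using N_distr[OF \<mu>] N_distr[OF \<nu>] \<open>c > 0\<close> by (auto simp: m_def c_def)
      show "real_distribution (N \<nu>)"
        using N_distr[OF \<nu>] \<open>c > 0\<close> by (auto simp: c_def)
      fix t
      have "(\<lambda>n. (CLINT x|\<mu> n. iexp (t * x)) / of_real (m n)) \<longlonglongrightarrow> (CLINT x|\<nu>. iexp (t * x)) / of_real c"
        using \<open>c > 0\<close> by (intro tendsto_divide lim lim_m) simp
      moreover have "\<forall>\<^sub>F n in sequentially. (CLINT x|\<mu> n. iexp (t * x)) / of_real (m n) = char (\<rho> n) t"
        using ev by eventually_elim (simp add: \<rho>_def char_def N_int[OF \<mu>(2)] m_def)
      ultimately have "(\<lambda>n. char (\<rho> n) t) \<longlonglongrightarrow> (CLINT x|\<nu>. iexp (t * x)) / of_real c"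
        by (rule Lim_transform_eventually)
      then show "(\<lambda>n. char (\<rho> n) t) \<longlonglongrightarrow> char (N \<nu>) t"
        by (simp add: char_def N_int[OF \<nu>(2)] c_def)
    qed
    then have "(\<lambda>n. CLINT x|\<rho> n. v x) \<longlonglongrightarrow> (CLINT x|N \<nu>. v x)"
    proof (rule weak_conv_imp_integral_bdd_continuous_conv[rotated 2])
      show "real_distribution (\<rho> n)" for n
        unfolding \<rho>_def using N_distr[OF \<mu>] N_distr[OF \<nu>] \<open>c > 0\<close> by (auto simp: m_def c_def)
      show "real_distribution (N \<nu>)"
        using N_distr[OF \<nu>] \<open>c > 0\<close> by (auto simp: c_def)
    qed (rule v)+
    then have "(\<lambda>n. (CLINT x|\<rho> n. v x) * of_real (m n)) \<longlonglongrightarrow> (CLINT x|N \<nu>. v x) * of_real c"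
      by (intro tendsto_mult lim_m)
    moreover have "\<forall>\<^sub>F n in sequentially. (CLINT x|\<rho> n. v x) * of_real (m n) = (CLINT x|\<mu> n. v x)"
      using ev by eventually_elim (simp add: \<rho>_def N_int[OF \<mu>(2) vm] m_def)
    ultimately have "(\<lambda>n. CLINT x|\<mu> n. v x) \<longlonglongrightarrow> (CLINT x|N \<nu>. v x) * of_real c"
      by (rule Lim_transform_eventually)
    then show ?thesis
      using \<open>c > 0\<close> by (simp add: N_int[OF \<nu>(2) vm] c_def)
  qed
qed

lemma norm_expectation_le_1:
  fixes f :: "'a \<Rightarrow> complex"
  assumes "prob_space M" "\<And>\<omega>. cmod (f \<omega>) \<le> 1"
  shows "cmod (integral\<^sup>L M f) \<le> 1"
proof (cases "integrable M f")
  case True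
  interpret prob_space M by fact
  have "cmod (integral\<^sup>L M f) \<le> (LINT \<omega>|M. 1)"
    by (intro order_trans[OF integral_norm_bound] integral_mono) (use assms True in auto)
  then show ?thesis by (simp add: prob_space)
qed (simp add: not_integrable_integral_eq)

text \<open>There is no drift and no Gaussian part, so \<open>F\<close> alone determines the law of the process;
  a mass of \<open>F\<close> at \<open>0\<close> is harmless.\<close>

locale fv_levy = prob_space M for M :: "'a measure" +
  fixes X :: "real \<Rightarrow> 'a \<Rightarrow> real" and F :: "real measure"
  assumes levy: "levy_process M X"
    and sets_F [measurable_cong]: "sets F = sets borel"
    and integrable_F: "integrable F (\<lambda>x. x)"
    and char_1: "\<And>z. char (distr M borel (X 1)) z = exp (CLINT x|F. (iexp (z * x) - 1))"
begin

definition levy_exponent :: "real \<Rightarrow> complex" where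
  "levy_exponent z = (CLINT x|F. (iexp (z * x) - 1))"

lemma X_measurable [measurable]: "0 \<le> t \<Longrightarrow> X t \<in> borel_measurable M"
  using levy unfolding levy_process_def by blast

lemma X_cadlag: "\<omega> \<in> space M \<Longrightarrow> cadlag (\<lambda>t. X t \<omega>)"
  using levy unfolding levy_process_def by blast

lemma X_0: "AE \<omega> in M. X 0 \<omega> = 0"
  using levy unfolding levy_process_def by blast

lemma increments_indep:
  "0 \<le> t 0 \<Longrightarrow> mono t \<Longrightarrow> indep_vars (\<lambda>_. borel) (\<lambda>i \<omega>. X (t (Suc i)) \<omega> - X (t i) \<omega>) {..<n}"
  for t :: "nat \<Rightarrow> real" and n :: nat
  using levy unfolding levy_process_def by blast

lemma increments_stationary:
  "0 \<le> s \<Longrightarrow> 0 \<le> h \<Longrightarrow> distr M borel (\<lambda>\<omega>. X (s + h) \<omega> - X s \<omega>) = distr M borel (X h)"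
  using levy unfolding levy_process_def by blast

lemma measurable_F [measurable (raw)]: "f \<in> borel_measurable borel \<Longrightarrow> f \<in> borel_measurable F"
  by (simp cong: measurable_cong_sets add: sets_F)

lemma integrable_linear_bound:
  fixes f :: "real \<Rightarrow> complex"
  assumes [measurable]: "f \<in> borel_measurable borel" and "\<And>x. cmod (f x) \<le> C * \<bar>x\<bar>"
  shows "integrable F f"
proof (rule Bochner_Integration.integrable_bound)
  show "integrable F (\<lambda>x. C * \<bar>x\<bar>)" using integrable_F by auto
  show "AE x in F. norm (f x) \<le> norm (C * \<bar>x\<bar>)"
    using assms(2) order_trans[OF _ abs_ge_self] by (auto simp del: abs_mult)
qed simp

lemma integrable_levy_exponent: "integrable F (\<lambda>x. iexp (z * x) - 1)"
  by (rule integrable_linear_bound[where C="\<bar>z\<bar>"])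
    (auto intro: order_trans[OF norm_iexp_minus_1_le] simp: abs_mult simp del: of_real_mult)

lemma isCont_levy_exponent: "isCont levy_exponent z"
  unfolding continuous_at_sequentially
proof safe
  fix u assume u: "u \<longlonglongrightarrow> z"
  then obtain K where K: "\<And>n. \<bar>u n\<bar> \<le> K"
    using convergentI[OF u, THEN convergent_imp_Bseq] by (auto simp: Bseq_def)
  show "(levy_exponent \<circ> u) \<longlonglongrightarrow> levy_exponent z"
    unfolding comp_def levy_exponent_def
  proof (rule integral_dominated_convergence[where w="\<lambda>x. K * \<bar>x\<bar>"])
    have "cmod (iexp (u n * x) - 1) \<le> K * \<bar>x\<bar>" for n x
      using norm_iexp_minus_1_le[of "u n * x"] mult_right_mono[OF K[of n] abs_ge_zero[of x]]
      by (simp add: abs_mult)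
    then show "AE x in F. cmod (iexp (u n * x) - 1) \<le> K * \<bar>x\<bar>" for n
      by simp
  qed (auto intro!: tendsto_intros u integrable_F integrable_abs)
qed

lemma X_power_char:
  assumes "0 \<le> h"
  shows "char (distr M borel (X (real k * h))) z = char (distr M borel (X h)) z ^ k"
proof -
  define t where "t i = real i * h" for i
  have mono: "mono t" unfolding t_def using assms by (intro monoI mult_right_mono) auto
  have ind: "indep_vars (\<lambda>_. borel) (\<lambda>i \<omega>. X (t (Suc i)) \<omega> - X (t i) \<omega>) {..<k}"
    by (rule increments_indep[OF _ mono]) (simp add: t_def)
  have t0: "0 \<le> t i" for i using assms by (simp add: t_def)
  have d: "distr M borel (\<lambda>\<omega>. X (t (Suc i)) \<omega> - X (t i) \<omega>) = distr M borel (X h)" for i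
    using increments_stationary[OF t0[of i] assms] by (simp add: t_def algebra_simps)
  have "distr M borel (X (real k * h)) = distr M borel (\<lambda>\<omega>. \<Sum>i<k. X (t (Suc i)) \<omega> - X (t i) \<omega>)"
  proof (rule distr_cong_AE)
    show "AE \<omega> in M. X (real k * h) \<omega> = (\<Sum>i<k. X (t (Suc i)) \<omega> - X (t i) \<omega>)"
      using X_0 by eventually_elim (subst sum_lessThan_telescope[of "\<lambda>i. X (t i) _"], simp add: t_def)
  qed (use assms t0 in auto)
  then show ?thesis
    using char_distr_sum[OF ind, of z] by (simp add: d)
qed

text \<open>The quotient of the two sides is a continuous function of \<open>z\<close> whose values are \<open>n\<close>-th roots of
  unity.\<close>

lemma X_char_inverse:
  assumes "0 < n"
  shows "char (distr M borel (X (1 / real n))) z = exp (levy_exponent z / of_nat n)"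
proof -
  interpret D: real_distribution "distr M borel (X (1 / real n))" by simp
  define r where "r z = char (distr M borel (X (1 / real n))) z * exp (- levy_exponent z / of_nat n)" for z
  have "r z ^ n = 1" for z
  proof -
    have "char (distr M borel (X (1 / real n))) z ^ n = exp (levy_exponent z)"
      using X_power_char[of "1 / real n" n z] assms char_1[of z] by (simp add: levy_exponent_def)
    moreover have "exp (- levy_exponent z / of_nat n) ^ n = exp (- levy_exponent z)"
      using assms by (simp add: exp_of_nat_mult[symmetric])
    ultimately show ?thesis by (simp add: r_def power_mult_distrib exp_minus)
  qed
  then have "range r \<subseteq> {x. x ^ n = 1}" by auto
  then have "finite (range r)"
    using finite_roots_unity[of n] assms finite_subset by (metis One_nat_def Suc_leI)
  moreover have "continuous_on UNIV r"
    unfolding r_def using assms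
    by (intro continuous_at_imp_continuous_on ballI continuous_intros D.isCont_char isCont_levy_exponent) auto
  ultimately have "r constant_on UNIV"
    by (intro continuous_finite_range_constant) auto
  then have "r z = r 0" by (auto simp: constant_on_def)
  also have "r 0 = 1" using D.char_zero by (simp add: r_def levy_exponent_def)
  finally show ?thesis by (simp add: r_def exp_minus field_simps)
qed

lemma X_char:
  assumes "0 \<le> t"
  shows "char (distr M borel (X t)) z = exp (of_real t * levy_exponent z)"
proof -
  \<comment> \<open>The floor plus one lets the rational times \<open>q n\<close> approach
    \<open>t\<close> from above, where the paths are continuous; \<open>Suc n\<close> keeps the
    denominator positive.\<close>
  define k where "k n = nat \<lfloor>t * real (Suc n)\<rfloor> + 1" for n
  define q where "q n = real (k n) * (1 / real (Suc n))" for n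
  have q: "t \<le> q n" "q n \<le> t + 1 / real (Suc n)" for n
  proof -
    have "0 \<le> t * real (Suc n)" using assms by simp
    then have "t * real (Suc n) \<le> real (k n)" "real (k n) \<le> t * real (Suc n) + 1"
      unfolding k_def by linarith+
    then have "t \<le> real (k n) / real (Suc n)"
      by (simp only: pos_le_divide_eq of_nat_0_less_iff zero_less_Suc)
    moreover have "real (k n) / real (Suc n) \<le> (t * real (Suc n) + 1) / real (Suc n)"
      using \<open>real (k n) \<le> t * real (Suc n) + 1\<close> of_nat_0_le_iff by (rule divide_right_mono)
    ultimately show "t \<le> q n" "q n \<le> t + 1 / real (Suc n)"
      unfolding q_def by (auto simp: add_divide_distrib simp del: of_nat_Suc)
  qed
  have q_lim: "q \<longlonglongrightarrow> t"
  proof (rule tendsto_sandwich[of "\<lambda>n. t" _ _ "\<lambda>n. t + 1 / real (Suc n)"])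
    show "(\<lambda>n. t + 1 / real (Suc n)) \<longlonglongrightarrow> t"
      using tendsto_add[OF tendsto_const LIMSEQ_Suc[OF lim_1_over_n], of t] by simp
  qed (use q in auto)
  have q0: "0 \<le> q n" for n using q(1)[of n] assms by simp
  have cq: "char (distr M borel (X (q n))) z = exp (of_real (q n) * levy_exponent z)" for n
    unfolding q_def
    by (subst X_power_char) (simp_all add: X_char_inverse del: of_nat_Suc flip: exp_of_nat_mult)
  have 1: "(\<lambda>n. char (distr M borel (X (q n))) z) \<longlonglongrightarrow> exp (of_real t * levy_exponent z)"
    unfolding cq by (intro tendsto_intros q_lim)
  have "(\<lambda>n. CLINT \<omega>|M. iexp (z * X (q n) \<omega>)) \<longlonglongrightarrow> (CLINT \<omega>|M. iexp (z * X t \<omega>))"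
  proof (rule integral_dominated_convergence[where w="\<lambda>_. 1"])
    show "AE \<omega> in M. (\<lambda>n. iexp (z * X (q n) \<omega>)) \<longlonglongrightarrow> iexp (z * X t \<omega>)"
    proof (rule AE_I2)
      fix \<omega> assume "\<omega> \<in> space M"
      then have "(\<lambda>n. X (q n) \<omega>) \<longlonglongrightarrow> X t \<omega>"
        using cadlag_tendsto_right[OF X_cadlag, of \<omega> t q] assms q_lim q(1) by simp
      then show "(\<lambda>n. iexp (z * X (q n) \<omega>)) \<longlonglongrightarrow> iexp (z * X t \<omega>)"
        by (intro tendsto_intros)
    qed
  qed (use assms q0 in auto)
  then have "(\<lambda>n. char (distr M borel (X (q n))) z) \<longlonglongrightarrow> char (distr M borel (X t)) z"
    using assms q0 by (simp add: char_def integral_distr)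
  with 1 show ?thesis using LIMSEQ_unique by blast
qed

lemma X_char_limit:
  assumes "0 \<le> d"
  shows "(\<lambda>n. of_nat n * (char (distr M borel (X (d / real n))) z - 1)) \<longlonglongrightarrow> of_real d * levy_exponent z"
proof -
  have "char (distr M borel (X (d / real n))) z = exp (of_real d * levy_exponent z / of_nat n)" for n
    using X_char[of "d / real n" z] assms by simp
  then show ?thesis using tendsto_n_exp_minus_1[of "of_real d * levy_exponent z"] by simp
qed

end

section \<open>Test functions and sums over jumps\<close>

definition test_fn :: "(real \<Rightarrow> 'b::real_normed_vector) \<Rightarrow> bool" where
  "test_fn h \<longleftrightarrow> continuous_on UNIV h \<and> (\<exists>e>0. \<forall>x. \<bar>x\<bar> \<le> e \<or> 1/e \<le> \<bar>x\<bar> \<longrightarrow> h x = 0)"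

lemma test_fn_measurable: "test_fn h \<Longrightarrow> h \<in> borel_measurable borel"
  unfolding test_fn_def by (auto intro: borel_measurable_continuous_onI)

lemma bounded_of_compact_support:
  fixes v :: "real \<Rightarrow> 'b::real_normed_vector"
  assumes "continuous_on UNIV v" "\<And>x. R \<le> \<bar>x\<bar> \<Longrightarrow> v x = 0"
  obtains B where "\<And>x. norm (v x) \<le> B"
proof -
  have "bounded (v ` {-R..R})"
    using assms(1) by (intro compact_imp_bounded compact_continuous_image) (auto elim: continuous_on_subset)
  then obtain B where B: "\<forall>x\<in>{-R..R}. norm (v x) \<le> B" unfolding bounded_iff by blast
  have "norm (v x) \<le> max B 0" for x
    using bspec[OF B, of x] assms(2)[of x] by (cases "\<bar>x\<bar> \<le> R") (auto simp: abs_le_iff)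
  then show ?thesis using that by blast
qed

lemma test_fn_linear_bound:
  assumes "test_fn h"
  obtains C where "\<And>x. norm (h x) \<le> C * \<bar>x\<bar>"
proof -
  from assms obtain e where e: "e > 0" "\<And>x. \<bar>x\<bar> \<le> e \<or> 1/e \<le> \<bar>x\<bar> \<Longrightarrow> h x = 0"
    and c: "continuous_on UNIV h" by (auto simp: test_fn_def)
  obtain B where B: "\<And>x. norm (h x) \<le> B"
    using bounded_of_compact_support[OF c, of "1/e"] e by blast
  have "norm (h x) \<le> B / e * \<bar>x\<bar>" for x
  proof (cases "\<bar>x\<bar> \<le> e")
    case True
    have "0 \<le> B" using B[of 0] norm_ge_zero order_trans by blast
    then show ?thesis using True e by simp
  next
    case False
    have "B = B / e * e" using e by simp
    also have "\<dots> \<le> B / e * \<bar>x\<bar>"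
      using False e B[of 0] by (intro mult_left_mono) (auto intro: order_trans[OF norm_ge_zero])
    finally show ?thesis using B[of x] by linarith
  qed
  then show ?thesis using that by blast
qed

lemma finite_measure_density_real:
  assumes "integrable N f" "\<And>x. 0 \<le> f x"
  shows "finite_measure (density N (\<lambda>x. ennreal (f x)))"
proof (rule finite_measureI)
  have [measurable]: "f \<in> borel_measurable N" using assms(1) by simp
  have "emeasure (density N (\<lambda>x. ennreal (f x))) (space N) = (\<integral>\<^sup>+x. ennreal (f x) \<partial>N)"
    by (subst emeasure_density) (auto intro!: nn_integral_cong)
  then show "emeasure (density N (\<lambda>x. ennreal (f x))) (space (density N (\<lambda>x. ennreal (f x)))) \<noteq> \<infinity>"
    using nn_integral_eq_integral[OF assms(1)] assms(2) by simp
qed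

text \<open>A second difference in the frequency. The coefficients 1, -1/2, -1/2 sum to 0, so 1 can
  be subtracted from each exponential, and every summand becomes integrable against the possibly
  infinite measure \<open>F\<close>. Fourier transforms of the weighted measures thus reduce to
  \<open>char - 1\<close>, or to the Levy exponent, at \<open>y\<close>, \<open>y + e\<close> and
  \<open>y - e\<close>.\<close>

lemma iexp_scaled_one_minus_cos:
  "complex_of_real (1 - cos (e * x)) * iexp (y * x) =
     (iexp (y * x) - 1) - (iexp ((y + e) * x) - 1) / 2 - (iexp ((y - e) * x) - 1) / 2"
proof -
  have 1: "complex_of_real (cos (e * x)) = (iexp (e * x) + iexp (- (e * x))) / 2"
    by (auto simp: complex_eq_iff Re_exp Im_exp)
  have 2: "iexp ((y + e) * x) = iexp (y * x) * iexp (e * x)" "iexp ((y - e) * x) = iexp (y * x) * iexp (- (e * x))"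
    by (auto simp: exp_add[symmetric] algebra_simps)
  show ?thesis unfolding 2 of_real_diff 1 of_real_1 by (simp add: algebra_simps add_divide_distrib diff_divide_distrib)
qed

definition jump_sum :: "(real \<Rightarrow> 'b::{comm_monoid_add, t2_space}) \<Rightarrow> real \<Rightarrow> real \<Rightarrow> (real \<Rightarrow> real) \<Rightarrow> 'b" where
  "jump_sum h a b \<omega> = (\<Sum>\<^sub>\<infinity>s\<in>{a<..b}. h (jump \<omega> s))"

text \<open>The threshold \<open>e/2\<close> is the one of \<open>sum_increments_tendsto\<close>;
  jumps between \<open>e/2\<close> and \<open>e\<close> contribute 0 to the sum.\<close>

lemma jump_sum_eq_sum:
  fixes h :: "real \<Rightarrow> 'b::real_normed_vector"
  assumes "cadlag \<omega>" "0 \<le> a" "e > 0" "\<And>x. \<bar>x\<bar> \<le> e \<Longrightarrow> h x = 0"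
  shows "jump_sum h a b \<omega> = (\<Sum>s | s \<in> {a<..b} \<and> e/2 \<le> \<bar>jump \<omega> s\<bar>. h (jump \<omega> s))"
proof -
  define S where "S = {s\<in>{a<..b}. e/2 \<le> \<bar>jump \<omega> s\<bar>}"
  have "finite S" unfolding S_def using assms by (intro cadlag_big_jumps_finite) auto
  have "jump_sum h a b \<omega> = (\<Sum>\<^sub>\<infinity>s\<in>S. h (jump \<omega> s))"
    unfolding jump_sum_def
  proof (rule infsum_cong_neutral)
    fix s assume "s \<in> {a<..b} - S"
    then show "h (jump \<omega> s) = 0" using assms(3) by (intro assms(4)) (auto simp: S_def)
  qed (auto simp: S_def)
  also have "\<dots> = (\<Sum>s\<in>S. h (jump \<omega> s))" using \<open>finite S\<close> by simp
  finally show ?thesis by (simp add: S_def)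
qed

lemma jump_sum_tendsto:
  fixes h :: "real \<Rightarrow> 'b::real_normed_vector"
  assumes \<omega>: "cadlag \<omega>" and ab: "0 \<le> a" "a \<le> b" and h: "test_fn h"
  shows "(\<lambda>n. \<Sum>i<n. h (\<omega> (grid a b n (Suc i)) - \<omega> (grid a b n i))) \<longlonglongrightarrow> jump_sum h a b \<omega>"
proof -
  from h obtain e where e: "e > 0" "\<And>x. \<bar>x\<bar> \<le> e \<or> 1/e \<le> \<bar>x\<bar> \<Longrightarrow> h x = 0"
    and c: "continuous_on UNIV h" by (auto simp: test_fn_def)
  show ?thesis
    using sum_increments_tendsto[OF \<omega> ab e(1) c] jump_sum_eq_sum[OF \<omega> ab(1) e(1), of h] e(2) by simp
qed

lemma grid_in: "a \<le> b \<Longrightarrow> i \<le> n \<Longrightarrow> grid a b n i \<in> {a..b}"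
proof -
  assume *: "a \<le> b" "i \<le> n"
  have "(b - a) * (real i / real n) \<le> (b - a) * 1"
    using * by (intro mult_left_mono) (auto simp: divide_le_eq)
  then show ?thesis using * by (simp add: grid_def)
qed

text \<open>As a limit of grid sums the jump sum depends on the path through its values at times in
  \<open>{a..b}\<close>. \<open>Y\<close> and \<open>N\<close> are general because the natural
  filtration later takes the place of \<open>N\<close>, and the lemma then gives
  adaptedness.\<close>

lemma jump_sum_measurable:
  fixes h :: "real \<Rightarrow> 'b::{real_normed_vector, second_countable_topology}"
  assumes Y: "\<And>s. s \<in> {a..b} \<Longrightarrow> Y s \<in> borel_measurable N"
    and cad: "\<And>\<omega>. \<omega> \<in> space N \<Longrightarrow> cadlag (\<lambda>t. Y t \<omega>)"
    and ab: "0 \<le> a" "a \<le> b" and h: "test_fn h"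
  shows "(\<lambda>\<omega>. jump_sum h a b (\<lambda>t. Y t \<omega>)) \<in> borel_measurable N"
proof (rule borel_measurable_LIMSEQ_metric)
  note [measurable] = test_fn_measurable[OF h]
  fix n
  show "(\<lambda>\<omega>. \<Sum>i<n. h (Y (grid a b n (Suc i)) \<omega> - Y (grid a b n i) \<omega>)) \<in> borel_measurable N"
  proof (rule borel_measurable_sum)
    fix i assume "i \<in> {..<n}"
    then have [measurable]: "Y (grid a b n (Suc i)) \<in> borel_measurable N" "Y (grid a b n i) \<in> borel_measurable N"
      using grid_in[OF ab(2), of i n] grid_in[OF ab(2), of "Suc i" n] by (auto intro!: Y)
    show "(\<lambda>\<omega>. h (Y (grid a b n (Suc i)) \<omega> - Y (grid a b n i) \<omega>)) \<in> borel_measurable N"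
      by measurable
  qed
qed (rule jump_sum_tendsto[OF cad ab h])

context fv_levy
begin

lemma integrable_test_fn: "test_fn u \<Longrightarrow> integrable F u" for u :: "real \<Rightarrow> complex"
  by (metis integrable_linear_bound test_fn_linear_bound test_fn_measurable)

text \<open>Weighted by \<open>1 - cos (e * x)\<close>, which is positive on the support of \<open>u\<close>, the measures
  \<open>n\<close> times the law of \<open>X (d / n)\<close> become finite, and their Fourier transforms are combinations of
  characteristic functions of \<open>X (d / n)\<close>. So the continuity theorem applies.\<close>

lemma X_test_fn_limit:
  fixes u :: "real \<Rightarrow> complex"
  assumes u: "test_fn u" and d: "0 \<le> d"
  shows "(\<lambda>n. of_nat n * (CLINT \<omega>|M. u (X (d / real n) \<omega>))) \<longlonglongrightarrow> of_real d * (CLINT x|F. u x)"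
proof -
  from u obtain e where e: "e > 0" "\<And>x. \<bar>x\<bar> \<le> e \<or> 1/e \<le> \<bar>x\<bar> \<Longrightarrow> u x = 0"
    and c: "continuous_on UNIV u" by (auto simp: test_fn_def)
  note [measurable] = test_fn_measurable[OF u]
  \<comment> \<open>For |x| between \<open>e\<close> and \<open>1/e\<close> the argument
    \<open>e * x\<close> has modulus in (0, 1], below pi, so the weight is positive. This is why
    \<open>test_fn\<close> couples its two cut-offs as \<open>e\<close> and
    \<open>1/e\<close>.\<close>
  define w where "w x = 1 - cos (e * x)" for x
  have w0: "0 \<le> w x" "w x \<le> 2" for x
    unfolding w_def using cos_ge_minus_one[of "e * x"] by auto
  have [measurable]: "w \<in> borel_measurable borel" unfolding w_def by measurable
  have w_pos: "0 < w x" if "e \<le> \<bar>x\<bar>" "\<bar>x\<bar> \<le> 1/e" for x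
  proof -
    have "0 < \<bar>e * x\<bar>" "\<bar>e * x\<bar> \<le> 1" using that e(1) by (auto simp: abs_mult field_simps)
    then have "cos \<bar>e * x\<bar> < cos 0"
      using pi_ge_two by (intro cos_monotone_0_pi) linarith+
    then show ?thesis unfolding w_def by (simp only: cos_abs_real cos_zero)
  qed
  \<comment> \<open>The zeros of \<open>w\<close>, at multiples of 2 pi / e, all lie where
    \<open>u\<close> vanishes; division by zero yields 0 there, in agreement with
    \<open>u\<close>.\<close>
  define v where "v x = u x / of_real (w x)" for x
  have wv: "of_real (w x) * v x = u x" for x
  proof (cases "e \<le> \<bar>x\<bar> \<and> \<bar>x\<bar> \<le> 1/e")
    case True then show ?thesis using w_pos[of x] by (simp add: v_def)
  next
    case False then show ?thesis using e(2)[of x] by (auto simp: v_def)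
  qed
  have v_cont: "isCont v x" for x
  proof -
    have uc: "isCont u x" using c by (simp add: continuous_on_eq_continuous_at)
    consider "\<bar>x\<bar> < e" | "1/e < \<bar>x\<bar>" | "e \<le> \<bar>x\<bar>" "\<bar>x\<bar> \<le> 1/e" by linarith
    then show ?thesis
    proof cases
      case 1
      have "\<forall>\<^sub>F y in nhds x. y \<in> {y. \<bar>y\<bar> < e}"
        using 1 by (intro eventually_nhds_in_open open_Collect_less continuous_intros) auto
      then have "\<forall>\<^sub>F y in nhds x. v y = 0" by eventually_elim (auto simp: v_def e(2))
      from isCont_cong[OF this] show ?thesis by simp
    next
      case 2
      have "\<forall>\<^sub>F y in nhds x. y \<in> {y. 1/e < \<bar>y\<bar>}"
        using 2 by (intro eventually_nhds_in_open open_Collect_less continuous_intros) auto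
      then have "\<forall>\<^sub>F y in nhds x. v y = 0" by eventually_elim (auto simp: v_def e(2))
      from isCont_cong[OF this] show ?thesis by simp
    next
      case 3
      then have "complex_of_real (w x) \<noteq> 0" using w_pos[of x] by simp
      then show ?thesis unfolding v_def
        by (intro continuous_divide uc) (auto simp: w_def intro!: continuous_intros)
    qed
  qed
  obtain B where B: "\<And>x. cmod (v x) \<le> B"
  proof (rule bounded_of_compact_support[of v "1/e"])
    show "continuous_on UNIV v" using v_cont by (simp add: continuous_on_eq_continuous_at)
    show "v x = 0" if "1/e \<le> \<bar>x\<bar>" for x using that e(2)[of x] by (simp add: v_def)
  qed blast
  have dn: "0 \<le> d / real n" for n using d by simp
  define D where "D n = distr M borel (X (d / real n))" for n
  have D: "real_distribution (D n)" for n unfolding D_def using dn by simp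
  define \<mu> where "\<mu> n = density (D n) (\<lambda>x. ennreal (real n * w x))" for n
  define \<nu> where "\<nu> = density F (\<lambda>x. ennreal (d * w x))"
  have setsD [measurable_cong]: "sets (D n) = sets borel" for n by (simp add: D_def)
  have \<mu>_int: "(CLINT x|\<mu> n. f x) = of_nat n * (CLINT x|D n. of_real (w x) * f x)"
    if [measurable]: "f \<in> borel_measurable borel" for f :: "real \<Rightarrow> complex" and n
    unfolding \<mu>_def by (subst integral_density) (auto simp: w0 scaleR_conv_of_real mult.assoc)
  have \<nu>_int: "(CLINT x|\<nu>. f x) = of_real d * (CLINT x|F. of_real (w x) * f x)"
    if [measurable]: "f \<in> borel_measurable borel" for f :: "real \<Rightarrow> complex"
    unfolding \<nu>_def by (subst integral_density) (auto simp: w0 d scaleR_conv_of_real mult.assoc)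
  have int_D: "integrable (D n) (\<lambda>x. iexp (z * x) - 1)" for n z
  proof -
    interpret D: real_distribution "D n" by (rule D)
    show ?thesis by (intro Bochner_Integration.integrable_diff D.integrable_iexp) auto
  qed
  have D_char: "(CLINT x|D n. iexp (z * x) - 1) = char (D n) z - 1" for n z
  proof -
    interpret D: real_distribution "D n" by (rule D)
    have "integrable (D n) (\<lambda>x. iexp (z * x))" by (intro D.integrable_iexp) auto
    then show ?thesis using D.prob_space by (simp add: char_def Bochner_Integration.integral_diff del: D.space_eq_univ)
  qed
  have "(\<lambda>n. CLINT x|\<mu> n. v x) \<longlonglongrightarrow> (CLINT x|\<nu>. v x)"
  proof (rule levy_continuity_finite[OF _ _ _ _ _ v_cont B])
    show "finite_measure (\<mu> n)" for n
    proof -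
      interpret D: real_distribution "D n" by (rule D)
      show ?thesis unfolding \<mu>_def
        by (intro finite_measure_density_real D.integrable_const_bound[where B="real n * 2"])
          (auto simp: w0 intro!: mult_left_mono)
    qed
    show "finite_measure \<nu>" unfolding \<nu>_def
    proof (intro finite_measure_density_real)
      \<comment> \<open>The case \<open>y = 0\<close> of the identity writes the weight as a
        combination of three functions that are bounded by multiples of |x|.\<close>
      have "integrable F (\<lambda>x. complex_of_real (1 - cos (e * x)) * iexp (0 * x))"
        unfolding iexp_scaled_one_minus_cos
        by (intro Bochner_Integration.integrable_diff integrable_divide integrable_levy_exponent)
      then have "integrable F (\<lambda>x. complex_of_real (w x))" by (simp add: w_def)
      then show "integrable F (\<lambda>x. d * w x)" by (simp add: complex_of_real_integrable_eq)
    qed (simp add: d w0)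
    show "sets (\<mu> n) = sets borel" "sets \<nu> = sets borel" for n
      by (auto simp: \<mu>_def \<nu>_def D_def sets_F)
    fix y
    have 1: "(CLINT x|\<mu> n. iexp (y * x)) = of_nat n * (char (D n) y - 1)
       - of_nat n * (char (D n) (y + e) - 1) / 2 - of_nat n * (char (D n) (y - e) - 1) / 2" for n
    proof -
      have "(CLINT x|D n. of_real (w x) * iexp (y * x)) =
         (char (D n) y - 1) - (char (D n) (y + e) - 1) / 2 - (char (D n) (y - e) - 1) / 2"
        unfolding w_def iexp_scaled_one_minus_cos
        by (simp add: int_D D_char del: of_real_mult of_real_diff of_real_add)
      then show ?thesis
        by (subst \<mu>_int) (simp_all add: right_diff_distrib)
    qed
    have 2: "(CLINT x|\<nu>. iexp (y * x)) = of_real d * levy_exponent y - of_real d * levy_exponent (y + e) / 2 - of_real d * levy_exponent (y - e) / 2"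
    proof -
      have "(CLINT x|F. of_real (w x) * iexp (y * x)) = levy_exponent y - levy_exponent (y + e) / 2 - levy_exponent (y - e) / 2"
        unfolding w_def iexp_scaled_one_minus_cos
        by (simp add: integrable_levy_exponent levy_exponent_def[symmetric] del: of_real_mult of_real_diff of_real_add)
      then show ?thesis
        by (subst \<nu>_int) (simp_all add: right_diff_distrib)
    qed
    show "(\<lambda>n. CLINT x|\<mu> n. iexp (y * x)) \<longlonglongrightarrow> (CLINT x|\<nu>. iexp (y * x))"
      unfolding 1 2 D_def by (intro tendsto_intros X_char_limit d) auto
  qed
  moreover have [measurable]: "v \<in> borel_measurable borel" unfolding v_def by measurable
  ultimately show ?thesis
    unfolding \<mu>_int[OF \<open>v \<in> borel_measurable borel\<close>] \<nu>_int[OF \<open>v \<in> borel_measurable borel\<close>] wv D_def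
    using dn by (simp add: integral_distr)
qed

end

section \<open>Joint law of increments and jump sums\<close>

text \<open>Truncates small and large arguments at once, continuously. The slopes are such that the
  value increases with \<open>m\<close>, which the monotone convergence in
  \<open>jumps_summable\<close> requires.\<close>

definition cutoff :: "nat \<Rightarrow> real \<Rightarrow> real" where
  "cutoff m x = max 0 (min 1 (min (real (Suc m) * \<bar>x\<bar> - 1) (real (Suc m) - \<bar>x\<bar>)))"

lemma cutoff_bounds: "0 \<le> cutoff m x" "cutoff m x \<le> 1"
  by (auto simp: cutoff_def)

lemma cutoff_mono: "m \<le> n \<Longrightarrow> cutoff m x \<le> cutoff n x"
  unfolding cutoff_def by (intro max.mono min.mono diff_mono mult_right_mono) auto

lemma cutoff_tendsto:
  assumes "x \<noteq> 0"
  shows "(\<lambda>m. cutoff m x) \<longlonglongrightarrow> 1"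
proof (rule tendsto_eventually)
  obtain N :: nat where N: "2 / \<bar>x\<bar> < real N" using reals_Archimedean2 by blast
  obtain N' :: nat where N': "1 + \<bar>x\<bar> < real N'" using reals_Archimedean2 by blast
  show "\<forall>\<^sub>F m in sequentially. cutoff m x = 1"
    using eventually_ge_at_top[of N] eventually_ge_at_top[of N']
  proof eventually_elim
    case (elim m)
    have "2 / \<bar>x\<bar> \<le> real (Suc m)" "1 + \<bar>x\<bar> \<le> real (Suc m)" using N N' elim by linarith+
    then have "2 \<le> real (Suc m) * \<bar>x\<bar>" "1 \<le> real (Suc m) - \<bar>x\<bar>" using assms by (auto simp: divide_le_eq simp del: of_nat_Suc)
    then show ?case unfolding cutoff_def by linarith
  qed
qed

lemma cutoff_eq_0:
  assumes "\<bar>x\<bar> \<le> 1 / real (Suc m) \<or> real (Suc m) \<le> \<bar>x\<bar>"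
  shows "cutoff m x = 0"
proof -
  have "real (Suc m) * \<bar>x\<bar> - 1 \<le> 0 \<or> real (Suc m) - \<bar>x\<bar> \<le> 0"
    using assms by (auto simp: pos_le_divide_eq mult.commute simp del: of_nat_Suc)
  then show ?thesis unfolding cutoff_def by linarith
qed

lemma continuous_on_cutoff: "continuous_on UNIV (cutoff m)"
  unfolding cutoff_def by (intro continuous_intros)

lemma test_fn_cutoff:
  assumes "continuous_on UNIV k"
  shows "test_fn (\<lambda>x. cutoff m x *\<^sub>R k x)"
  unfolding test_fn_def
proof (intro conjI exI allI impI)
  show "continuous_on UNIV (\<lambda>x. cutoff m x *\<^sub>R k x)"
    by (intro continuous_intros assms continuous_on_compose2[OF continuous_on_cutoff]) auto
  show "0 < 1 / real (Suc m)" by simp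
  fix x assume "\<bar>x\<bar> \<le> 1 / real (Suc m) \<or> 1 / (1 / real (Suc m)) \<le> \<bar>x\<bar>"
  then have "cutoff m x = 0" by (intro cutoff_eq_0) auto
  then show "cutoff m x *\<^sub>R k x = 0" by simp
qed

lemma jump_sum_cutoff_eq:
  fixes k :: "real \<Rightarrow> 'b::real_normed_vector"
  assumes "cadlag \<omega>" "0 \<le> a"
  shows "jump_sum (\<lambda>x. cutoff m x *\<^sub>R k x) a b \<omega> =
    (\<Sum>s | s \<in> {a<..b} \<and> 1 / real (Suc m) / 2 \<le> \<bar>jump \<omega> s\<bar>. cutoff m (jump \<omega> s) *\<^sub>R k (jump \<omega> s))"
  by (rule jump_sum_eq_sum[OF assms]) (auto simp: cutoff_eq_0)

lemma cutoff_summable: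
  fixes k :: "real \<Rightarrow> 'b::real_normed_vector"
  assumes "cadlag \<omega>" "0 \<le> a"
  shows "(\<lambda>s. cutoff m (jump \<omega> s) *\<^sub>R k (jump \<omega> s)) summable_on {a<..b}"
proof -
  define S where "S = {s\<in>{a<..b}. 1 / real (Suc m) / 2 \<le> \<bar>jump \<omega> s\<bar>}"
  have "finite S" unfolding S_def using assms by (intro cadlag_big_jumps_finite) auto
  then have "(\<lambda>s. cutoff m (jump \<omega> s) *\<^sub>R k (jump \<omega> s)) summable_on S" by simp
  moreover have "cutoff m (jump \<omega> s) = 0" if "s \<in> {a<..b} - S" for s
  proof -
    have half: "x / 2 \<le> x" if "0 \<le> x" for x :: real using that by simp
    have "1 / real (Suc m) / 2 \<le> 1 / real (Suc m)" by (rule half) simp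
    then show ?thesis using that by (intro cutoff_eq_0 disjI1) (auto simp: S_def simp del: of_nat_Suc)
  qed
  ultimately show ?thesis
    by (subst summable_on_cong_neutral[of S]) (auto simp: S_def)
qed

lemma sum_le_jump_sum_cutoff:
  fixes u :: "real \<Rightarrow> real"
  assumes "cadlag \<omega>" "0 \<le> a" "\<And>x. 0 \<le> u x" "finite S" "S \<subseteq> {a<..b}"
  shows "(\<Sum>s\<in>S. cutoff m (jump \<omega> s) * u (jump \<omega> s)) \<le> jump_sum (\<lambda>x. cutoff m x * u x) a b \<omega>"
  unfolding jump_sum_def
  using cutoff_summable[OF assms(1,2), of m u] assms(3-) by (intro finite_sum_le_infsum) (auto simp: cutoff_bounds)

lemma sum_cutoff_tendsto:
  fixes u :: "real \<Rightarrow> real"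
  assumes "u 0 = 0"
  shows "(\<lambda>m. \<Sum>s\<in>S. cutoff m (j s) * u (j s)) \<longlonglongrightarrow> (\<Sum>s\<in>S. u (j s))"
proof (rule tendsto_sum)
  fix s
  show "(\<lambda>m. cutoff m (j s) * u (j s)) \<longlonglongrightarrow> u (j s)"
    using tendsto_mult[OF cutoff_tendsto tendsto_const, of "j s" "u (j s)"] assms
    by (cases "j s = 0") auto
qed

text \<open>Monotone convergence over an uncountable index set: from below through finite partial
  sums, whose terms converge; from above term by term, as \<open>cutoff m x \<le> 1\<close>. Times
  without a jump are cut off for every \<open>m\<close>, which is consistent because
  \<open>u 0 = 0\<close>.\<close>

lemma jump_sum_cutoff_tendsto:
  fixes u :: "real \<Rightarrow> real"
  assumes cad: "cadlag \<omega>" "0 \<le> a" and u: "\<And>x. 0 \<le> u x" "u 0 = 0"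
    and sm: "(\<lambda>s. u (jump \<omega> s)) summable_on {a<..b}"
  shows "(\<lambda>m. jump_sum (\<lambda>x. cutoff m x * u x) a b \<omega>) \<longlonglongrightarrow> jump_sum u a b \<omega>"
proof (rule order_tendstoI)
  fix y assume y: "y < jump_sum u a b \<omega>"
  have "((\<lambda>S. \<Sum>s\<in>S. u (jump \<omega> s)) \<longlongrightarrow> jump_sum u a b \<omega>) (finite_subsets_at_top {a<..b})"
    using has_sum_infsum[OF sm] by (simp add: has_sum_def jump_sum_def)
  from order_tendstoD(1)[OF this y] obtain S where S: "finite S" "S \<subseteq> {a<..b}" "y < (\<Sum>s\<in>S. u (jump \<omega> s))"
    unfolding eventually_finite_subsets_at_top by blast
  have "\<forall>\<^sub>F m in sequentially. y < (\<Sum>s\<in>S. cutoff m (jump \<omega> s) * u (jump \<omega> s))"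
    using sum_cutoff_tendsto[of u "jump \<omega>" S] u(2) S(3) by (auto intro: order_tendstoD(1))
  then show "\<forall>\<^sub>F m in sequentially. y < jump_sum (\<lambda>x. cutoff m x * u x) a b \<omega>"
    by eventually_elim (rule less_le_trans[OF _ sum_le_jump_sum_cutoff[OF cad u(1) S(1,2)]])
next
  fix y assume y: "jump_sum u a b \<omega> < y"
  have "jump_sum (\<lambda>x. cutoff m x * u x) a b \<omega> \<le> jump_sum u a b \<omega>" for m
    unfolding jump_sum_def
  proof (rule infsum_mono)
    show "(\<lambda>s. cutoff m (jump \<omega> s) * u (jump \<omega> s)) summable_on {a<..b}"
      using cutoff_summable[OF cad, of m u] by simp
  qed (use sm u cutoff_bounds in \<open>auto intro: mult_left_le_one_le\<close>)
  with y show "\<forall>\<^sub>F m in sequentially. jump_sum (\<lambda>x. cutoff m x * u x) a b \<omega> < y"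
    by (intro always_eventually allI) (rule le_less_trans)
qed

text \<open>The bound \<open>K\<close> passes to every finite partial sum as \<open>m\<close> grows.
  It serves twice: for almost sure summability, and to recognise the summable paths by convergence
  of their cut-off sums.\<close>

lemma summable_if_jump_sum_cutoff_bounded:
  fixes u :: "real \<Rightarrow> real"
  assumes cad: "cadlag \<omega>" "0 \<le> a" and u: "\<And>x. 0 \<le> u x" "u 0 = 0"
    and K: "\<And>m. jump_sum (\<lambda>x. cutoff m x * u x) a b \<omega> \<le> K"
  shows "(\<lambda>s. u (jump \<omega> s)) summable_on {a<..b}"
proof (rule nonneg_bdd_above_summable_on)
  show "bdd_above (sum (\<lambda>s. u (jump \<omega> s)) ` {F. F \<subseteq> {a<..b} \<and> finite F})"
  proof (rule bdd_aboveI2)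
    fix S assume S: "S \<in> {F. F \<subseteq> {a<..b} \<and> finite F}"
    show "(\<Sum>s\<in>S. u (jump \<omega> s)) \<le> K"
    proof (rule LIMSEQ_le_const2[OF sum_cutoff_tendsto[of u "jump \<omega>" S, OF u(2)]], intro exI allI impI)
      show "(\<Sum>s\<in>S. cutoff m (jump \<omega> s) * u (jump \<omega> s)) \<le> K" for m
        using order_trans[OF sum_le_jump_sum_cutoff[OF cad u(1)] K] S by blast
    qed
  qed
qed (rule u)

text \<open>The cut-off sums converge exactly on the paths with summable terms, and elsewhere the
  infinite sum has the default value 0. This gives measurability at every path and not only up to a
  null set, as is required for a filtration that is not completed.\<close>

lemma jump_sum_nonneg_measurable:
  fixes u :: "real \<Rightarrow> real"
  assumes Y: "\<And>s. s \<in> {a..b} \<Longrightarrow> Y s \<in> borel_measurable N"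
    and cad: "\<And>\<omega>. \<omega> \<in> space N \<Longrightarrow> cadlag (\<lambda>t. Y t \<omega>)"
    and ab: "0 \<le> a" "a \<le> b" and u: "continuous_on UNIV u" "\<And>x. 0 \<le> u x" "u 0 = 0"
  shows "(\<lambda>\<omega>. jump_sum u a b (\<lambda>t. Y t \<omega>)) \<in> borel_measurable N"
proof -
  define Z where "Z m \<omega> = jump_sum (\<lambda>x. cutoff m x * u x) a b (\<lambda>t. Y t \<omega>)" for m \<omega>
  have [measurable]: "Z m \<in> borel_measurable N" for m
    unfolding Z_def
    by (rule jump_sum_measurable[OF Y cad ab]) (use test_fn_cutoff[OF u(1), of m] in auto)
  have "jump_sum u a b (\<lambda>t. Y t \<omega>) = (if Cauchy (\<lambda>m. Z m \<omega>) then lim (\<lambda>m. Z m \<omega>) else 0)"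
    if "\<omega> \<in> space N" for \<omega>
  proof (cases "(\<lambda>s. u (jump (\<lambda>t. Y t \<omega>) s)) summable_on {a<..b}")
    case True
    then have "(\<lambda>m. Z m \<omega>) \<longlonglongrightarrow> jump_sum u a b (\<lambda>t. Y t \<omega>)"
      unfolding Z_def by (intro jump_sum_cutoff_tendsto cad that ab u)
    then show ?thesis using LIMSEQ_imp_Cauchy limI by metis
  next
    case False
    have "\<not> Cauchy (\<lambda>m. Z m \<omega>)"
    proof
      assume "Cauchy (\<lambda>m. Z m \<omega>)"
      then have "Bseq (\<lambda>m. Z m \<omega>)" by (simp add: Cauchy_convergent convergent_imp_Bseq)
      then obtain K where "\<And>m. \<bar>Z m \<omega>\<bar> \<le> K" by (auto simp: Bseq_def)
      then have "Z m \<omega> \<le> K" for m by (meson abs_le_D1)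
      then show False
        using False summable_if_jump_sum_cutoff_bounded[of "\<lambda>t. Y t \<omega>" a u b K] cad[OF that] ab(1) u(2,3)
        unfolding Z_def by blast
    qed
    then show ?thesis using False by (simp add: jump_sum_def infsum_not_exists)
  qed
  then show ?thesis by (subst measurable_cong) auto
qed

lemma prod_norm_le_1:
  fixes f :: "'i \<Rightarrow> complex"
  assumes "\<And>i. cmod (f i) \<le> 1"
  shows "cmod (\<Prod>i\<in>A. f i) \<le> 1"
  by (simp add: prod_norm[symmetric] prod_le_1 assms)

context fv_levy
begin

abbreviation (input) sample :: "'a \<Rightarrow> real \<Rightarrow> real" where "sample \<omega> \<equiv> (\<lambda>t. X t \<omega>)"

lemma grid_mono: "a \<le> b \<Longrightarrow> mono (grid a b n)"
  unfolding grid_def by (intro monoI add_left_mono mult_left_mono divide_right_mono) auto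

lemma grid_Suc: "grid a b n (Suc i) = grid a b n i + (b - a) / real n"
  by (simp add: grid_def add_divide_distrib distrib_left)

lemma increment_grid_distr:
  assumes "0 \<le> a" "a \<le> b"
  shows "distr M borel (\<lambda>\<omega>. X (grid a b n (Suc i)) \<omega> - X (grid a b n i) \<omega>) = distr M borel (X ((b - a) / real n))"
  unfolding grid_Suc using assms by (intro increments_stationary) (auto simp: grid_def)

lemma grid_nonneg: "0 \<le> a \<Longrightarrow> a \<le> b \<Longrightarrow> 0 \<le> grid a b n i"
  by (simp add: grid_def)

lemma increment_grid_integral:
  fixes f :: "real \<Rightarrow> 'b::{banach, second_countable_topology}"
  assumes ab: "0 \<le> a" "a \<le> b" and [measurable]: "f \<in> borel_measurable borel"
  shows "(LINT \<omega>|M. f (X (grid a b n (Suc i)) \<omega> - X (grid a b n i) \<omega>)) = (LINT \<omega>|M. f (X ((b - a) / real n) \<omega>))"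
proof -
  have [measurable]: "X (grid a b n i) \<in> borel_measurable M" for i using grid_nonneg[OF ab] by simp
  have [measurable]: "X ((b - a) / real n) \<in> borel_measurable M" using ab by simp
  have "(LINT \<omega>|M. f (X (grid a b n (Suc i)) \<omega> - X (grid a b n i) \<omega>)) =
    (LINT x|distr M borel (\<lambda>\<omega>. X (grid a b n (Suc i)) \<omega> - X (grid a b n i) \<omega>). f x)"
    by (subst integral_distr) auto
  then show ?thesis unfolding increment_grid_distr[OF ab] by (subst (asm) integral_distr) auto
qed

lemma sum_grid_increments: "0 < n \<Longrightarrow> (\<Sum>i<n. X (grid a b n (Suc i)) \<omega> - X (grid a b n i) \<omega>) = X b \<omega> - X a \<omega>"
  by (subst sum_lessThan_telescope[of "\<lambda>i. X (grid a b n i) \<omega>"]) (simp add: grid_def)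

text \<open>Over a grid, both the increment and the jump sum become sums over i.i.d. increments, so
  the expectation is the n-th power of \<open>A n\<close>, and \<open>tendsto_power_exp\<close>
  needs only the limit of \<open>n * (A n - 1)\<close>. As \<open>Re (h x)\<close> is nonnegative,
  all products have modulus at most 1, which permits the passage to the limit.\<close>

lemma block_law_test_fn:
  assumes h: "test_fn h" "\<And>x. 0 \<le> Re (h x)" and ab: "0 \<le> a" "a \<le> b"
  shows "(CLINT \<omega>|M. iexp (z * (X b \<omega> - X a \<omega>)) * exp (- jump_sum h a b (sample \<omega>))) =
    exp (of_real (b - a) * (CLINT x|F. iexp (z * x) * exp (- h x) - 1))"
proof -
  define d where "d = b - a"
  have d: "0 \<le> d" using ab by (simp add: d_def)
  define g where "g x = iexp (z * x) * exp (- h x)" for x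
  \<comment> \<open>\<open>g - 1\<close> does not vanish near 0, but its excess \<open>u\<close>
    over \<open>iexp (z * x) - 1\<close> vanishes wherever \<open>h\<close> does. The first part is
    covered by \<open>X_char_limit\<close>, the second by \<open>X_test_fn_limit\<close>.\<close>
  define u where "u x = iexp (z * x) * (exp (- h x) - 1)" for x
  note [measurable] = test_fn_measurable[OF h(1)]
  have g_le: "cmod (g x) \<le> 1" for x using h(2)[of x] by (simp add: g_def norm_mult)
  have [measurable]: "g \<in> borel_measurable borel" unfolding g_def by measurable
  have u: "test_fn u"
    using h(1) unfolding test_fn_def u_def
    by (auto intro!: continuous_intros)
  have gu: "g x - 1 = (iexp (z * x) - 1) + u x" for x by (simp add: g_def u_def algebra_simps)
  have dn: "0 \<le> d / real n" for n using d by simp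
  have [measurable]: "X (d / real n) \<in> borel_measurable M" for n using dn by simp
  define A where "A n = (CLINT \<omega>|M. g (X (d / real n) \<omega>))" for n
  have int_iexp: "integrable M (\<lambda>\<omega>. iexp (z * X (d / real n) \<omega>))" for n
    by (intro integrable_const_bound[where B=1]) auto
  have int_g: "integrable M (\<lambda>\<omega>. g (X (d / real n) \<omega>))" for n
    by (intro integrable_const_bound[where B=1]) (auto simp: g_le)
  have "A n - 1 = (char (distr M borel (X (d / real n))) z - 1) + (CLINT \<omega>|M. u (X (d / real n) \<omega>))" for n
  proof -
    have "u x = g x - iexp (z * x)" for x by (simp add: g_def u_def algebra_simps)
    then have "(CLINT \<omega>|M. u (X (d / real n) \<omega>)) = A n - (CLINT \<omega>|M. iexp (z * X (d / real n) \<omega>))"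
      using Bochner_Integration.integral_diff[OF int_g int_iexp] by (simp add: A_def)
    then show ?thesis by (simp add: char_def integral_distr)
  qed
  then have eq: "of_nat n * (A n - 1) = of_nat n * (char (distr M borel (X (d / real n))) z - 1)
      + of_nat n * (CLINT \<omega>|M. u (X (d / real n) \<omega>))" for n
    by (simp only: distrib_left)
  have "(\<lambda>n. of_nat n * (A n - 1)) \<longlonglongrightarrow> of_real d * levy_exponent z + of_real d * (CLINT x|F. u x)"
    unfolding eq by (intro tendsto_add X_char_limit X_test_fn_limit d u)
  also have "of_real d * levy_exponent z + of_real d * (CLINT x|F. u x) = of_real d * (CLINT x|F. g x - 1)"
    unfolding gu levy_exponent_def by (subst Bochner_Integration.integral_add) (auto simp: distrib_left integrable_levy_exponent integrable_test_fn[OF u] simp del: of_real_mult)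
  finally have "(\<lambda>n. A n ^ n) \<longlonglongrightarrow> exp (of_real d * (CLINT x|F. g x - 1))"
  proof (rule tendsto_power_exp[rotated])
    show "cmod (A n) \<le> 1" for n
      unfolding A_def by (rule norm_expectation_le_1[OF prob_space_axioms g_le])
  qed
  moreover
  define G where "G n \<omega> = (\<Prod>i<n. g (X (grid a b n (Suc i)) \<omega> - X (grid a b n i) \<omega>))" for n \<omega>
  have [measurable]: "X (grid a b n i) \<in> borel_measurable M" for n i using grid_nonneg[OF ab] by simp
  have "(CLINT \<omega>|M. G n \<omega>) = A n ^ n" for n
  proof -
    have "indep_vars (\<lambda>_. borel) (\<lambda>i \<omega>. X (grid a b n (Suc i)) \<omega> - X (grid a b n i) \<omega>) {..<n}"
      by (rule increments_indep[OF grid_nonneg[OF ab] grid_mono[OF ab(2)]])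
    then have "indep_vars (\<lambda>_. borel) (\<lambda>i \<omega>. g (X (grid a b n (Suc i)) \<omega> - X (grid a b n i) \<omega>)) {..<n}"
      by (rule indep_vars_compose2) measurable
    moreover have "integrable M (\<lambda>\<omega>. g (X (grid a b n (Suc i)) \<omega> - X (grid a b n i) \<omega>))" for i
      by (intro integrable_const_bound[where B=1]) (auto simp: g_le)
    ultimately show ?thesis
      unfolding G_def by (subst indep_vars_lebesgue_integral) (simp_all add: increment_grid_integral[OF ab] A_def d_def)
  qed
  moreover have "(\<lambda>n. CLINT \<omega>|M. G n \<omega>) \<longlonglongrightarrow> (CLINT \<omega>|M. iexp (z * (X b \<omega> - X a \<omega>)) * exp (- jump_sum h a b (sample \<omega>)))"
  proof (rule integral_dominated_convergence[where w="\<lambda>_. 1"])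
    show "AE \<omega> in M. (\<lambda>n. G n \<omega>) \<longlonglongrightarrow> iexp (z * (X b \<omega> - X a \<omega>)) * exp (- jump_sum h a b (sample \<omega>))"
    proof (rule AE_I2)
      fix \<omega> assume "\<omega> \<in> space M"
      have "(\<lambda>n. iexp (z * (X b \<omega> - X a \<omega>)) * exp (- (\<Sum>i<n. h (X (grid a b n (Suc i)) \<omega> - X (grid a b n i) \<omega>))))
         \<longlonglongrightarrow> iexp (z * (X b \<omega> - X a \<omega>)) * exp (- jump_sum h a b (sample \<omega>))"
        by (intro tendsto_intros jump_sum_tendsto[OF X_cadlag[OF \<open>\<omega> \<in> space M\<close>] ab h(1)])
      moreover have "\<forall>\<^sub>F n in sequentially. iexp (z * (X b \<omega> - X a \<omega>)) * exp (- (\<Sum>i<n. h (X (grid a b n (Suc i)) \<omega> - X (grid a b n i) \<omega>))) = G n \<omega>"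
        using eventually_gt_at_top[of 0]
      proof eventually_elim
        case (elim n)
        show ?case
          unfolding sum_grid_increments[OF elim, of a b \<omega>, symmetric] G_def g_def
          by (simp add: prod.distrib exp_sum[symmetric] sum_distrib_left sum_negf)
      qed
      ultimately show "(\<lambda>n. G n \<omega>) \<longlonglongrightarrow> iexp (z * (X b \<omega> - X a \<omega>)) * exp (- jump_sum h a b (sample \<omega>))"
        by (rule Lim_transform_eventually)
    qed
    have [measurable]: "(\<lambda>\<omega>. jump_sum h a b (sample \<omega>)) \<in> borel_measurable M"
      by (rule jump_sum_measurable[OF X_measurable X_cadlag ab h(1)]) (use ab in auto)
    have [measurable]: "X a \<in> borel_measurable M" "X b \<in> borel_measurable M" using ab by auto
    show "(\<lambda>\<omega>. iexp (z * (X b \<omega> - X a \<omega>)) * exp (- jump_sum h a b (sample \<omega>))) \<in> borel_measurable M"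
      by measurable
    show "G n \<in> borel_measurable M" for n unfolding G_def by measurable
    show "AE \<omega> in M. cmod (G n \<omega>) \<le> 1" for n
      unfolding G_def by (intro AE_I2 prod_norm_le_1 g_le)
  qed auto
  ultimately show ?thesis
    unfolding g_def d_def using LIMSEQ_unique by simp
qed

text \<open>Fatou's lemma along the grids; an upper bound is all that the summability of the jumps
  asks for.\<close>

lemma expectation_jump_sum_le:
  fixes u :: "real \<Rightarrow> real"
  assumes u: "test_fn u" "\<And>x. 0 \<le> u x" and ab: "0 \<le> a" "a \<le> b"
  shows "(\<integral>\<^sup>+\<omega>. ennreal (jump_sum u a b (sample \<omega>)) \<partial>M) \<le> ennreal ((b - a) * (LINT x|F. u x))"
proof -
  define d where "d = b - a"
  have d: "0 \<le> d" using ab by (simp add: d_def)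
  note [measurable] = test_fn_measurable[OF u(1)]
  have dn: "0 \<le> d / real n" for n using d by simp
  have [measurable]: "X (d / real n) \<in> borel_measurable M" for n using dn by simp
  have [measurable]: "X (grid a b n i) \<in> borel_measurable M" for n i using grid_nonneg[OF ab] by simp
  have uc: "test_fn (\<lambda>x. complex_of_real (u x))"
    using u(1) unfolding test_fn_def by (auto intro!: continuous_intros)
  obtain B where B: "\<And>x. norm (u x) \<le> B"
    using u(1) bounded_of_compact_support[of u] unfolding test_fn_def by metis
  define Y where "Y n \<omega> = (\<Sum>i<n. u (X (grid a b n (Suc i)) \<omega> - X (grid a b n i) \<omega>))" for n \<omega>
  have Y0: "0 \<le> Y n \<omega>" for n \<omega> unfolding Y_def by (intro sum_nonneg u(2))
  have [measurable]: "Y n \<in> borel_measurable M" for n unfolding Y_def by measurable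
  have int_u: "integrable M (\<lambda>\<omega>. u (X (grid a b n (Suc i)) \<omega> - X (grid a b n i) \<omega>))" for n i
    by (intro integrable_const_bound[where B=B]) (use B in auto)
  have EY: "(\<integral>\<^sup>+\<omega>. ennreal (Y n \<omega>) \<partial>M) = ennreal (real n * (LINT \<omega>|M. u (X (d / real n) \<omega>)))" for n
  proof -
    have "(LINT \<omega>|M. Y n \<omega>) = real n * (LINT \<omega>|M. u (X (d / real n) \<omega>))"
      unfolding Y_def by (simp add: int_u increment_grid_integral[OF ab] d_def)
    moreover have "integrable M (Y n)" unfolding Y_def by (simp add: int_u)
    ultimately show ?thesis using nn_integral_eq_integral[of M "Y n"] Y0 by simp
  qed
  have "(\<lambda>n. complex_of_real (real n * (LINT \<omega>|M. u (X (d / real n) \<omega>)))) \<longlonglongrightarrow> complex_of_real (d * (LINT x|F. u x))"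
    using X_test_fn_limit[OF uc d] by simp
  then have "(\<lambda>n. real n * (LINT \<omega>|M. u (X (d / real n) \<omega>))) \<longlonglongrightarrow> d * (LINT x|F. u x)"
    by (simp only: tendsto_of_real_iff)
  then have lim: "(\<lambda>n. ennreal (real n * (LINT \<omega>|M. u (X (d / real n) \<omega>)))) \<longlonglongrightarrow> ennreal (d * (LINT x|F. u x))"
    by (rule tendsto_ennrealI)
  have "(\<integral>\<^sup>+\<omega>. ennreal (jump_sum u a b (sample \<omega>)) \<partial>M) = (\<integral>\<^sup>+\<omega>. liminf (\<lambda>n. ennreal (Y n \<omega>)) \<partial>M)"
  proof (rule nn_integral_cong)
    fix \<omega> assume "\<omega> \<in> space M"
    from jump_sum_tendsto[OF X_cadlag[OF this] ab u(1)]
    have "(\<lambda>n. ennreal (Y n \<omega>)) \<longlonglongrightarrow> ennreal (jump_sum u a b (sample \<omega>))"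
      unfolding Y_def by (rule tendsto_ennrealI)
    then show "ennreal (jump_sum u a b (sample \<omega>)) = liminf (\<lambda>n. ennreal (Y n \<omega>))"
      by (intro lim_imp_Liminf[symmetric]) auto
  qed
  also have "\<dots> \<le> liminf (\<lambda>n. \<integral>\<^sup>+\<omega>. ennreal (Y n \<omega>) \<partial>M)"
    by (rule nn_integral_liminf) measurable
  also have "\<dots> = ennreal (d * (LINT x|F. u x))"
    unfolding EY by (intro lim_imp_Liminf lim) auto
  finally show ?thesis by (simp add: d_def)
qed

text \<open>The expected cut-off sum of |jumps| is at most \<open>(b - a) * I\<close> with the first
  absolute moment \<open>I\<close> of \<open>F\<close>, uniformly in \<open>m\<close>. By monotone
  convergence the supremum over \<open>m\<close> is then finite almost surely.\<close>

lemma jumps_summable: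
  assumes ab: "0 \<le> a" "a \<le> b"
  shows "AE \<omega> in M. (\<lambda>s. \<bar>jump (sample \<omega>) s\<bar>) summable_on {a<..b}"
proof -
  define u where "u m x = cutoff m x * \<bar>x\<bar>" for m and x :: real
  have u: "test_fn (u m)" "0 \<le> u m x" for m x
    unfolding u_def using test_fn_cutoff[OF continuous_on_rabs[OF continuous_on_id], of m]
    by (auto simp: cutoff_bounds)
  define I where "I = (LINT x|F. \<bar>x\<bar>)"
  have I: "(LINT x|F. u m x) \<le> I" for m
    unfolding I_def
  proof (rule integral_mono)
    have [measurable]: "u m \<in> borel_measurable borel" using u(1) by (rule test_fn_measurable)
    show "integrable F (u m)"
      by (rule Bochner_Integration.integrable_bound[OF integrable_abs[OF integrable_F]])
        (auto simp: u_def abs_mult cutoff_bounds intro!: AE_I2 mult_left_le_one_le)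
    show "u m x \<le> \<bar>x\<bar>" for x by (auto simp: u_def cutoff_bounds intro: mult_left_le_one_le)
  qed (rule integrable_abs[OF integrable_F])
  have [measurable]: "(\<lambda>\<omega>. jump_sum (u m) a b (sample \<omega>)) \<in> borel_measurable M" for m
    by (rule jump_sum_measurable[OF X_measurable X_cadlag ab u(1)]) (use ab in auto)
  have mono: "jump_sum (u m) a b (sample \<omega>) \<le> jump_sum (u n) a b (sample \<omega>)" if "m \<le> n" "\<omega> \<in> space M" for m n \<omega>
    unfolding jump_sum_def
  proof (rule infsum_mono)
    have *: "(\<lambda>s. u m (jump (sample \<omega>) s)) summable_on {a<..b}" for m
      using cutoff_summable[OF X_cadlag[OF that(2)] ab(1), of m "\<lambda>x. \<bar>x\<bar>"] by (simp add: u_def)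
    show "(\<lambda>s. u m (jump (sample \<omega>) s)) summable_on {a<..b}"
      "(\<lambda>s. u n (jump (sample \<omega>) s)) summable_on {a<..b}" by (rule *)+
  qed (use cutoff_mono[OF that(1)] in \<open>auto simp: u_def intro: mult_right_mono\<close>)
  \<comment> \<open>Outside \<open>space M\<close> the path need not be cadlag and monotonicity in
    \<open>m\<close> may fail; the indicator makes \<open>V\<close> increasing at every
    point.\<close>
  define V where "V m \<omega> = ennreal (jump_sum (u m) a b (sample \<omega>)) * indicator (space M) \<omega>" for m \<omega>
  have [measurable]: "V m \<in> borel_measurable M" for m unfolding V_def by measurable
  have "(\<integral>\<^sup>+\<omega>. (SUP m. V m \<omega>) \<partial>M) = (SUP m. \<integral>\<^sup>+\<omega>. V m \<omega> \<partial>M)"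
  proof (rule nn_integral_monotone_convergence_SUP)
    show "incseq V"
      by (intro incseq_SucI le_funI) (auto simp: V_def intro!: ennreal_leI mono split: split_indicator)
  qed simp
  also have "\<dots> \<le> ennreal ((b - a) * I)"
  proof (rule SUP_least)
    fix m
    have "(\<integral>\<^sup>+\<omega>. V m \<omega> \<partial>M) = (\<integral>\<^sup>+\<omega>. ennreal (jump_sum (u m) a b (sample \<omega>)) \<partial>M)"
      by (intro nn_integral_cong) (simp add: V_def)
    also have "\<dots> \<le> ennreal ((b - a) * (LINT x|F. u m x))" by (rule expectation_jump_sum_le[OF u ab])
    also have "\<dots> \<le> ennreal ((b - a) * I)" using I ab by (intro ennreal_leI mult_left_mono) auto
    finally show "(\<integral>\<^sup>+\<omega>. V m \<omega> \<partial>M) \<le> ennreal ((b - a) * I)" .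
  qed
  finally have "(\<integral>\<^sup>+\<omega>. (SUP m. V m \<omega>) \<partial>M) \<noteq> \<infinity>" by (auto simp: top_unique)
  then have "AE \<omega> in M. (SUP m. V m \<omega>) \<noteq> \<infinity>"
    by (intro nn_integral_PInf_AE) measurable
  then show ?thesis
  proof (rule AE_mp, intro AE_I2 impI)
    fix \<omega> assume \<omega>: "\<omega> \<in> space M" and fin: "(SUP m. V m \<omega>) \<noteq> \<infinity>"
    then obtain K where K: "0 \<le> K" "(SUP m. V m \<omega>) = ennreal K" by (cases "SUP m. V m \<omega>") auto
    have "V m \<omega> \<le> ennreal K" for m unfolding K(2)[symmetric] by (rule SUP_upper) auto
    then have "jump_sum (u m) a b (sample \<omega>) \<le> K" for m using \<omega> K(1) by (simp add: V_def ennreal_le_iff)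
    then show "(\<lambda>s. \<bar>jump (sample \<omega>) s\<bar>) summable_on {a<..b}"
      unfolding u_def by (intro summable_if_jump_sum_cutoff_bounded[OF X_cadlag[OF \<omega>] ab(1)]) auto
  qed
qed

end

text \<open>\<open>bislope_jumps\<close> is written with the two real sums, not as the sum of \<open>bislope\<close> over the jumps:
  where the jumps are not summable the two may disagree, and the real sums are limits of their cut-off
  versions or \<open>0\<close>, hence measurable.\<close>

definition bislope :: "'b \<Rightarrow> 'b \<Rightarrow> real \<Rightarrow> 'b::real_normed_vector" where
  "bislope c c' x = max 0 x *\<^sub>R c + max 0 (- x) *\<^sub>R c'"

definition bislope_jumps :: "'b \<Rightarrow> 'b \<Rightarrow> real \<Rightarrow> real \<Rightarrow> (real \<Rightarrow> real) \<Rightarrow> 'b::real_normed_vector" where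
  "bislope_jumps c c' a b \<omega> = jump_sum (max 0) a b \<omega> *\<^sub>R c + jump_sum (\<lambda>x. max 0 (- x)) a b \<omega> *\<^sub>R c'"

lemma continuous_on_bislope: "continuous_on UNIV (bislope c c')"
  unfolding bislope_def by (intro continuous_intros)

lemma norm_bislope_le: "norm (bislope c c' x) \<le> (norm c + norm c') * \<bar>x\<bar>"
proof -
  have "norm (bislope c c' x) \<le> \<bar>x\<bar> * norm c + \<bar>x\<bar> * norm c'"
    unfolding bislope_def by (rule order_trans[OF norm_triangle_ineq]) (auto intro!: add_mono mult_right_mono)
  then show ?thesis by (simp add: algebra_simps)
qed

lemma bislope_nonneg: "0 \<le> c \<Longrightarrow> 0 \<le> c' \<Longrightarrow> 0 \<le> bislope c c' x" for c :: real
  by (simp add: bislope_def)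

lemma Re_bislope_nonneg: "0 \<le> Re c \<Longrightarrow> 0 \<le> Re c' \<Longrightarrow> 0 \<le> Re (bislope c c' x)"
  by (simp add: bislope_def)

lemma jump_sum_nonneg: "(\<And>x. 0 \<le> u x) \<Longrightarrow> 0 \<le> jump_sum u a b \<omega>" for u :: "real \<Rightarrow> real"
  unfolding jump_sum_def by (rule infsum_nonneg)

lemma bislope_jumps_nonneg: "0 \<le> c \<Longrightarrow> 0 \<le> c' \<Longrightarrow> 0 \<le> bislope_jumps c c' a b \<omega>" for c :: real
  by (simp add: bislope_jumps_def jump_sum_nonneg)

lemma bislope_jumps_measurable:
  fixes c c' :: "'b::{real_normed_vector, second_countable_topology}"
  assumes "\<And>s. s \<in> {a..b} \<Longrightarrow> Y s \<in> borel_measurable N" "\<And>\<omega>. \<omega> \<in> space N \<Longrightarrow> cadlag (\<lambda>t. Y t \<omega>)"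
    and "0 \<le> a" "a \<le> b"
  shows "(\<lambda>\<omega>. bislope_jumps c c' a b (\<lambda>t. Y t \<omega>)) \<in> borel_measurable N"
proof -
  have [measurable]: "(\<lambda>\<omega>. jump_sum (max 0) a b (\<lambda>t. Y t \<omega>)) \<in> borel_measurable N"
    "(\<lambda>\<omega>. jump_sum (\<lambda>x. max 0 (- x)) a b (\<lambda>t. Y t \<omega>)) \<in> borel_measurable N"
    by (rule jump_sum_nonneg_measurable[OF assms]; auto intro!: continuous_intros)+
  show ?thesis unfolding bislope_jumps_def by measurable
qed

lemma jump_sum_cutoff_bislope_tendsto:
  assumes cad: "cadlag \<omega>" "0 \<le> a" and sm: "(\<lambda>s. \<bar>jump \<omega> s\<bar>) summable_on {a<..b}"
  shows "(\<lambda>m. jump_sum (\<lambda>x. cutoff m x *\<^sub>R bislope c c' x) a b \<omega>) \<longlonglongrightarrow> bislope_jumps c c' a b \<omega>"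
proof -
  have eq: "jump_sum (\<lambda>x. cutoff m x *\<^sub>R bislope c c' x) a b \<omega> =
     jump_sum (\<lambda>x. cutoff m x * max 0 x) a b \<omega> *\<^sub>R c + jump_sum (\<lambda>x. cutoff m x * max 0 (- x)) a b \<omega> *\<^sub>R c'" for m
    using jump_sum_cutoff_eq[OF cad, of m "bislope c c'" b] jump_sum_cutoff_eq[OF cad, of m "max 0" b]
      jump_sum_cutoff_eq[OF cad, of m "\<lambda>x. max 0 (- x)" b]
    by (simp add: bislope_def scaleR_add_right sum.distrib scaleR_sum_left)
  have "(\<lambda>s. max 0 (jump \<omega> s)) summable_on {a<..b}" "(\<lambda>s. max 0 (- jump \<omega> s)) summable_on {a<..b}"
    by (rule summable_on_comparison_test[OF sm]; auto)+
  then show ?thesis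
    unfolding eq bislope_jumps_def by (intro tendsto_intros jump_sum_cutoff_tendsto cad) auto
qed

text \<open>Additivity rests on summability: without it the sum over the long interval may be the
  default 0 while a sum over a part of it is not.\<close>

lemma bislope_jumps_split:
  assumes sm: "(\<lambda>s. \<bar>jump \<omega> s\<bar>) summable_on {a<..d}" and "a \<le> b" "b \<le> d"
  shows "bislope_jumps c c' a d \<omega> = bislope_jumps c c' a b \<omega> + bislope_jumps c c' b d \<omega>"
proof -
  have un: "{a<..d} = {a<..b} \<union> {b<..d}" using assms by auto
  have split: "jump_sum u a d \<omega> = jump_sum u a b \<omega> + jump_sum u b d \<omega>"
    if "\<And>x. 0 \<le> u x" "\<And>x. u x \<le> \<bar>x\<bar>" for u :: "real \<Rightarrow> real"
  proof -
    have s: "(\<lambda>s. u (jump \<omega> s)) summable_on {a<..d}"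
      by (rule summable_on_comparison_test[OF sm]) (use that in auto)
    show ?thesis unfolding jump_sum_def un
      by (rule infsum_Un_disjoint) (auto intro: summable_on_subset_banach[OF s] simp: un)
  qed
  show ?thesis unfolding bislope_jumps_def by (simp add: split algebra_simps)
qed

text \<open>Levy's uniqueness theorem for weighted laws. \<open>Y\<close> and \<open>Z\<close> are
  arbitrary, since the lemma is applied to increments of the process and, in
  \<open>esscher_moment\<close>, to jump sums.\<close>

lemma tilted_distr_eq:
  assumes P: "integrable P W" "\<And>x. 0 \<le> W x" "(LINT x|P. W x) = 1" "Y \<in> borel_measurable P"
    and Q: "integrable Q V" "\<And>x. 0 \<le> V x" "(LINT x|Q. V x) = 1" "Z \<in> borel_measurable Q"
    and eq: "\<And>z. (CLINT x|P. iexp (z * Y x) * of_real (W x)) = (CLINT x|Q. iexp (z * Z x) * of_real (V x))"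
  shows "distr (density P (\<lambda>x. ennreal (W x))) borel Y = distr (density Q (\<lambda>x. ennreal (V x))) borel Z"
proof -
  have distr: "real_distribution (distr (density P (\<lambda>x. ennreal (W x))) borel Y)"
    if "integrable P W" "\<And>x. 0 \<le> W x" "(LINT x|P. W x) = 1" "Y \<in> borel_measurable P" for P :: "'c measure" and W Y
  proof -
    have [measurable]: "W \<in> borel_measurable P" using that(1) by simp
    have "prob_space (density P (\<lambda>x. ennreal (W x)))"
    proof (rule prob_spaceI)
      have "emeasure (density P (\<lambda>x. ennreal (W x))) (space P) = (\<integral>\<^sup>+x. ennreal (W x) \<partial>P)"
        by (subst emeasure_density) (auto intro!: nn_integral_cong)
      then show "emeasure (density P (\<lambda>x. ennreal (W x))) (space (density P (\<lambda>x. ennreal (W x)))) = 1"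
        using nn_integral_eq_integral[OF that(1)] that(2,3) by simp
    qed
    then interpret prob_space "density P (\<lambda>x. ennreal (W x))" .
    show ?thesis using that(4) by (intro real_distribution_distr) simp
  qed
  have char: "char (distr (density P (\<lambda>x. ennreal (W x))) borel Y) z = (CLINT x|P. iexp (z * Y x) * of_real (W x))"
    if "integrable P W" "\<And>x. 0 \<le> W x" "Y \<in> borel_measurable P" for P :: "'c measure" and W Y z
  proof -
    have [measurable]: "W \<in> borel_measurable P" "Y \<in> borel_measurable P" using that by auto
    show ?thesis
      unfolding char_def
      by (subst integral_distr, simp, simp, subst integral_density)
        (auto simp: that scaleR_conv_of_real mult.commute)
  qed
  show ?thesis
  proof (rule Levy_uniqueness)
    show "real_distribution (distr (density P (\<lambda>x. ennreal (W x))) borel Y)" by (rule distr[OF P])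
    show "real_distribution (distr (density Q (\<lambda>x. ennreal (V x))) borel Z)" by (rule distr[OF Q])
    show "char (distr (density P (\<lambda>x. ennreal (W x))) borel Y) = char (distr (density Q (\<lambda>x. ennreal (V x))) borel Z)"
      using eq by (auto simp: char P Q)
  qed
qed

text \<open>Block \<open>l\<close> uses the variables with indices from \<open>l * n\<close> up to
  \<open>l * n + n - 1\<close>. Functions of disjoint groups of independent variables are
  independent, and the bound 1 on each factor makes it integrable.\<close>

lemma indep_vars_block_product:
  fixes D :: "nat \<Rightarrow> 'a \<Rightarrow> real" and f :: "nat \<Rightarrow> real \<Rightarrow> real" and h :: "real \<Rightarrow> real"
  assumes M: "prob_space M" and ind: "prob_space.indep_vars M (\<lambda>_. borel) D {..<m * n}"
    and f: "\<And>l. f l \<in> borel_measurable borel" "\<And>l x. \<bar>f l x\<bar> \<le> 1"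
    and h: "h \<in> borel_measurable borel" "\<And>x. 0 \<le> h x"
  shows "(LINT \<omega>|M. (\<Prod>l<m. f l (\<Sum>j<n. D (l * n + j) \<omega>) * exp (- (\<Sum>j<n. h (D (l * n + j) \<omega>))))) =
     (\<Prod>l<m. LINT \<omega>|M. f l (\<Sum>j<n. D (l * n + j) \<omega>) * exp (- (\<Sum>j<n. h (D (l * n + j) \<omega>))))"
proof -
  interpret prob_space M by fact
  note [measurable] = f(1) h(1)
  define K where "K l = (\<lambda>j. l * n + j) ` {..<n}" for l
  have sub: "K l \<subseteq> {..<m * n}" if "l \<in> {..<m}" for l
  proof -
    have "l * n + n \<le> m * n" using that mult_le_mono1[of "Suc l" m n] by simp
    then show ?thesis unfolding K_def by auto
  qed
  have div: "i div n = l" if "i \<in> K l" for i l using that unfolding K_def by auto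
  have disj: "disjoint_family_on K {..<m}"
    unfolding disjoint_family_on_def using div by blast
  define Y where "Y l x = f l (\<Sum>i\<in>K l. x i) * exp (- (\<Sum>i\<in>K l. h (x i)))" for l and x :: "nat \<Rightarrow> real"
  have Y_eq: "Y l (restrict x (K l)) = f l (\<Sum>j<n. x (l * n + j)) * exp (- (\<Sum>j<n. h (x (l * n + j))))" for l x
    unfolding Y_def K_def by (subst (1 2) sum.reindex) (auto simp: inj_on_def)
  have "indep_vars (\<lambda>l. PiM (K l) (\<lambda>_. borel)) (\<lambda>l \<omega>. restrict (\<lambda>i. D i \<omega>) (K l)) {..<m}"
    by (rule indep_vars_restrict[OF ind sub disj])
  then have *: "indep_vars (\<lambda>_. borel) (\<lambda>l \<omega>. Y l (restrict (\<lambda>i. D i \<omega>) (K l))) {..<m}"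
    by (rule indep_vars_compose2) (unfold Y_def, measurable)
  have le: "\<bar>f l (\<Sum>j<n. x (l * n + j)) * exp (- (\<Sum>j<n. h (x (l * n + j))))\<bar> \<le> 1" for l x
    using f(2)[of l] h(2) by (auto simp: abs_mult intro!: mult_le_one sum_nonneg)
  have eq: "f l (\<Sum>j<n. D (l * n + j) \<omega>) * exp (- (\<Sum>j<n. h (D (l * n + j) \<omega>))) =
      Y l (restrict (\<lambda>i. D i \<omega>) (K l))" for l \<omega>
    by (rule Y_eq[symmetric])
  show ?thesis
    unfolding eq
  proof (rule indep_vars_lebesgue_integral[OF _ *])
    fix l assume "l \<in> {..<m}"
    with * have "(\<lambda>\<omega>. Y l (restrict (\<lambda>i. D i \<omega>) (K l))) \<in> borel_measurable M"
      by (auto simp: indep_vars_def)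
    moreover have "\<bar>Y l (restrict (\<lambda>i. D i \<omega>) (K l))\<bar> \<le> 1" for \<omega>
      unfolding Y_eq by (rule le)
    ultimately show "integrable M (\<lambda>\<omega>. Y l (restrict (\<lambda>i. D i \<omega>) (K l)))"
      by (intro integrable_const_bound[where B=1]) auto
  qed simp
qed

text \<open>Cuts every interval from \<open>\<tau> l\<close> to \<open>\<tau> (Suc l)\<close> into
  \<open>n\<close> cells under one running index, because independence of increments is available
  along a single monotone sequence of times.\<close>

definition subgrid :: "(nat \<Rightarrow> real) \<Rightarrow> nat \<Rightarrow> nat \<Rightarrow> real" where
  "subgrid \<tau> n i = grid (\<tau> (i div n)) (\<tau> (Suc (i div n))) n (i mod n)"

text \<open>The case \<open>j = n\<close> is included: there the index already belongs to block
  \<open>Suc l\<close>, and the two descriptions of \<open>\<tau> (Suc l)\<close> agree. So the last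
  increment of a block is written like all others.\<close>

lemma subgrid_eq:
  assumes "j \<le> n" "0 < n"
  shows "subgrid \<tau> n (l * n + j) = grid (\<tau> l) (\<tau> (Suc l)) n j"
proof (cases "j = n")
  case True
  have "(l * n + n) div n = Suc l" using assms by simp
  then show ?thesis using True assms by (simp add: subgrid_def grid_def)
next
  case False
  then show ?thesis using assms by (simp add: subgrid_def)
qed

lemma subgrid_mono:
  assumes "mono \<tau>" "0 < n"
  shows "mono (subgrid \<tau> n)"
proof (rule incseq_SucI)
  fix i
  define l j where "l = i div n" and "j = i mod n"
  have i: "i = l * n + j" and j: "j < n" using assms by (auto simp: l_def j_def)
  have "subgrid \<tau> n (l * n + j) \<le> subgrid \<tau> n (l * n + Suc j)"
    using j assms incseq_SucD[OF assms(1), of l]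
    by (subst (1 2) subgrid_eq) (auto simp: grid_def intro!: mult_left_mono divide_right_mono)
  then show "subgrid \<tau> n i \<le> subgrid \<tau> n (Suc i)" by (simp add: i)
qed

context fv_levy
begin

lemma bislope_jumps_measurable_at:
  fixes c c' :: "'b::{real_normed_vector, second_countable_topology}"
  assumes "0 \<le> a" "a \<le> b"
  shows "(\<lambda>\<omega>. bislope_jumps c c' a b (sample \<omega>)) \<in> borel_measurable M"
  using assms by (intro bislope_jumps_measurable X_measurable X_cadlag) auto

lemma block_law:
  fixes c c' :: complex
  assumes c: "0 \<le> Re c" "0 \<le> Re c'" and ab: "0 \<le> a" "a \<le> b"
  shows "(CLINT \<omega>|M. iexp (z * (X b \<omega> - X a \<omega>)) * exp (- bislope_jumps c c' a b (sample \<omega>))) =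
    exp (of_real (b - a) * (CLINT x|F. iexp (z * x) * exp (- bislope c c' x) - 1))"
proof -
  define h where "h m x = cutoff m x *\<^sub>R bislope c c' x" for m x
  have h: "test_fn (h m)" "0 \<le> Re (h m x)" for m x
    unfolding h_def using cutoff_bounds Re_bislope_nonneg[OF c] by (auto intro!: test_fn_cutoff continuous_on_bislope)
  note [measurable] = test_fn_measurable[OF h(1)] borel_measurable_continuous_onI[OF continuous_on_bislope]
  have [measurable]: "X a \<in> borel_measurable M" "X b \<in> borel_measurable M" using ab by auto
  note [measurable] = bislope_jumps_measurable_at[OF ab, of c c']
  have [measurable]: "(\<lambda>\<omega>. jump_sum (h m) a b (sample \<omega>)) \<in> borel_measurable M" for m
    by (rule jump_sum_measurable[OF X_measurable X_cadlag ab h(1)]) (use ab in auto)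
  have Re_jsum: "0 \<le> Re (jump_sum (h m) a b (sample \<omega>))" if "\<omega> \<in> space M" for m \<omega>
    unfolding h_def jump_sum_cutoff_eq[OF X_cadlag[OF that] ab(1)]
    using cutoff_bounds Re_bislope_nonneg[OF c] by (auto intro!: sum_nonneg)
  have 1: "(\<lambda>m. CLINT \<omega>|M. iexp (z * (X b \<omega> - X a \<omega>)) * exp (- jump_sum (h m) a b (sample \<omega>)))
     \<longlonglongrightarrow> (CLINT \<omega>|M. iexp (z * (X b \<omega> - X a \<omega>)) * exp (- bislope_jumps c c' a b (sample \<omega>)))"
  proof (rule integral_dominated_convergence[where w="\<lambda>_. 1"])
    show "AE \<omega> in M. (\<lambda>m. iexp (z * (X b \<omega> - X a \<omega>)) * exp (- jump_sum (h m) a b (sample \<omega>)))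
       \<longlonglongrightarrow> iexp (z * (X b \<omega> - X a \<omega>)) * exp (- bislope_jumps c c' a b (sample \<omega>))"
      using jumps_summable[OF ab]
      by (rule AE_mp, intro AE_I2 impI, unfold h_def) (intro tendsto_intros jump_sum_cutoff_bislope_tendsto X_cadlag ab)
    show "AE \<omega> in M. cmod (iexp (z * (X b \<omega> - X a \<omega>)) * exp (- jump_sum (h m) a b (sample \<omega>))) \<le> 1" for m
      using Re_jsum by (intro AE_I2) (simp add: norm_mult)
  qed auto
  have 2: "(\<lambda>m. CLINT x|F. iexp (z * x) * exp (- h m x) - 1) \<longlonglongrightarrow> (CLINT x|F. iexp (z * x) * exp (- bislope c c' x) - 1)"
  proof (rule integral_dominated_convergence[where w="\<lambda>x. (2 * (\<bar>z\<bar> + (norm c + norm c'))) * \<bar>x\<bar>"])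
    show "AE x in F. (\<lambda>m. iexp (z * x) * exp (- h m x) - 1) \<longlonglongrightarrow> iexp (z * x) * exp (- bislope c c' x) - 1"
    proof (intro AE_I2)
      fix x
      have "(\<lambda>m. h m x) \<longlonglongrightarrow> bislope c c' x"
        using tendsto_scaleR[OF cutoff_tendsto tendsto_const, of x "bislope c c' x"]
        by (cases "x = 0") (simp_all add: h_def bislope_def)
      then show "(\<lambda>m. iexp (z * x) * exp (- h m x) - 1) \<longlonglongrightarrow> iexp (z * x) * exp (- bislope c c' x) - 1"
        by (intro tendsto_intros)
    qed
    show "AE x in F. cmod (iexp (z * x) * exp (- h m x) - 1) \<le> (2 * (\<bar>z\<bar> + (norm c + norm c'))) * \<bar>x\<bar>" for m
    proof (intro AE_I2)
      fix x
      have "cmod (h m x) \<le> cmod (bislope c c' x)"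
        unfolding h_def using cutoff_bounds[of m x] by (simp add: mult_left_le_one_le)
      also have "\<dots> \<le> (norm c + norm c') * \<bar>x\<bar>" by (rule norm_bislope_le)
      finally have hx: "cmod (h m x) \<le> (norm c + norm c') * \<bar>x\<bar>" .
      have "iexp (z * x) * exp (- h m x) = exp (\<i> * of_real (z * x) - h m x)" by (simp add: exp_diff exp_minus field_simps)
      then have "cmod (iexp (z * x) * exp (- h m x) - 1) \<le> 2 * cmod (\<i> * of_real (z * x) - h m x)"
        using norm_exp_minus_1_le[of "\<i> * of_real (z * x) - h m x"] h(2)[of m x] by simp
      also have "\<dots> \<le> 2 * (\<bar>z\<bar> * \<bar>x\<bar> + (norm c + norm c') * \<bar>x\<bar>)"
        using norm_triangle_ineq4[of "\<i> * of_real (z * x)" "h m x"] hx by (simp add: norm_mult abs_mult)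
      finally show "cmod (iexp (z * x) * exp (- h m x) - 1) \<le> (2 * (\<bar>z\<bar> + (norm c + norm c'))) * \<bar>x\<bar>"
        by (simp add: algebra_simps)
    qed
    show "integrable F (\<lambda>x. (2 * (\<bar>z\<bar> + (norm c + norm c'))) * \<bar>x\<bar>)"
      by (intro integrable_mult_right integrable_abs integrable_F)
  qed measurable
  have "(\<lambda>m. CLINT \<omega>|M. iexp (z * (X b \<omega> - X a \<omega>)) * exp (- jump_sum (h m) a b (sample \<omega>)))
     \<longlonglongrightarrow> exp (of_real (b - a) * (CLINT x|F. iexp (z * x) * exp (- bislope c c' x) - 1))"
    unfolding block_law_test_fn[OF h ab] by (intro tendsto_intros 2)
  with 1 show ?thesis using LIMSEQ_unique by blast
qed

text \<open>Independence is known for increments, while a jump sum depends on the whole path in its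
  block. So the factorization is carried out for the grid sums of each block, with
  \<open>\<tau>\<close> fixed, and survives the refinement because all factors are bounded by
  1.\<close>

lemma blocks_factorize_test_fn:
  fixes f :: "nat \<Rightarrow> real \<Rightarrow> real" and h :: "real \<Rightarrow> real"
  assumes \<tau>: "mono \<tau>" "0 \<le> \<tau> 0"
    and f: "\<And>l. f l \<in> borel_measurable borel" "\<And>l x. \<bar>f l x\<bar> \<le> 1"
    and h: "test_fn h" "\<And>x. 0 \<le> h x"
  shows "(LINT \<omega>|M. (\<Prod>l<m. f l (X (\<tau> (Suc l)) \<omega> - X (\<tau> l) \<omega>) * exp (- jump_sum h (\<tau> l) (\<tau> (Suc l)) (sample \<omega>)))) =
    (\<Prod>l<m. LINT \<omega>|M. f l (X (\<tau> (Suc l)) \<omega> - X (\<tau> l) \<omega>) * exp (- jump_sum h (\<tau> l) (\<tau> (Suc l)) (sample \<omega>)))"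
proof -
  note [measurable] = f(1) test_fn_measurable[OF h(1)]
  have \<tau>0: "0 \<le> \<tau> l" "\<tau> l \<le> \<tau> (Suc l)" for l
    using \<tau> monoD[OF \<tau>(1), of 0 l] incseq_SucD[OF \<tau>(1)] by auto
  have [measurable]: "X (\<tau> l) \<in> borel_measurable M" for l using \<tau>0 by simp
  have [measurable]: "X (grid (\<tau> l) (\<tau> (Suc l)) n j) \<in> borel_measurable M" for l n j
    using grid_nonneg[OF \<tau>0] by simp
  define W where "W n l \<omega> = f l (X (\<tau> (Suc l)) \<omega> - X (\<tau> l) \<omega>) *
    exp (- (\<Sum>j<n. h (X (grid (\<tau> l) (\<tau> (Suc l)) n (Suc j)) \<omega> - X (grid (\<tau> l) (\<tau> (Suc l)) n j) \<omega>)))" for n l \<omega>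
  define V where "V l \<omega> = f l (X (\<tau> (Suc l)) \<omega> - X (\<tau> l) \<omega>) * exp (- jump_sum h (\<tau> l) (\<tau> (Suc l)) (sample \<omega>))" for l \<omega>
  have [measurable]: "W n l \<in> borel_measurable M" for n l unfolding W_def by measurable
  have [measurable]: "(\<lambda>\<omega>. jump_sum h (\<tau> l) (\<tau> (Suc l)) (sample \<omega>)) \<in> borel_measurable M" for l
    by (rule jump_sum_measurable[OF X_measurable X_cadlag \<tau>0 h(1)]) (use \<tau>0(1)[of l] in auto)
  have [measurable]: "V l \<in> borel_measurable M" for l unfolding V_def by measurable
  have W_le: "\<bar>W n l \<omega>\<bar> \<le> 1" for n l \<omega>
    unfolding W_def using f(2)[of l] h(2) by (auto simp: abs_mult intro!: mult_le_one sum_nonneg)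
  have W_lim: "(\<lambda>n. W n l \<omega>) \<longlonglongrightarrow> V l \<omega>" if "\<omega> \<in> space M" for l \<omega>
    unfolding W_def V_def by (intro tendsto_intros jump_sum_tendsto[OF X_cadlag[OF that] \<tau>0 h(1)])
  have fact: "(LINT \<omega>|M. (\<Prod>l<m. W n l \<omega>)) = (\<Prod>l<m. LINT \<omega>|M. W n l \<omega>)" if n: "0 < n" for n
  proof -
    define D where "D i \<omega> = X (subgrid \<tau> n (Suc i)) \<omega> - X (subgrid \<tau> n i) \<omega>" for i \<omega>
    have D_eq: "D (l * n + j) \<omega> = X (grid (\<tau> l) (\<tau> (Suc l)) n (Suc j)) \<omega> - X (grid (\<tau> l) (\<tau> (Suc l)) n j) \<omega>"
      if "j < n" for l j \<omega>
      using subgrid_eq[of j n \<tau> l] subgrid_eq[of "Suc j" n \<tau> l] that n by (simp add: D_def)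
    have "(\<Sum>j<n. D (l * n + j) \<omega>) = X (\<tau> (Suc l)) \<omega> - X (\<tau> l) \<omega>" for l \<omega>
      using sum_grid_increments[OF n, of "\<tau> l" "\<tau> (Suc l)" \<omega>] by (simp add: D_eq)
    then have W_eq: "W n l \<omega> = f l (\<Sum>j<n. D (l * n + j) \<omega>) * exp (- (\<Sum>j<n. h (D (l * n + j) \<omega>)))" for l \<omega>
      by (simp add: W_def D_eq)
    have "indep_vars (\<lambda>_. borel) D {..<m * n}"
      unfolding D_def
    proof (rule increments_indep[OF _ subgrid_mono[OF \<tau>(1) n]])
      show "0 \<le> subgrid \<tau> n 0" using \<tau>(2) by (simp add: subgrid_def grid_def)
    qed
    then show ?thesis
      unfolding W_eq by (rule indep_vars_block_product[OF prob_space_axioms _ f _ h(2)]) measurable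
  qed
  have "(\<lambda>n. LINT \<omega>|M. (\<Prod>l<m. W n l \<omega>)) \<longlonglongrightarrow> (LINT \<omega>|M. (\<Prod>l<m. V l \<omega>))"
  proof (rule integral_dominated_convergence[where w="\<lambda>_. 1"])
    show "AE \<omega> in M. norm (\<Prod>l<m. W n l \<omega>) \<le> 1" for n
      by (intro AE_I2) (simp add: abs_prod prod_le_1 W_le)
    show "AE \<omega> in M. (\<lambda>n. \<Prod>l<m. W n l \<omega>) \<longlonglongrightarrow> (\<Prod>l<m. V l \<omega>)"
      by (intro AE_I2 tendsto_prod W_lim)
  qed measurable
  moreover have "(\<lambda>n. \<Prod>l<m. LINT \<omega>|M. W n l \<omega>) \<longlonglongrightarrow> (\<Prod>l<m. LINT \<omega>|M. V l \<omega>)"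
  proof (rule tendsto_prod, rule integral_dominated_convergence[where w="\<lambda>_. 1"])
    show "AE \<omega> in M. norm (W n l \<omega>) \<le> 1" for n l by (intro AE_I2) (simp add: W_le)
    show "AE \<omega> in M. (\<lambda>n. W n l \<omega>) \<longlonglongrightarrow> V l \<omega>" for l by (intro AE_I2 W_lim)
  qed auto
  moreover have "\<forall>\<^sub>F n in sequentially. (LINT \<omega>|M. (\<Prod>l<m. W n l \<omega>)) = (\<Prod>l<m. LINT \<omega>|M. W n l \<omega>)"
    using eventually_gt_at_top[of 0] by eventually_elim (rule fact)
  ultimately have "(LINT \<omega>|M. (\<Prod>l<m. V l \<omega>)) = (\<Prod>l<m. LINT \<omega>|M. V l \<omega>)"
    using LIMSEQ_unique Lim_transform_eventually by fast
  then show ?thesis unfolding V_def .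
qed

lemma blocks_factorize:
  fixes f :: "nat \<Rightarrow> real \<Rightarrow> real"
  assumes \<tau>: "mono \<tau>" "0 \<le> \<tau> 0"
    and f: "\<And>l. f l \<in> borel_measurable borel" "\<And>l x. \<bar>f l x\<bar> \<le> 1"
    and p: "0 \<le> p" "0 \<le> p'"
  shows "(LINT \<omega>|M. (\<Prod>l<m. f l (X (\<tau> (Suc l)) \<omega> - X (\<tau> l) \<omega>) * exp (- bislope_jumps p p' (\<tau> l) (\<tau> (Suc l)) (sample \<omega>)))) =
    (\<Prod>l<m. LINT \<omega>|M. f l (X (\<tau> (Suc l)) \<omega> - X (\<tau> l) \<omega>) * exp (- bislope_jumps p p' (\<tau> l) (\<tau> (Suc l)) (sample \<omega>)))"
proof -
  define h where "h k x = cutoff k x *\<^sub>R bislope p p' x" for k x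
  have h: "test_fn (h k)" "0 \<le> h k x" for k x
    unfolding h_def using test_fn_cutoff[OF continuous_on_bislope, of k p p'] cutoff_bounds bislope_nonneg[OF p]
    by simp_all
  note [measurable] = f(1)
  have \<tau>0: "0 \<le> \<tau> l" "\<tau> l \<le> \<tau> (Suc l)" for l
    using \<tau> monoD[OF \<tau>(1), of 0 l] incseq_SucD[OF \<tau>(1)] by auto
  have [measurable]: "X (\<tau> l) \<in> borel_measurable M" for l using \<tau>0 by simp
  define W where "W k l \<omega> = f l (X (\<tau> (Suc l)) \<omega> - X (\<tau> l) \<omega>) * exp (- jump_sum (h k) (\<tau> l) (\<tau> (Suc l)) (sample \<omega>))" for k l \<omega>
  define V where "V l \<omega> = f l (X (\<tau> (Suc l)) \<omega> - X (\<tau> l) \<omega>) * exp (- bislope_jumps p p' (\<tau> l) (\<tau> (Suc l)) (sample \<omega>))" for l \<omega>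
  have [measurable]: "(\<lambda>\<omega>. jump_sum (h k) (\<tau> l) (\<tau> (Suc l)) (sample \<omega>)) \<in> borel_measurable M" for k l
    by (rule jump_sum_measurable[OF X_measurable X_cadlag \<tau>0 h(1)]) (use \<tau>0(1)[of l] in auto)
  note [measurable] = bislope_jumps_measurable_at[OF \<tau>0, of p p']
  have [measurable]: "W k l \<in> borel_measurable M" "V l \<in> borel_measurable M" for k l
    unfolding W_def V_def by measurable
  have W_le: "\<bar>W k l \<omega>\<bar> \<le> 1" for k l \<omega>
    unfolding W_def using f(2)[of l] jump_sum_nonneg[OF h(2)] by (auto simp: abs_mult intro!: mult_le_one)
  have W_lim: "AE \<omega> in M. (\<lambda>k. W k l \<omega>) \<longlonglongrightarrow> V l \<omega>" for l
    using jumps_summable[OF \<tau>0]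
    by (rule AE_mp, intro AE_I2 impI, unfold h_def W_def V_def) (intro tendsto_intros jump_sum_cutoff_bislope_tendsto X_cadlag \<tau>0)
  have "(\<lambda>k. LINT \<omega>|M. (\<Prod>l<m. W k l \<omega>)) \<longlonglongrightarrow> (LINT \<omega>|M. (\<Prod>l<m. V l \<omega>))"
  proof (rule integral_dominated_convergence[where w="\<lambda>_. 1"])
    show "AE \<omega> in M. norm (\<Prod>l<m. W n l \<omega>) \<le> 1" for n
      by (intro AE_I2) (simp add: abs_prod prod_le_1 W_le)
    have "AE \<omega> in M. \<forall>l. (\<lambda>n. W n l \<omega>) \<longlonglongrightarrow> V l \<omega>"
      using W_lim by (simp add: AE_all_countable)
    then show "AE \<omega> in M. (\<lambda>n. \<Prod>l<m. W n l \<omega>) \<longlonglongrightarrow> (\<Prod>l<m. V l \<omega>)"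
      by eventually_elim (intro tendsto_prod, simp)
  qed measurable
  moreover have "(\<lambda>n. \<Prod>l<m. LINT \<omega>|M. W n l \<omega>) \<longlonglongrightarrow> (\<Prod>l<m. LINT \<omega>|M. V l \<omega>)"
  proof (rule tendsto_prod, rule integral_dominated_convergence[where w="\<lambda>_. 1"])
    show "AE \<omega> in M. norm (W n l \<omega>) \<le> 1" for n l by (intro AE_I2) (simp add: W_le)
  qed (use W_lim in auto)
  ultimately have "(LINT \<omega>|M. (\<Prod>l<m. V l \<omega>)) = (\<Prod>l<m. LINT \<omega>|M. V l \<omega>)"
    unfolding W_def using blocks_factorize_test_fn[OF \<tau> f h] LIMSEQ_unique by simp
  then show ?thesis unfolding V_def .
qed

lemma bislope_jumps_sum_blocks:
  fixes c c' :: "'b::real_normed_vector"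
  assumes \<tau>: "mono \<tau>" "0 \<le> \<tau> 0"
  shows "AE \<omega> in M. (\<Sum>l<m. bislope_jumps c c' (\<tau> l) (\<tau> (Suc l)) (sample \<omega>)) = bislope_jumps c c' (\<tau> 0) (\<tau> m) (sample \<omega>)"
proof (induction m)
  case 0
  show ?case by (simp add: bislope_jumps_def jump_sum_def)
next
  case (Suc m)
  have "\<tau> 0 \<le> \<tau> m" "\<tau> m \<le> \<tau> (Suc m)" using monoD[OF \<tau>(1)] by auto
  then have "AE \<omega> in M. (\<lambda>s. \<bar>jump (sample \<omega>) s\<bar>) summable_on {\<tau> 0<..\<tau> (Suc m)}"
    using \<tau> by (intro jumps_summable) auto
  with Suc show ?case
    by eventually_elim (simp add: bislope_jumps_split[OF _ \<open>\<tau> 0 \<le> \<tau> m\<close> \<open>\<tau> m \<le> \<tau> (Suc m)\<close>])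
qed

end

text \<open>The endpoint 0 lets the values of the process be recovered from increments, and the
  endpoint \<open>t\<close> makes the blocks exhaust \<open>{0..t}\<close>, the interval of the
  tilt. After index \<open>m\<close> the sequence stays constant, so that it is monotone on all
  naturals.\<close>

lemma finite_times_mono:
  fixes t :: real
  assumes "finite S" "S \<subseteq> {0..t}" "0 \<le> t"
  obtains \<tau> m where "mono \<tau>" "\<tau> 0 = 0" "\<tau> m = t" "S \<subseteq> \<tau> ` {..m::nat}"
proof -
  define xs where "xs = sorted_list_of_set (insert 0 (insert t S))"
  have set: "set xs = insert 0 (insert t S)" and so: "sorted xs"
    unfolding xs_def using assms(1) by (simp_all only: finite_insert set_sorted_list_of_set sorted_sorted_list_of_set)
  define m where "m = length xs - 1"
  have len: "length xs = Suc m" using set unfolding m_def by (cases xs) auto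
  define \<tau> where "\<tau> i = xs ! (min i m)" for i
  have mono: "mono \<tau>"
    unfolding \<tau>_def using so len by (intro monoI sorted_nth_mono) (auto intro: min.mono)
  have range: "0 \<le> \<tau> i" "\<tau> i \<le> t" for i
  proof -
    have "\<tau> i \<in> set xs" unfolding \<tau>_def using len by (intro nth_mem) simp
    then show "0 \<le> \<tau> i" "\<tau> i \<le> t" using set assms by auto
  qed
  have all: "set xs \<subseteq> \<tau> ` {..m}"
  proof
    fix x assume "x \<in> set xs"
    then obtain i where "i < length xs" "x = xs ! i" by (auto simp: in_set_conv_nth)
    then show "x \<in> \<tau> ` {..m}" using len by (auto simp: \<tau>_def intro!: image_eqI[of _ _ i])
  qed
  have "\<tau> 0 = 0"
  proof -
    have "0 \<in> \<tau> ` {..m}" using all set by auto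
    then obtain i where "\<tau> i = 0" by force
    then show ?thesis using monoD[OF mono, of 0 i] range(1)[of 0] by simp
  qed
  moreover have "\<tau> m = t"
  proof -
    have "t \<in> \<tau> ` {..m}" using all set by auto
    then obtain i where "i \<le> m" "\<tau> i = t" by force
    then show ?thesis using monoD[OF mono, of i m] range(2)[of m] by simp
  qed
  ultimately show ?thesis using that mono all set by blast
qed

section \<open>Exponential tilting\<close>

text \<open>The tilted measures are known to agree on \<open>F\<close> only. Since \<open>W\<close>
  and \<open>V\<close> are themselves \<open>F\<close>-measurable, the weight \<open>V\<close> can
  be divided out without leaving \<open>F\<close>.\<close>

lemma restr_to_subalg_tilt_quotient:
  fixes W V :: "'a \<Rightarrow> real"
  assumes sub: "subalgebra M F" and sets: "sets N = sets M"
    and [measurable]: "W \<in> borel_measurable F" "V \<in> borel_measurable F"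
    and pos: "\<And>x. 0 < W x" "\<And>x. 0 < V x"
    and eq: "\<And>A. A \<in> sets F \<Longrightarrow> emeasure (density M (\<lambda>x. ennreal (W x))) A = emeasure (density N (\<lambda>x. ennreal (V x))) A"
  shows "restr_to_subalg N F = density (restr_to_subalg M F) (\<lambda>x. ennreal (W x / V x))"
proof (rule measure_eqI)
  have subN: "subalgebra N F"
    using sub sets sets_eq_imp_space_eq[OF sets] by (simp add: subalgebra_def)
  show "sets (restr_to_subalg N F) = sets (density (restr_to_subalg M F) (\<lambda>x. ennreal (W x / V x)))"
    by (simp add: sets_restr_to_subalg sub subN)
  fix A assume "A \<in> sets (restr_to_subalg N F)"
  then have A[measurable]: "A \<in> sets F" by (simp add: sets_restr_to_subalg subN)
  have mM: "f \<in> borel_measurable F \<Longrightarrow> f \<in> borel_measurable M" and mN: "f \<in> borel_measurable F \<Longrightarrow> f \<in> borel_measurable N"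
    for f :: "'a \<Rightarrow> real"
    using measurable_from_subalg[OF sub] measurable_from_subalg[OF subN] by auto
  have mM': "f \<in> borel_measurable F \<Longrightarrow> f \<in> borel_measurable M" and mN': "f \<in> borel_measurable F \<Longrightarrow> f \<in> borel_measurable N"
    for f :: "'a \<Rightarrow> ennreal"
    using measurable_from_subalg[OF sub] measurable_from_subalg[OF subN] by auto
  have W: "W \<in> borel_measurable M" and V: "V \<in> borel_measurable N" by (simp_all add: mM mN)
  define DM where "DM = density M (\<lambda>x. ennreal (W x))"
  define DN where "DN = density N (\<lambda>x. ennreal (V x))"
  have subD: "subalgebra DM F" "subalgebra DN F"
    using sub subN by (auto simp: subalgebra_def DM_def DN_def)
  have DD: "restr_to_subalg DM F = restr_to_subalg DN F"
    by (rule measure_eqI) (simp_all add: sets_restr_to_subalg subD emeasure_restr_to_subalg eq DM_def[symmetric] DN_def[symmetric] eq[folded DM_def DN_def])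
  \<comment> \<open>Integrated against the \<open>V\<close>-tilt of \<open>N\<close> this gives the
    mass of \<open>A\<close> under \<open>N\<close>; against the \<open>W\<close>-tilt of
    \<open>M\<close> it gives the integral of \<open>W / V\<close> over \<open>A\<close>.\<close>
  define f where "f x = indicator A x * ennreal (1 / V x)" for x
  have f[measurable]: "f \<in> borel_measurable F" unfolding f_def by measurable
  have AN: "A \<in> sets N" using A subN by (auto simp: subalgebra_def)
  have "emeasure (restr_to_subalg N F) A = (\<integral>\<^sup>+x. indicator A x \<partial>N)"
    using AN by (simp add: emeasure_restr_to_subalg[OF subN A])
  also have "\<dots> = (\<integral>\<^sup>+x. ennreal (V x) * f x \<partial>N)"
    using pos(2) by (intro nn_integral_cong) (auto simp: f_def ennreal_mult[symmetric] less_imp_le less_imp_neq[symmetric] split: split_indicator)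
  also have "\<dots> = (\<integral>\<^sup>+x. f x \<partial>DN)"
    unfolding DN_def using V by (subst nn_integral_density) (auto intro: mN' f)
  also have "\<dots> = (\<integral>\<^sup>+x. f x \<partial>restr_to_subalg DN F)" by (simp add: nn_integral_subalgebra2[OF subD(2)])
  also have "\<dots> = (\<integral>\<^sup>+x. f x \<partial>DM)" unfolding DD[symmetric] by (simp add: nn_integral_subalgebra2[OF subD(1)])
  also have "\<dots> = (\<integral>\<^sup>+x. ennreal (W x) * f x \<partial>M)"
    unfolding DM_def using W by (subst nn_integral_density) (auto intro: mM' f)
  also have "\<dots> = (\<integral>\<^sup>+x. ennreal (W x / V x) * indicator A x \<partial>M)"
    using pos by (intro nn_integral_cong) (auto simp: f_def ennreal_mult[symmetric] less_imp_le split: split_indicator)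
  also have "\<dots> = (\<integral>\<^sup>+x. ennreal (W x / V x) * indicator A x \<partial>restr_to_subalg M F)"
    by (intro nn_integral_subalgebra2[OF sub, symmetric]) measurable
  also have "\<dots> = emeasure (density (restr_to_subalg M F) (\<lambda>x. ennreal (W x / V x))) A"
  proof (rule emeasure_density[symmetric])
    show "(\<lambda>x. ennreal (W x / V x)) \<in> borel_measurable (restr_to_subalg M F)"
      by (rule measurable_in_subalg[OF sub]) measurable
  qed (simp add: sets_restr_to_subalg sub)
  finally show "emeasure (restr_to_subalg N F) A = emeasure (density (restr_to_subalg M F) (\<lambda>x. ennreal (W x / V x))) A" .
qed

context fv_levy
begin

text \<open>The Laplace exponent per unit time of the jump sums weighted by \<open>p\<close> and
  \<open>p'\<close>; it is what gives \<open>tilt\<close> the expectation 1.\<close>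

definition tilt_rate :: "real \<Rightarrow> real \<Rightarrow> real" where
  "tilt_rate p p' = (LINT x|F. 1 - exp (- bislope p p' x))"

definition tilt :: "real \<Rightarrow> real \<Rightarrow> real \<Rightarrow> real \<Rightarrow> (real \<Rightarrow> real) \<Rightarrow> real" where
  "tilt p p' a b \<omega> = exp ((b - a) * tilt_rate p p' - bislope_jumps p p' a b \<omega>)"

text \<open>The characteristic exponent, per unit time, of the increment together with the jump
  sums, for the Levy measure that has density \<open>exp (- bislope p p' x)\<close> with respect to
  \<open>F\<close>.\<close>

definition tilted_exponent :: "real \<Rightarrow> real \<Rightarrow> real \<Rightarrow> real \<Rightarrow> real \<Rightarrow> complex" where
  "tilted_exponent p p' z w w' = (CLINT x|F. (iexp (z * x + bislope w w' x) - 1) * of_real (exp (- bislope p p' x)))"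

lemma tilt_pos: "0 < tilt p p' a b \<omega>"
  by (simp add: tilt_def)

lemma tilt_le: "0 \<le> p \<Longrightarrow> 0 \<le> p' \<Longrightarrow> tilt p p' a b \<omega> \<le> exp ((b - a) * tilt_rate p p')"
  by (simp add: tilt_def bislope_jumps_nonneg)

lemma tilt_measurable:
  assumes "0 \<le> a" "a \<le> b"
  shows "(\<lambda>\<omega>. tilt p p' a b (sample \<omega>)) \<in> borel_measurable M"
  using bislope_jumps_measurable_at[OF assms, of p p'] unfolding tilt_def by measurable

lemma tilt_integrable:
  assumes "0 \<le> p" "0 \<le> p'" "0 \<le> a" "a \<le> b"
  shows "integrable M (\<lambda>\<omega>. tilt p p' a b (sample \<omega>))"
  by (rule integrable_const_bound[where B="exp ((b - a) * tilt_rate p p')"])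
    (use tilt_le[OF assms(1,2), of a b] tilt_pos tilt_measurable[OF assms(3,4)] in \<open>auto simp: abs_of_pos\<close>)

lemma tilt_rate_integrable:
  fixes p p' :: real
  assumes p: "0 \<le> p" "0 \<le> p'"
  shows "integrable F (\<lambda>x. 1 - exp (- bislope p p' x))"
proof -
  note [measurable] = borel_measurable_continuous_onI[OF continuous_on_bislope]
  have "integrable F (\<lambda>x. complex_of_real (1 - exp (- bislope p p' x)))"
  proof (rule integrable_linear_bound[where C="2 * (norm p + norm p')"])
    fix x
    have "cmod (complex_of_real (1 - exp (- bislope p p' x))) = cmod (exp (of_real (- bislope p p' x)) - 1)"
      unfolding exp_of_real of_real_diff of_real_1 by (rule norm_minus_commute)
    also have "\<dots> \<le> 2 * cmod (of_real (- bislope p p' x))"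
      using bislope_nonneg[OF p, of x] by (intro norm_exp_minus_1_le) simp
    also have "\<dots> \<le> 2 * (norm p + norm p') * \<bar>x\<bar>" using norm_bislope_le[of p p' x] by (simp add: algebra_simps)
    finally show "cmod (complex_of_real (1 - exp (- bislope p p' x))) \<le> 2 * (norm p + norm p') * \<bar>x\<bar>" .
  qed measurable
  then show ?thesis by (simp only: complex_of_real_integrable_eq)
qed

text \<open>At each x at most one of the two slopes acts, so one of the two summands is 0. This is
  how the joint normalising constant separates into the two one-sided cumulants.\<close>

lemma tilt_rate_split:
  assumes p: "0 \<le> p" "0 \<le> p'"
  shows "tilt_rate p p' = tilt_rate p 0 + tilt_rate 0 p'"
proof -
  have "tilt_rate p p' = (LINT x|F. (1 - exp (- bislope p 0 x)) + (1 - exp (- bislope 0 p' x)))"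
    unfolding tilt_rate_def by (intro Bochner_Integration.integral_cong) (simp_all add: bislope_def max_def)
  also have "\<dots> = tilt_rate p 0 + tilt_rate 0 p'"
    unfolding tilt_rate_def using p by (intro Bochner_Integration.integral_add tilt_rate_integrable) auto
  finally show ?thesis .
qed

text \<open>The complex slopes \<open>p - \<i> w\<close> and \<open>p' - \<i> w'\<close> turn \<open>block_law\<close> into a statement on tilted characteristic
  functions.\<close>

lemma tilt_law:
  assumes p: "0 \<le> p" "0 \<le> p'" and ab: "0 \<le> a" "a \<le> b"
  shows "(CLINT \<omega>|M. iexp (z * (X b \<omega> - X a \<omega>) + bislope_jumps w w' a b (sample \<omega>)) * of_real (tilt p p' a b (sample \<omega>))) =
    exp (of_real (b - a) * tilted_exponent p p' z w w')"
proof -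
  define c where "c = Complex p (- w)"
  define c' where "c' = Complex p' (- w')"
  have c: "c = of_real p - \<i> * of_real w" "c' = of_real p' - \<i> * of_real w'"
    by (simp_all add: c_def c'_def complex_eq_iff)
  have J: "bislope_jumps c c' a b \<omega> = of_real (bislope_jumps p p' a b \<omega>) - \<i> * of_real (bislope_jumps w w' a b \<omega>)" for \<omega>
    by (simp add: bislope_jumps_def c scaleR_conv_of_real algebra_simps)
  have PM: "bislope c c' x = of_real (bislope p p' x) - \<i> * of_real (bislope w w' x)" for x
    by (simp add: bislope_def c scaleR_conv_of_real algebra_simps)
  note [measurable] = borel_measurable_continuous_onI[OF continuous_on_bislope]
  define K where "K = complex_of_real ((b - a) * tilt_rate p p')"
  have "iexp (z * (X b \<omega> - X a \<omega>) + bislope_jumps w w' a b (sample \<omega>)) * of_real (tilt p p' a b (sample \<omega>)) =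
     exp K * (iexp (z * (X b \<omega> - X a \<omega>)) * exp (- bislope_jumps c c' a b (sample \<omega>)))" for \<omega>
    unfolding tilt_def J K_def by (simp add: exp_of_real[symmetric] exp_add[symmetric] exp_diff exp_minus algebra_simps)
  then have "(CLINT \<omega>|M. iexp (z * (X b \<omega> - X a \<omega>) + bislope_jumps w w' a b (sample \<omega>)) * of_real (tilt p p' a b (sample \<omega>))) =
     exp K * exp (of_real (b - a) * (CLINT x|F. iexp (z * x) * exp (- bislope c c' x) - 1))"
    using block_law[of c c' a b z] p ab by (simp add: c_def c'_def)
  also have "\<dots> = exp (of_real (b - a) * ((CLINT x|F. iexp (z * x) * exp (- bislope c c' x) - 1) + of_real (tilt_rate p p')))"
    by (simp add: exp_add[symmetric] K_def algebra_simps)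
  also have "complex_of_real (tilt_rate p p') = (CLINT x|F. of_real (1 - exp (- bislope p p' x)))"
    unfolding tilt_rate_def by (rule integral_complex_of_real[symmetric])
  also have "(CLINT x|F. iexp (z * x) * exp (- bislope c c' x) - 1) + (CLINT x|F. of_real (1 - exp (- bislope p p' x))) =
     (CLINT x|F. (iexp (z * x) * exp (- bislope c c' x) - 1) + of_real (1 - exp (- bislope p p' x)))"
  proof (rule Bochner_Integration.integral_add[symmetric])
    show "integrable F (\<lambda>x. iexp (z * x) * exp (- bislope c c' x) - 1)"
    proof (rule integrable_linear_bound[where C="2 * (\<bar>z\<bar> + (norm c + norm c'))"])
      fix x
      have "iexp (z * x) * exp (- bislope c c' x) = exp (\<i> * of_real (z * x) - bislope c c' x)" by (simp add: exp_diff exp_minus field_simps)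
      then have "cmod (iexp (z * x) * exp (- bislope c c' x) - 1) \<le> 2 * cmod (\<i> * of_real (z * x) - bislope c c' x)"
        using norm_exp_minus_1_le[of "\<i> * of_real (z * x) - bislope c c' x"] Re_bislope_nonneg[of c c' x] p by (simp add: c_def c'_def)
      also have "\<dots> \<le> 2 * (\<bar>z\<bar> * \<bar>x\<bar> + (norm c + norm c') * \<bar>x\<bar>)"
        using norm_triangle_ineq4[of "\<i> * of_real (z * x)" "bislope c c' x"] norm_bislope_le[of c c' x] by (simp add: norm_mult abs_mult)
      finally show "cmod (iexp (z * x) * exp (- bislope c c' x) - 1) \<le> (2 * (\<bar>z\<bar> + (norm c + norm c'))) * \<bar>x\<bar>"
        by (simp add: algebra_simps)
    qed measurable
    show "integrable F (\<lambda>x. complex_of_real (1 - exp (- bislope p p' x)))"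
      using tilt_rate_integrable[OF p] by (rule integrable_of_real)
  qed
  also have "\<dots> = tilted_exponent p p' z w w'"
    unfolding tilted_exponent_def PM
    by (intro Bochner_Integration.integral_cong) (simp_all add: exp_of_real[symmetric] exp_add exp_diff exp_minus divide_inverse algebra_simps)
  finally show ?thesis .
qed

lemma tilt_expectation:
  assumes p: "0 \<le> p" "0 \<le> p'" and ab: "0 \<le> a" "a \<le> b"
  shows "(LINT \<omega>|M. tilt p p' a b (sample \<omega>)) = 1"
proof -
  have "complex_of_real (LINT \<omega>|M. tilt p p' a b (sample \<omega>)) = 1"
    using tilt_law[OF assms, of 0 0 0] by (simp add: bislope_jumps_def bislope_def tilted_exponent_def)
  then show ?thesis by (simp only: of_real_eq_1_iff)
qed

text \<open>Almost surely the tilt over the whole interval is the product of the tilts over the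
  blocks, so increments remain independent under the tilted measure.\<close>

lemma tilt_blocks:
  fixes f :: "nat \<Rightarrow> real \<Rightarrow> real"
  assumes \<tau>: "mono \<tau>" "0 \<le> \<tau> 0"
    and f: "\<And>l. f l \<in> borel_measurable borel" "\<And>l x. \<bar>f l x\<bar> \<le> 1"
    and p: "0 \<le> p" "0 \<le> p'"
  shows "(LINT \<omega>|M. (\<Prod>l<m. f l (X (\<tau> (Suc l)) \<omega> - X (\<tau> l) \<omega>)) * tilt p p' (\<tau> 0) (\<tau> m) (sample \<omega>)) =
    (\<Prod>l<m. LINT \<omega>|M. f l (X (\<tau> (Suc l)) \<omega> - X (\<tau> l) \<omega>) * tilt p p' (\<tau> l) (\<tau> (Suc l)) (sample \<omega>))"
proof -
  note [measurable] = f(1)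
  have \<tau>0: "0 \<le> \<tau> l" "\<tau> l \<le> \<tau> (Suc l)" for l
    using \<tau> monoD[OF \<tau>(1), of 0 l] incseq_SucD[OF \<tau>(1)] by auto
  have [measurable]: "X (\<tau> l) \<in> borel_measurable M" for l using \<tau>0 by simp
  note [measurable] = bislope_jumps_measurable_at[OF \<tau>0, of p p']
  have "\<tau> 0 \<le> \<tau> m" using monoD[OF \<tau>(1)] by simp
  note [measurable] = tilt_measurable[OF \<tau>(2) this]
  define k where "k l = exp ((\<tau> (Suc l) - \<tau> l) * tilt_rate p p')" for l
  have k: "(\<Prod>l<m. k l) = exp ((\<tau> m - \<tau> 0) * tilt_rate p p')"
    unfolding k_def by (simp add: exp_sum[symmetric] sum_distrib_right[symmetric] sum_lessThan_telescope)
  define U where "U l \<omega> = f l (X (\<tau> (Suc l)) \<omega> - X (\<tau> l) \<omega>) * exp (- bislope_jumps p p' (\<tau> l) (\<tau> (Suc l)) (sample \<omega>))" for l \<omega>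
  have "(LINT \<omega>|M. (\<Prod>l<m. f l (X (\<tau> (Suc l)) \<omega> - X (\<tau> l) \<omega>)) * tilt p p' (\<tau> 0) (\<tau> m) (sample \<omega>)) =
    (LINT \<omega>|M. (\<Prod>l<m. k l) * (\<Prod>l<m. U l \<omega>))"
  proof (rule integral_cong_AE)
    show "AE \<omega> in M. (\<Prod>l<m. f l (X (\<tau> (Suc l)) \<omega> - X (\<tau> l) \<omega>)) * tilt p p' (\<tau> 0) (\<tau> m) (sample \<omega>) =
      (\<Prod>l<m. k l) * (\<Prod>l<m. U l \<omega>)"
      using bislope_jumps_sum_blocks[OF \<tau>, where m=m and c=p and c'=p']
    proof eventually_elim
      case (elim \<omega>)
      show ?case
        unfolding k tilt_def elim[symmetric] U_def
        by (simp add: prod.distrib exp_diff exp_sum exp_minus prod_inversef[symmetric] divide_inverse)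
    qed
  qed (simp_all add: U_def)
  also have "\<dots> = (\<Prod>l<m. k l) * (\<Prod>l<m. LINT \<omega>|M. U l \<omega>)"
    unfolding U_def by (simp add: blocks_factorize[OF \<tau> f p])
  also have "\<dots> = (\<Prod>l<m. LINT \<omega>|M. k l * U l \<omega>)"
    by (simp add: prod.distrib)
  also have "\<dots> = (\<Prod>l<m. LINT \<omega>|M. f l (X (\<tau> (Suc l)) \<omega> - X (\<tau> l) \<omega>) * tilt p p' (\<tau> l) (\<tau> (Suc l)) (sample \<omega>))"
  proof -
    have "k l * U l \<omega> = f l (X (\<tau> (Suc l)) \<omega> - X (\<tau> l) \<omega>) * tilt p p' (\<tau> l) (\<tau> (Suc l)) (sample \<omega>)" for l \<omega>
      by (simp add: k_def U_def tilt_def exp_diff exp_minus divide_inverse)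
    then show ?thesis by simp
  qed
  finally show ?thesis .
qed

end

section \<open>Two measures with a common tilt\<close>

locale fv_levy_pair = P: fv_levy M X F + Q: fv_levy N X G
  for M N :: "'a measure" and X :: "real \<Rightarrow> 'a \<Rightarrow> real" and F G :: "real measure" +
  fixes p p' q q' :: real
  assumes sets_eq: "sets N = sets M"
    and p: "0 \<le> p" "0 \<le> p'" and q: "0 \<le> q" "0 \<le> q'"
    and exponent_eq: "\<And>z w w'. P.tilted_exponent p p' z w w' = Q.tilted_exponent q q' z w w'"
begin

lemma space_eq: "space N = space M"
  using sets_eq by (rule sets_eq_imp_space_eq)

lemma tilted_block_eq:
  assumes ab: "0 \<le> a" "a \<le> b" and B: "B \<in> sets borel"
  shows "(LINT \<omega>|M. indicator B (X b \<omega> - X a \<omega>) * P.tilt p p' a b (\<lambda>t. X t \<omega>)) =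
    (LINT \<omega>|N. indicator B (X b \<omega> - X a \<omega>) * Q.tilt q q' a b (\<lambda>t. X t \<omega>))"
proof -
  have b0: "0 \<le> b" using ab by simp
  have mP[measurable]: "X a \<in> borel_measurable M" "X b \<in> borel_measurable M" using ab by auto
  have mQ[measurable]: "X a \<in> borel_measurable N" "X b \<in> borel_measurable N" using ab by auto
  note [measurable] = B P.tilt_measurable[OF ab] Q.tilt_measurable[OF ab]
  let ?Y = "\<lambda>\<omega>. X b \<omega> - X a \<omega>"
  let ?W = "\<lambda>\<omega>. P.tilt p p' a b (\<lambda>t. X t \<omega>)"
  let ?V = "\<lambda>\<omega>. Q.tilt q q' a b (\<lambda>t. X t \<omega>)"
  have "distr (density M (\<lambda>\<omega>. ennreal (?W \<omega>))) borel ?Y = distr (density N (\<lambda>\<omega>. ennreal (?V \<omega>))) borel ?Y"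
  proof (rule tilted_distr_eq)
    \<comment> \<open>Only the increment is tested (\<open>w = w' = 0\<close>), because the
      filtration is generated by \<open>X\<close>; the jump sums enter through the weights.\<close>
    show "(CLINT \<omega>|M. iexp (z * ?Y \<omega>) * of_real (?W \<omega>)) = (CLINT \<omega>|N. iexp (z * ?Y \<omega>) * of_real (?V \<omega>))" for z
      using P.tilt_law[OF p ab, of z 0 0] Q.tilt_law[OF q ab, of z 0 0] exponent_eq[of z 0 0] by (simp add: bislope_jumps_def)
  qed (use P.tilt_integrable[OF p ab] Q.tilt_integrable[OF q ab] P.tilt_expectation[OF p ab] Q.tilt_expectation[OF q ab]
    P.tilt_pos Q.tilt_pos in \<open>auto simp: less_imp_le\<close>)
  then have "emeasure (distr (density M (\<lambda>\<omega>. ennreal (?W \<omega>))) borel ?Y) B = emeasure (distr (density N (\<lambda>\<omega>. ennreal (?V \<omega>))) borel ?Y) B"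
    by simp
  moreover have "emeasure (distr (density M (\<lambda>\<omega>. ennreal (?W \<omega>))) borel ?Y) B = ennreal (LINT \<omega>|M. indicator B (?Y \<omega>) * ?W \<omega>)"
  proof -
    have "emeasure (distr (density M (\<lambda>\<omega>. ennreal (?W \<omega>))) borel ?Y) B = (\<integral>\<^sup>+\<omega>. ennreal (indicator B (?Y \<omega>) * ?W \<omega>) \<partial>M)"
      by (subst emeasure_distr, simp, simp, subst emeasure_density)
        (auto intro!: nn_integral_cong split: split_indicator)
    also have "\<dots> = ennreal (LINT \<omega>|M. indicator B (?Y \<omega>) * ?W \<omega>)"
      using P.tilt_pos by (intro nn_integral_eq_integral Bochner_Integration.integrable_bound[OF P.tilt_integrable[OF p ab]])
         (auto simp: less_imp_le split: split_indicator)
    finally show ?thesis .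
  qed
  moreover have "emeasure (distr (density N (\<lambda>\<omega>. ennreal (?V \<omega>))) borel ?Y) B = ennreal (LINT \<omega>|N. indicator B (?Y \<omega>) * ?V \<omega>)"
  proof -
    have "emeasure (distr (density N (\<lambda>\<omega>. ennreal (?V \<omega>))) borel ?Y) B = (\<integral>\<^sup>+\<omega>. ennreal (indicator B (?Y \<omega>) * ?V \<omega>) \<partial>N)"
      by (subst emeasure_distr, simp, simp, subst emeasure_density)
        (auto intro!: nn_integral_cong split: split_indicator)
    also have "\<dots> = ennreal (LINT \<omega>|N. indicator B (?Y \<omega>) * ?V \<omega>)"
      using Q.tilt_pos by (intro nn_integral_eq_integral Bochner_Integration.integrable_bound[OF Q.tilt_integrable[OF q ab]])
         (auto simp: less_imp_le split: split_indicator)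
    finally show ?thesis .
  qed
  ultimately show ?thesis
    using P.tilt_pos Q.tilt_pos by (simp add: ennreal_inj integral_nonneg_AE less_imp_le)
qed

text \<open>Boxes determine a finite measure on the product space. On a box
  \<open>tilt_blocks\<close> turns the tilted mass into a product over blocks, and
  \<open>tilted_block_eq\<close> compares the factors one by one.\<close>

lemma tilted_increments_eq:
  assumes \<tau>: "mono \<tau>" "0 \<le> \<tau> 0" and A: "A \<in> sets (PiM {..<m} (\<lambda>_. borel))"
  defines "D \<equiv> (\<lambda>\<omega>. \<lambda>l\<in>{..<m}. X (\<tau> (Suc l)) \<omega> - X (\<tau> l) \<omega>)"
  shows "(\<integral>\<^sup>+\<omega>. ennreal (P.tilt p p' (\<tau> 0) (\<tau> m) (\<lambda>t. X t \<omega>)) * indicator A (D \<omega>) \<partial>M) =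
    (\<integral>\<^sup>+\<omega>. ennreal (Q.tilt q q' (\<tau> 0) (\<tau> m) (\<lambda>t. X t \<omega>)) * indicator A (D \<omega>) \<partial>N)"
proof -
  have \<tau>0: "0 \<le> \<tau> l" "\<tau> l \<le> \<tau> (Suc l)" for l
    using \<tau> monoD[OF \<tau>(1), of 0 l] incseq_SucD[OF \<tau>(1)] by auto
  have ab: "0 \<le> \<tau> 0" "\<tau> 0 \<le> \<tau> m" using \<tau> monoD[OF \<tau>(1), of 0 m] by auto
  have [measurable]: "X (\<tau> l) \<in> borel_measurable M" "X (\<tau> l) \<in> borel_measurable N" for l using \<tau>0 by simp_all
  note [measurable] = P.tilt_measurable[OF ab] Q.tilt_measurable[OF ab]
  have DM[measurable]: "D \<in> measurable M (PiM {..<m} (\<lambda>_. borel))" unfolding D_def by measurable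
  have DN[measurable]: "D \<in> measurable N (PiM {..<m} (\<lambda>_. borel))" unfolding D_def by measurable
  let ?W = "\<lambda>\<omega>. P.tilt p p' (\<tau> 0) (\<tau> m) (\<lambda>t. X t \<omega>)"
  let ?V = "\<lambda>\<omega>. Q.tilt q q' (\<tau> 0) (\<tau> m) (\<lambda>t. X t \<omega>)"
  define \<mu> where "\<mu> = distr (density M (\<lambda>\<omega>. ennreal (?W \<omega>))) (PiM {..<m} (\<lambda>_. borel)) D"
  define \<nu> where "\<nu> = distr (density N (\<lambda>\<omega>. ennreal (?V \<omega>))) (PiM {..<m} (\<lambda>_. borel)) D"
  have \<mu>: "emeasure \<mu> A = (\<integral>\<^sup>+\<omega>. ennreal (?W \<omega>) * indicator A (D \<omega>) \<partial>M)" if "A \<in> sets (PiM {..<m} (\<lambda>_. borel))" for A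
    using that unfolding \<mu>_def by (subst emeasure_distr, simp, simp, subst emeasure_density)
        (auto intro!: nn_integral_cong split: split_indicator)
  have \<nu>: "emeasure \<nu> A = (\<integral>\<^sup>+\<omega>. ennreal (?V \<omega>) * indicator A (D \<omega>) \<partial>N)" if "A \<in> sets (PiM {..<m} (\<lambda>_. borel))" for A
    using that unfolding \<nu>_def by (subst emeasure_distr, simp, simp, subst emeasure_density)
        (auto intro!: nn_integral_cong split: split_indicator)
  have "\<mu> = \<nu>"
  proof (rule measure_eqI_PiM_finite)
    show "sets \<mu> = sets (PiM {..<m} (\<lambda>_. borel))" "sets \<nu> = sets (PiM {..<m} (\<lambda>_. borel))"
      by (simp_all add: \<mu>_def \<nu>_def)
    fix B :: "nat \<Rightarrow> real set" assume B: "\<And>l. l \<in> {..<m} \<Longrightarrow> B l \<in> sets borel"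
    \<comment> \<open>\<open>tilt_blocks\<close> asks for measurable factors at every index, so the
      sides of the box are extended by the empty set beyond \<open>m\<close>.\<close>
    define B' where "B' l = (if l < m then B l else {})" for l
    have [measurable]: "B' l \<in> sets borel" for l using B by (simp add: B'_def)
    have box: "Pi\<^sub>E {..<m} B \<in> sets (PiM {..<m} (\<lambda>_. borel))"
      using B by (intro sets_PiM_I_finite) auto
    have ind: "indicator (Pi\<^sub>E {..<m} B) (D \<omega>) = (\<Prod>l<m. indicator (B' l) (X (\<tau> (Suc l)) \<omega> - X (\<tau> l) \<omega>) :: real)" for \<omega>
    proof (cases "\<forall>l<m. X (\<tau> (Suc l)) \<omega> - X (\<tau> l) \<omega> \<in> B l")
      case True
      then have "D \<omega> \<in> Pi\<^sub>E {..<m} B" by (auto simp: D_def)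
      then show ?thesis using True by (simp add: B'_def)
    next
      case False
      then obtain l where l: "l < m" "X (\<tau> (Suc l)) \<omega> - X (\<tau> l) \<omega> \<notin> B l" by auto
      then have "D \<omega> \<notin> Pi\<^sub>E {..<m} B" by (auto simp: D_def PiE_iff)
      moreover have "(\<Prod>l<m. indicator (B' l) (X (\<tau> (Suc l)) \<omega> - X (\<tau> l) \<omega>) :: real) = 0"
        using l by (intro prod_zero bexI[of _ l]) (auto simp: B'_def)
      ultimately show ?thesis by simp
    qed
    have "emeasure \<mu> (Pi\<^sub>E {..<m} B) = ennreal (LINT \<omega>|M. (\<Prod>l<m. indicator (B' l) (X (\<tau> (Suc l)) \<omega> - X (\<tau> l) \<omega>)) * ?W \<omega>)"
    proof -
      have "emeasure \<mu> (Pi\<^sub>E {..<m} B) = (\<integral>\<^sup>+\<omega>. ennreal (indicator (Pi\<^sub>E {..<m} B) (D \<omega>) * ?W \<omega>) \<partial>M)"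
        unfolding \<mu>[OF box] by (auto intro!: nn_integral_cong split: split_indicator)
      also have "\<dots> = ennreal (LINT \<omega>|M. indicator (Pi\<^sub>E {..<m} B) (D \<omega>) * ?W \<omega>)"
        using P.tilt_pos box by (intro nn_integral_eq_integral Bochner_Integration.integrable_bound[OF P.tilt_integrable[OF p ab]])
           (auto simp: less_imp_le split: split_indicator)
      finally show ?thesis unfolding ind .
    qed
    also have "\<dots> = ennreal (\<Prod>l<m. LINT \<omega>|M. indicator (B' l) (X (\<tau> (Suc l)) \<omega> - X (\<tau> l) \<omega>) * P.tilt p p' (\<tau> l) (\<tau> (Suc l)) (\<lambda>t. X t \<omega>))"
      by (subst P.tilt_blocks[OF \<tau> _ _ p]) (auto split: split_indicator)
    also have "\<dots> = ennreal (\<Prod>l<m. LINT \<omega>|N. indicator (B' l) (X (\<tau> (Suc l)) \<omega> - X (\<tau> l) \<omega>) * Q.tilt q q' (\<tau> l) (\<tau> (Suc l)) (\<lambda>t. X t \<omega>))"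
      by (simp add: tilted_block_eq[OF \<tau>0])
    also have "\<dots> = ennreal (LINT \<omega>|N. (\<Prod>l<m. indicator (B' l) (X (\<tau> (Suc l)) \<omega> - X (\<tau> l) \<omega>)) * ?V \<omega>)"
      by (subst Q.tilt_blocks[OF \<tau> _ _ q]) (auto split: split_indicator)
    also have "\<dots> = emeasure \<nu> (Pi\<^sub>E {..<m} B)"
    proof -
      have "emeasure \<nu> (Pi\<^sub>E {..<m} B) = (\<integral>\<^sup>+\<omega>. ennreal (indicator (Pi\<^sub>E {..<m} B) (D \<omega>) * ?V \<omega>) \<partial>N)"
        unfolding \<nu>[OF box] by (auto intro!: nn_integral_cong split: split_indicator)
      also have "\<dots> = ennreal (LINT \<omega>|N. indicator (Pi\<^sub>E {..<m} B) (D \<omega>) * ?V \<omega>)"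
        using Q.tilt_pos box by (intro nn_integral_eq_integral Bochner_Integration.integrable_bound[OF Q.tilt_integrable[OF q ab]])
           (auto simp: less_imp_le split: split_indicator)
      finally show ?thesis unfolding ind ..
    qed
    finally show "emeasure \<mu> (Pi\<^sub>E {..<m} B) = emeasure \<nu> (Pi\<^sub>E {..<m} B)" .
  next
    show "range (\<lambda>_::nat. space (PiM {..<m} (\<lambda>_. borel :: real measure))) \<subseteq> prod_algebra {..<m} (\<lambda>_. borel)"
      by (auto simp: space_PiM intro!: prod_algebraI_finite)
    have "emeasure \<mu> (space (PiM {..<m} (\<lambda>_. borel))) \<le> (\<integral>\<^sup>+\<omega>. ennreal (?W \<omega>) \<partial>M)"
      by (subst \<mu>) (auto intro!: nn_integral_mono split: split_indicator)
    also have "\<dots> = 1"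
      using nn_integral_eq_integral[OF P.tilt_integrable[OF p ab]] P.tilt_expectation[OF p ab] P.tilt_pos by (simp add: less_imp_le)
    finally show "emeasure \<mu> (space (PiM {..<m} (\<lambda>_. borel))) \<noteq> \<infinity>" by (auto simp: top_unique)
  qed auto
  then show ?thesis using \<mu>[OF A] \<nu>[OF A] by simp
qed

lemma tilted_cylinder_eq:
  assumes t: "0 \<le> t" and S: "finite S" "S \<subseteq> {0..t}" and B: "\<And>s. B s \<in> sets borel"
  shows "emeasure (density M (\<lambda>\<omega>. ennreal (P.tilt p p' 0 t (\<lambda>t. X t \<omega>)))) {\<omega>\<in>space M. \<forall>s\<in>S. X s \<omega> \<in> B s} =
    emeasure (density N (\<lambda>\<omega>. ennreal (Q.tilt q q' 0 t (\<lambda>t. X t \<omega>)))) {\<omega>\<in>space M. \<forall>s\<in>S. X s \<omega> \<in> B s}"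
proof -
  obtain \<tau> and m :: nat where \<tau>: "mono \<tau>" "\<tau> 0 = 0" "\<tau> m = t" "S \<subseteq> \<tau> ` {..m}"
    using finite_times_mono[OF S t] by blast
  then have \<tau>0: "0 \<le> \<tau> 0" by simp
  from \<tau>(4) have "\<forall>s\<in>S. \<exists>j\<le>m. \<tau> j = s" by force
  then obtain j where j: "\<And>s. s \<in> S \<Longrightarrow> j s \<le> m" "\<And>s. s \<in> S \<Longrightarrow> \<tau> (j s) = s" by metis
  define D where "D = (\<lambda>\<omega>. \<lambda>l\<in>{..<m}. X (\<tau> (Suc l)) \<omega> - X (\<tau> l) \<omega>)"
  define A where "A = {x \<in> space (PiM {..<m} (\<lambda>_. borel)). \<forall>s\<in>S. (\<Sum>l<j s. x l) \<in> B s}"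
  have A: "A \<in> sets (PiM {..<m} (\<lambda>_. borel))"
    unfolding A_def
  proof (rule sets.sets_Collect_finite_All[OF _ S(1)])
    fix s assume "s \<in> S"
    have "(\<lambda>x. \<Sum>l<j s. x l) \<in> borel_measurable (PiM {..<m} (\<lambda>_. borel :: real measure))"
      using j(1)[OF \<open>s \<in> S\<close>] by (intro borel_measurable_sum measurable_component_singleton) auto
    from measurable_sets[OF this B[of s]]
    show "{x \<in> space (PiM {..<m} (\<lambda>_. borel)). (\<Sum>l<j s. x l) \<in> B s} \<in> sets (PiM {..<m} (\<lambda>_. borel))"
      by (simp add: vimage_def Int_def conj_commute)
  qed
  \<comment> \<open>Partial sums of increments give back the values of \<open>X\<close> once
    \<open>X 0 = 0\<close>. This holds only almost surely, under \<open>M\<close> and under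
    \<open>N\<close> separately; hence the general \<open>K\<close>.\<close>
  have iff: "AE \<omega> in K. D \<omega> \<in> A \<longleftrightarrow> (\<forall>s\<in>S. X s \<omega> \<in> B s)" if "AE \<omega> in K. X 0 \<omega> = 0" for K :: "'a measure"
    using that
  proof eventually_elim
    case (elim \<omega>)
    have "(\<Sum>l<j s. D \<omega> l) = X s \<omega>" if "s \<in> S" for s
    proof -
      have "(\<Sum>l<j s. D \<omega> l) = (\<Sum>l<j s. X (\<tau> (Suc l)) \<omega> - X (\<tau> l) \<omega>)"
        using j(1)[OF that] by (intro sum.cong) (auto simp: D_def)
      also have "\<dots> = X s \<omega>"
        by (subst sum_lessThan_telescope[of "\<lambda>l. X (\<tau> l) \<omega>"]) (simp add: \<tau>(2) elim j(2)[OF that])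
      finally show ?thesis .
    qed
    then show ?case by (auto simp: A_def D_def space_PiM)
  qed
  have Xm: "X s \<in> borel_measurable M" "X s \<in> borel_measurable N" if "s \<in> S" for s
    using S(2) that by auto
  have C: "{\<omega>\<in>space M. \<forall>s\<in>S. X s \<omega> \<in> B s} \<in> sets M"
  proof (rule sets.sets_Collect_finite_All[OF _ S(1)])
    fix s assume "s \<in> S"
    from measurable_sets[OF Xm(1)[OF this] B[of s]] show "{\<omega>\<in>space M. X s \<omega> \<in> B s} \<in> sets M"
      by (simp add: vimage_def Int_def conj_commute)
  qed
  note [measurable] = P.tilt_measurable[OF order_refl t] Q.tilt_measurable[OF order_refl t]
  have "emeasure (density M (\<lambda>\<omega>. ennreal (P.tilt p p' 0 t (\<lambda>t. X t \<omega>)))) {\<omega>\<in>space M. \<forall>s\<in>S. X s \<omega> \<in> B s} =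
    (\<integral>\<^sup>+\<omega>. ennreal (P.tilt p p' 0 t (\<lambda>t. X t \<omega>)) * indicator {\<omega>\<in>space M. \<forall>s\<in>S. X s \<omega> \<in> B s} \<omega> \<partial>M)"
    by (rule emeasure_density[OF _ C]) measurable
  also have "\<dots> = (\<integral>\<^sup>+\<omega>. ennreal (P.tilt p p' 0 t (\<lambda>t. X t \<omega>)) * indicator A (D \<omega>) \<partial>M)"
    using iff[OF P.X_0] by (intro nn_integral_cong_AE) (rule AE_mp, assumption, intro AE_I2 impI, simp add: indicator_def)
  also have "\<dots> = (\<integral>\<^sup>+\<omega>. ennreal (Q.tilt q q' 0 t (\<lambda>t. X t \<omega>)) * indicator A (D \<omega>) \<partial>N)"
    using tilted_increments_eq[OF \<tau>(1) \<tau>0 A] by (simp add: \<tau> D_def)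
  also have "\<dots> = (\<integral>\<^sup>+\<omega>. ennreal (Q.tilt q q' 0 t (\<lambda>t. X t \<omega>)) * indicator {\<omega>\<in>space M. \<forall>s\<in>S. X s \<omega> \<in> B s} \<omega> \<partial>N)"
    using iff[OF Q.X_0] by (intro nn_integral_cong_AE) (rule AE_mp, assumption, intro AE_I2 impI, simp add: indicator_def space_eq)
  also have "\<dots> = emeasure (density N (\<lambda>\<omega>. ennreal (Q.tilt q q' 0 t (\<lambda>t. X t \<omega>)))) {\<omega>\<in>space M. \<forall>s\<in>S. X s \<omega> \<in> B s}"
    by (rule emeasure_density[OF _ C[folded sets_eq], symmetric]) measurable
  finally show ?thesis .
qed

definition natural_filtration :: "real \<Rightarrow> 'a measure" where
  "natural_filtration t = sigma (space M) {X s -` B \<inter> space M | s B. s \<in> {0..t} \<and> B \<in> sets borel}"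

lemma subalgebra_natural_filtration: "subalgebra M (natural_filtration t)"
  unfolding subalgebra_def natural_filtration_def
proof
  show "sets (sigma (space M) {X s -` B \<inter> space M | s B. s \<in> {0..t} \<and> B \<in> sets borel}) \<subseteq> sets M"
    by (subst sets_measure_of, force, rule sets.sigma_sets_subset) (auto intro: measurable_sets[OF P.X_measurable])
qed (subst space_measure_of, auto)

lemma tilted_eq:
  assumes t: "0 \<le> t" and A: "A \<in> sets (natural_filtration t)"
  shows "emeasure (density M (\<lambda>\<omega>. ennreal (P.tilt p p' 0 t (\<lambda>t. X t \<omega>)))) A =
    emeasure (density N (\<lambda>\<omega>. ennreal (Q.tilt q q' 0 t (\<lambda>t. X t \<omega>)))) A"
proof -
  define \<mu> where "\<mu> = density M (\<lambda>\<omega>. ennreal (P.tilt p p' 0 t (\<lambda>t. X t \<omega>)))"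
  define \<nu> where "\<nu> = density N (\<lambda>\<omega>. ennreal (Q.tilt q q' 0 t (\<lambda>t. X t \<omega>)))"
  let ?F = "natural_filtration t"
  define E where "E = {{\<omega>\<in>space M. \<forall>s\<in>S. X s \<omega> \<in> B s} | S B. finite S \<and> S \<subseteq> {0..t} \<and> (\<forall>s. B s \<in> sets borel)}"
  have sub: "subalgebra \<mu> ?F" "subalgebra \<nu> ?F"
    using subalgebra_natural_filtration[of t] sets_eq space_eq by (auto simp: subalgebra_def \<mu>_def \<nu>_def)
  have eq: "{\<omega>\<in>space M. X s \<omega> \<in> B} = X s -` B \<inter> space M" for s B by auto
  have gen: "sets ?F = sigma_sets (space M) E"
  proof -
    have "sets ?F = sigma_sets (space M) {X s -` B \<inter> space M | s B. s \<in> {0..t} \<and> B \<in> sets borel}"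
      unfolding natural_filtration_def by (subst sets_measure_of) auto
    also have "\<dots> = sigma_sets (space M) E"
    proof (rule sigma_sets_eqI)
      fix a assume "a \<in> {X s -` B \<inter> space M | s B. s \<in> {0..t} \<and> B \<in> sets borel}"
      then obtain s B where "a = X s -` B \<inter> space M" "s \<in> {0..t}" "B \<in> sets borel" by auto
      then have "a \<in> E" unfolding E_def mem_Collect_eq by (intro exI[of _ "{s}"] exI[of _ "\<lambda>_. B"]) auto
      then show "a \<in> sigma_sets (space M) E" by (rule sigma_sets.Basic)
    next
      fix b assume "b \<in> E"
      then obtain S B where b: "b = {\<omega>\<in>space M. \<forall>s\<in>S. X s \<omega> \<in> B s}" "finite S" "S \<subseteq> {0..t}" "\<forall>s. B s \<in> sets borel"
        unfolding E_def by blast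
      interpret sigma_algebra "space M" "sigma_sets (space M) {X s -` B \<inter> space M | s B. s \<in> {0..t} \<and> B \<in> sets borel}"
        by (rule sigma_algebra_sigma_sets) auto
      show "b \<in> sigma_sets (space M) {X s -` B \<inter> space M | s B. s \<in> {0..t} \<and> B \<in> sets borel}"
        unfolding b(1)
      proof (rule sets_Collect_finite_All[OF _ b(2)])
        fix s assume "s \<in> S"
        then have "s \<in> {0..t}" using b(3) by blast
        show "{\<omega>\<in>space M. X s \<omega> \<in> B s} \<in> sigma_sets (space M) {X s -` B \<inter> space M | s B. s \<in> {0..t} \<and> B \<in> sets borel}"
          unfolding eq
        proof (rule sigma_sets.Basic, rule CollectI, intro exI conjI)
          show "X s -` B s \<inter> space M = X s -` B s \<inter> space M" ..
          show "s \<in> {0..t}" by fact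
          show "B s \<in> sets borel" using b(4) by blast
        qed
      qed
    qed
    finally show ?thesis .
  qed
  have "restr_to_subalg \<mu> ?F = restr_to_subalg \<nu> ?F"
  proof (rule measure_eqI_generator_eq[where E=E and \<Omega>="space M" and A="\<lambda>_::nat. space M"])
    show "Int_stable E"
    proof (rule Int_stableI)
      fix a b assume "a \<in> E" "b \<in> E"
      then obtain S B S' B' where a: "a = {\<omega>\<in>space M. \<forall>s\<in>S. X s \<omega> \<in> B s}" "finite S" "S \<subseteq> {0..t}" "\<forall>s. B s \<in> sets borel"
        and b: "b = {\<omega>\<in>space M. \<forall>s\<in>S'. X s \<omega> \<in> B' s}" "finite S'" "S' \<subseteq> {0..t}" "\<forall>s. B' s \<in> sets borel"
        unfolding E_def by blast
      \<comment> \<open>With \<open>UNIV\<close> at the times that a cylinder does not restrict, the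
        intersection is a cylinder over \<open>S \<union> S'\<close>.\<close>
      define C where "C s = (if s \<in> S then B s else UNIV) \<inter> (if s \<in> S' then B' s else UNIV)" for s
      have "a \<inter> b = {\<omega>\<in>space M. \<forall>s\<in>S\<union>S'. X s \<omega> \<in> C s}" unfolding a b C_def by auto
      moreover have "\<forall>s. C s \<in> sets borel" using a b by (auto simp: C_def)
      ultimately show "a \<inter> b \<in> E"
        unfolding E_def mem_Collect_eq using a(2,3) b(2,3) by (intro exI[of _ "S \<union> S'"] exI[of _ C]) auto
    qed
    show "E \<subseteq> Pow (space M)" unfolding E_def by auto
    show "sets (restr_to_subalg \<mu> ?F) = sigma_sets (space M) E" "sets (restr_to_subalg \<nu> ?F) = sigma_sets (space M) E"
      by (simp_all add: sets_restr_to_subalg sub gen)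
    have "space M \<in> E" unfolding E_def mem_Collect_eq by (intro exI[of _ "{}"] exI[of _ "\<lambda>_. UNIV"]) auto
    then show "range (\<lambda>_::nat. space M) \<subseteq> E" by auto
    have "emeasure \<mu> (space M) = 1"
      unfolding \<mu>_def using nn_integral_eq_integral[OF P.tilt_integrable[OF p order_refl t]] P.tilt_expectation[OF p order_refl t]
        P.tilt_pos P.tilt_measurable[OF order_refl t, of p p']
      by (subst emeasure_density) (auto simp: less_imp_le cong: nn_integral_cong_simp)
    then show "emeasure (restr_to_subalg \<mu> ?F) (space M) \<noteq> \<infinity>"
      using sub(1) by (subst emeasure_restr_to_subalg) (auto simp: gen intro!: sigma_sets.Basic \<open>space M \<in> E\<close>)
    fix a assume "a \<in> E"
    then have "a \<in> sets ?F" unfolding gen by (rule sigma_sets.Basic)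
    moreover have "emeasure \<mu> a = emeasure \<nu> a"
      using \<open>a \<in> E\<close> tilted_cylinder_eq[OF t] unfolding E_def \<mu>_def \<nu>_def by auto
    ultimately show "emeasure (restr_to_subalg \<mu> ?F) a = emeasure (restr_to_subalg \<nu> ?F) a"
      by (simp add: emeasure_restr_to_subalg sub)
  qed auto
  then show ?thesis
    using A emeasure_restr_to_subalg[OF sub(1) A] emeasure_restr_to_subalg[OF sub(2) A]
    unfolding \<mu>_def \<nu>_def by simp
qed

theorem density_natural_filtration:
  assumes t: "0 \<le> t"
  defines "Z \<equiv> \<lambda>\<omega>. exp (bislope_jumps (q - p) (q' - p') 0 t (\<lambda>t. X t \<omega>) - t * (Q.tilt_rate q q' - P.tilt_rate p p'))"
  shows "Z \<in> borel_measurable (natural_filtration t)"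
    and "restr_to_subalg N (natural_filtration t) = density (restr_to_subalg M (natural_filtration t)) (\<lambda>\<omega>. ennreal (Z \<omega>))"
proof -
  let ?F = "natural_filtration t"
  have sp: "space ?F = space M" using subalgebra_natural_filtration by (simp add: subalgebra_def)
  have X: "X s \<in> borel_measurable ?F" if "s \<in> {0..t}" for s
  proof (rule measurableI)
    fix B :: "real set" assume "B \<in> sets borel"
    then show "X s -` B \<inter> space ?F \<in> sets ?F"
      unfolding sp unfolding natural_filtration_def using that by (intro in_measure_of) auto
  qed auto
  have [measurable]: "(\<lambda>\<omega>. bislope_jumps c c' 0 t (\<lambda>t. X t \<omega>)) \<in> borel_measurable ?F" for c c' :: real
    by (intro bislope_jumps_measurable X) (use t P.X_cadlag in \<open>auto simp: sp\<close>)
  show "Z \<in> borel_measurable ?F" unfolding Z_def by measurable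
  have "Z \<omega> = P.tilt p p' 0 t (\<lambda>t. X t \<omega>) / Q.tilt q q' 0 t (\<lambda>t. X t \<omega>)" for \<omega>
    unfolding Z_def P.tilt_def Q.tilt_def by (simp add: exp_diff[symmetric] bislope_jumps_def algebra_simps)
  moreover have "(\<lambda>\<omega>. P.tilt p p' 0 t (\<lambda>t. X t \<omega>)) \<in> borel_measurable ?F"
    "(\<lambda>\<omega>. Q.tilt q q' 0 t (\<lambda>t. X t \<omega>)) \<in> borel_measurable ?F"
    unfolding P.tilt_def Q.tilt_def by measurable
  ultimately show "restr_to_subalg N ?F = density (restr_to_subalg M ?F) (\<lambda>\<omega>. ennreal (Z \<omega>))"
    using restr_to_subalg_tilt_quotient[OF subalgebra_natural_filtration sets_eq _ _ P.tilt_pos Q.tilt_pos tilted_eq[OF t]]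
    by simp
qed

end

section \<open>Tempered stable processes\<close>

text \<open>The exponent \<open>q - p\<close> may be positive, so the expectation is not covered by \<open>block_law\<close>. Instead the
  laws of the jump sum under both measures are compared after tilting.\<close>

lemma esscher_moment:
  assumes "fv_levy M X F" "fv_levy N Y G"
    and u: "0 \<le> u" "0 \<le> u'" and p: "0 \<le> p" and q: "0 \<le> q"
    and exponent_eq: "\<And>w. fv_levy.tilted_exponent F (p * u) (p * u') 0 (w * u) (w * u') =
       fv_levy.tilted_exponent G (q * u) (q * u') 0 (w * u) (w * u')"
  shows "(LINT \<omega>|M. exp ((q - p) * bislope_jumps u u' 0 1 (\<lambda>t. X t \<omega>))) =
    exp (fv_levy.tilt_rate G (q * u) (q * u') - fv_levy.tilt_rate F (p * u) (p * u'))"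
proof -
  interpret P: fv_levy M X F by fact
  interpret Q: fv_levy N Y G by fact
  have pu: "0 \<le> p * u" "0 \<le> p * u'" and qu: "0 \<le> q * u" "0 \<le> q * u'" using u p q by auto
  have ab: "(0::real) \<le> 0" "(0::real) \<le> 1" by auto
  define J where "J \<omega> = bislope_jumps u u' 0 1 (\<lambda>t. X t \<omega>)" for \<omega>
  define J' where "J' \<omega> = bislope_jumps u u' 0 1 (\<lambda>t. Y t \<omega>)" for \<omega>
  have scale: "bislope_jumps (c * u) (c * u') a b \<omega> = c * bislope_jumps u u' a b \<omega>" for c a b \<omega>
    by (simp add: bislope_jumps_def algebra_simps)
  let ?k = "P.tilt_rate (p * u) (p * u')" and ?l = "Q.tilt_rate (q * u) (q * u')"
  have W: "P.tilt (p * u) (p * u') 0 1 (\<lambda>t. X t \<omega>) = exp (?k - p * J \<omega>)" for \<omega>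
    by (simp add: P.tilt_def scale J_def)
  have V: "Q.tilt (q * u) (q * u') 0 1 (\<lambda>t. Y t \<omega>) = exp (?l - q * J' \<omega>)" for \<omega>
    by (simp add: Q.tilt_def scale J'_def)
  have [measurable]: "J \<in> borel_measurable M" unfolding J_def by (rule P.bislope_jumps_measurable_at[OF ab])
  have [measurable]: "J' \<in> borel_measurable N" unfolding J'_def by (rule Q.bislope_jumps_measurable_at[OF ab])
  have "distr (density M (\<lambda>\<omega>. ennreal (exp (?k - p * J \<omega>)))) borel J = distr (density N (\<lambda>\<omega>. ennreal (exp (?l - q * J' \<omega>)))) borel J'"
  proof (rule tilted_distr_eq)
    show "(CLINT \<omega>|M. iexp (z * J \<omega>) * of_real (exp (?k - p * J \<omega>))) = (CLINT \<omega>|N. iexp (z * J' \<omega>) * of_real (exp (?l - q * J' \<omega>)))" for z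
      using P.tilt_law[OF pu ab, of 0 "z * u" "z * u'"] Q.tilt_law[OF qu ab, of 0 "z * u" "z * u'"] exponent_eq[of z]
      unfolding W V by (simp add: scale J_def J'_def)
  qed (use P.tilt_integrable[OF pu ab] Q.tilt_integrable[OF qu ab] P.tilt_expectation[OF pu ab] Q.tilt_expectation[OF qu ab]
    in \<open>simp_all add: W V\<close>)
  \<comment> \<open>This test function cancels the tilt on the right, leaving the constant
    \<open>exp (?l - ?k)\<close>, and turns the tilt on the left into the wanted exponential. With
    nonnegative integrals, finiteness of the moment comes out as a result.\<close>
  then have "(\<integral>\<^sup>+y. ennreal (exp (q * y - ?k)) \<partial>distr (density M (\<lambda>\<omega>. ennreal (exp (?k - p * J \<omega>)))) borel J) =
     (\<integral>\<^sup>+y. ennreal (exp (q * y - ?k)) \<partial>distr (density N (\<lambda>\<omega>. ennreal (exp (?l - q * J' \<omega>)))) borel J')"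
    by simp
  moreover have "(\<integral>\<^sup>+y. ennreal (exp (q * y - ?k)) \<partial>distr (density M (\<lambda>\<omega>. ennreal (exp (?k - p * J \<omega>)))) borel J) =
     (\<integral>\<^sup>+\<omega>. ennreal (exp ((q - p) * J \<omega>)) \<partial>M)"
    by (subst nn_integral_distr, simp, simp, subst nn_integral_density)
      (auto intro!: nn_integral_cong simp: ennreal_mult[symmetric] exp_add[symmetric] algebra_simps)
  moreover have "(\<integral>\<^sup>+y. ennreal (exp (q * y - ?k)) \<partial>distr (density N (\<lambda>\<omega>. ennreal (exp (?l - q * J' \<omega>)))) borel J') =
     (\<integral>\<^sup>+\<omega>. ennreal (exp (?l - ?k)) \<partial>N)"
    by (subst nn_integral_distr, simp, simp, subst nn_integral_density)
      (auto intro!: nn_integral_cong simp: ennreal_mult[symmetric] exp_add[symmetric] algebra_simps)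
  ultimately have "(\<integral>\<^sup>+\<omega>. ennreal (exp ((q - p) * J \<omega>)) \<partial>M) = ennreal (exp (?l - ?k))"
    by (simp add: Q.emeasure_space_1)
  then have "(LINT \<omega>|M. exp ((q - p) * J \<omega>)) = exp (?l - ?k)"
    by (subst integral_eq_nn_integral) auto
  then show ?thesis by (simp add: J_def)
qed

section \<open>Levy measures of tempered stable laws\<close>

definition ts_density :: "real \<Rightarrow> real \<Rightarrow> real \<Rightarrow> real \<Rightarrow> real" where
  "ts_density \<alpha> \<beta> lam x = \<alpha> / x powr (1 + \<beta>) * exp (- lam * x) * indicator {0<..} x"

definition bilateral_levy_measure :: "real \<Rightarrow> real \<Rightarrow> real \<Rightarrow> real \<Rightarrow> real \<Rightarrow> real \<Rightarrow> real measure" where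
  "bilateral_levy_measure \<alpha>p \<beta>p lamp \<alpha>m \<beta>m lamm =
     density lborel (\<lambda>x. ennreal (ts_density \<alpha>p \<beta>p lamp x + ts_density \<alpha>m \<beta>m lamm (- x)))"

lemma ts_levy_measure_eq: "ts_levy_measure \<alpha> \<beta> lam = density lborel (\<lambda>x. ennreal (ts_density \<alpha> \<beta> lam x))"
  by (simp add: ts_levy_measure_def ts_density_def)

lemma ts_density_measurable [measurable]: "ts_density \<alpha> \<beta> lam \<in> borel_measurable borel"
  unfolding ts_density_def by measurable

lemma ts_density_nonneg: "0 \<le> \<alpha> \<Longrightarrow> 0 \<le> ts_density \<alpha> \<beta> lam x"
  by (simp add: ts_density_def)

lemma ts_density_nonpos: "x \<le> 0 \<Longrightarrow> ts_density \<alpha> \<beta> lam x = 0"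
  by (simp add: ts_density_def)

text \<open>Exponential weights shift the tempering parameter and leave \<open>\<alpha>\<close> and
  \<open>\<beta>\<close> alone. This is why tempered stable laws with equal \<open>\<alpha>\<close>
  and \<open>\<beta>\<close> are linked by Esscher transforms.\<close>

lemma ts_density_exp:
  "ts_density \<alpha> \<beta> lam x * exp (- p * x) = ts_density \<alpha> \<beta> (lam + p) x"
  by (simp add: ts_density_def exp_add[symmetric] algebra_simps)

text \<open>Up to the factor \<open>\<alpha>\<close> the integrand is that of the Gamma integral
  with parameter \<open>1 - \<beta>\<close>, positive because \<open>\<beta> < 1\<close>. The detour
  through complex powers and Lebesgue-measurable functions is due to the form of the Gamma integral
  that is used.\<close>

lemma integrable_ts_density:
  assumes "\<beta> < 1" "0 < lam"
  shows "integrable lborel (\<lambda>x. ts_density \<alpha> \<beta> lam x * x)"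
proof -
  let ?f = "\<lambda>t. complex_of_real t powr (complex_of_real (1 - \<beta>) - 1) / of_real (exp (lam * t))"
  let ?g = "\<lambda>t. indicator {0<..} t * (t powr (- \<beta>) / exp (lam * t))"
  have "?f absolutely_integrable_on {0<..}"
    using assms by (intro absolutely_integrable_Gamma_integral) auto
  then have "integrable lebesgue (\<lambda>t. indicator {0<..} t *\<^sub>R ?f t)"
    by (simp add: set_integrable_def)
  moreover have "indicator {0<..} t *\<^sub>R ?f t = complex_of_real (?g t)" for t
  proof (cases "0 < t")
    case True
    have "complex_of_real (1 - \<beta>) - 1 = complex_of_real (- \<beta>)" by simp
    then have "?f t = complex_of_real (t powr (- \<beta>)) / of_real (exp (lam * t))"
      using True by (simp only: powr_of_real less_imp_le)
    then show ?thesis using True by simp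
  qed simp
  ultimately have "integrable lebesgue (\<lambda>t. complex_of_real (?g t))" by simp
  then have "integrable lebesgue ?g" by (simp only: complex_of_real_integrable_eq)
  then have "integrable lborel ?g"
    by (subst (asm) integrable_completion) auto
  then have "integrable lborel (\<lambda>t. \<alpha> * ?g t)" by (rule integrable_mult_right)
  moreover have "\<alpha> * ?g t = ts_density \<alpha> \<beta> lam t * t" for t
  proof (cases "0 < t")
    case True
    then have "t / t powr (1 + \<beta>) = t powr (- \<beta>)"
      by (simp add: powr_add powr_minus divide_simps)
    then have "\<alpha> / t powr (1 + \<beta>) * t = \<alpha> * t powr (- \<beta>)"
      by (simp only: times_divide_eq_left times_divide_eq_right[symmetric])
    then show ?thesis using True by (auto simp: ts_density_def exp_minus divide_inverse mult_ac)
  qed (simp add: ts_density_def)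
  ultimately show ?thesis by simp
qed

text \<open>The linear bound makes \<open>f\<close> integrable for each one-sided part, so that the
  integral over the sum of the densities may be split; the reflection x to -x moves the negative
  part to the positive half line.\<close>

lemma bilateral_levy_measure_integral:
  fixes f :: "real \<Rightarrow> complex"
  assumes ap: "0 \<le> \<alpha>p" "\<beta>p < 1" "0 < lamp" and am: "0 \<le> \<alpha>m" "\<beta>m < 1" "0 < lamm"
    and f[measurable]: "f \<in> borel_measurable borel" and le: "\<And>x. cmod (f x) \<le> C * \<bar>x\<bar>"
  shows "(CLINT x|bilateral_levy_measure \<alpha>p \<beta>p lamp \<alpha>m \<beta>m lamm. f x) =
    (CLINT x|ts_levy_measure \<alpha>p \<beta>p lamp. f x) + (CLINT x|ts_levy_measure \<alpha>m \<beta>m lamm. f (- x))"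
proof -
  have int: "integrable lborel (\<lambda>x. ts_density \<alpha> \<beta> lam x *\<^sub>R g x)"
    if "0 \<le> \<alpha>" "\<beta> < 1" "0 < lam" "g \<in> borel_measurable borel" "\<And>x. cmod (g x) \<le> C * \<bar>x\<bar>"
    for \<alpha> \<beta> lam and g :: "real \<Rightarrow> complex"
  proof (rule Bochner_Integration.integrable_bound[OF integrable_mult_right[OF integrable_ts_density[OF that(2,3), of \<alpha>], of C]])
    note [measurable] = that(4)
    show "(\<lambda>x. ts_density \<alpha> \<beta> lam x *\<^sub>R g x) \<in> borel_measurable lborel" by measurable
    have C: "0 \<le> C" using order_trans[OF norm_ge_zero that(5)[of 1]] by simp
    show "AE x in lborel. norm (ts_density \<alpha> \<beta> lam x *\<^sub>R g x) \<le> norm (C * (ts_density \<alpha> \<beta> lam x * x))"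
    proof (rule AE_I2)
      fix x
      have "norm (ts_density \<alpha> \<beta> lam x *\<^sub>R g x) \<le> ts_density \<alpha> \<beta> lam x * (C * \<bar>x\<bar>)"
        using ts_density_nonneg[OF that(1)] that(5)[of x] by (simp add: mult_left_mono)
      then show "norm (ts_density \<alpha> \<beta> lam x *\<^sub>R g x) \<le> norm (C * (ts_density \<alpha> \<beta> lam x * x))"
        using C ts_density_nonneg[OF that(1), of \<beta> lam x] by (simp add: abs_mult mult_ac)
    qed
  qed
  have int2: "integrable lborel (\<lambda>x. ts_density \<alpha>m \<beta>m lamm x *\<^sub>R f (- x))"
    by (rule int[OF am]) (use le[of "- x" for x] in auto)
  have "(CLINT x|bilateral_levy_measure \<alpha>p \<beta>p lamp \<alpha>m \<beta>m lamm. f x) =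
    (CLINT x|lborel. ts_density \<alpha>p \<beta>p lamp x *\<^sub>R f x + ts_density \<alpha>m \<beta>m lamm (- x) *\<^sub>R f x)"
    unfolding bilateral_levy_measure_def
    by (subst integral_density) (auto simp: ts_density_nonneg ap am scaleR_add_left)
  also have "\<dots> = (CLINT x|lborel. ts_density \<alpha>p \<beta>p lamp x *\<^sub>R f x) + (CLINT x|lborel. ts_density \<alpha>m \<beta>m lamm (- x) *\<^sub>R f x)"
    using lborel_integrable_real_affine[OF int2, of "-1" 0] by (intro Bochner_Integration.integral_add int[OF ap f le]) simp
  also have "(CLINT x|lborel. ts_density \<alpha>m \<beta>m lamm (- x) *\<^sub>R f x) = (CLINT x|lborel. ts_density \<alpha>m \<beta>m lamm x *\<^sub>R f (- x))"
    by (subst lborel_integral_real_affine[where c="-1" and t=0]) auto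
  also have "(CLINT x|lborel. ts_density \<alpha>p \<beta>p lamp x *\<^sub>R f x) = (CLINT x|ts_levy_measure \<alpha>p \<beta>p lamp. f x)"
    unfolding ts_levy_measure_eq by (subst integral_density) (auto simp: ts_density_nonneg ap)
  also have "(CLINT x|lborel. ts_density \<alpha>m \<beta>m lamm x *\<^sub>R f (- x)) = (CLINT x|ts_levy_measure \<alpha>m \<beta>m lamm. f (- x))"
    unfolding ts_levy_measure_eq by (subst integral_density) (auto simp: ts_density_nonneg am)
  finally show ?thesis .
qed

lemma integrable_bilateral_levy_measure:
  assumes ap: "0 \<le> \<alpha>p" "\<beta>p < 1" "0 < lamp" and am: "0 \<le> \<alpha>m" "\<beta>m < 1" "0 < lamm"
  shows "integrable (bilateral_levy_measure \<alpha>p \<beta>p lamp \<alpha>m \<beta>m lamm) (\<lambda>x. x)"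
proof -
  have "integrable lborel (\<lambda>x. ts_density \<alpha>p \<beta>p lamp x * x + ts_density \<alpha>m \<beta>m lamm (- x) * x)"
    using integrable_minus[OF lborel_integrable_real_affine[OF integrable_ts_density[OF am(2,3), of \<alpha>m], of "-1" 0]]
    by (intro Bochner_Integration.integrable_add integrable_ts_density ap) simp
  then show ?thesis
    unfolding bilateral_levy_measure_def
    by (subst integrable_density) (auto simp: ts_density_nonneg ap am distrib_right)
qed

lemma tempered_stable_char:
  assumes ts: "tempered_stable \<alpha>p \<beta>p lamp \<alpha>m \<beta>m lamm \<mu>"
    and ap: "0 \<le> \<alpha>p" "\<beta>p < 1" "0 < lamp" and am: "0 \<le> \<alpha>m" "\<beta>m < 1" "0 < lamm"
  shows "char \<mu> z = exp (CLINT x|bilateral_levy_measure \<alpha>p \<beta>p lamp \<alpha>m \<beta>m lamm. (iexp (z * x) - 1))"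
proof -
  from ts obtain \<mu>p \<mu>m where p: "one_sided_tempered_stable \<alpha>p \<beta>p lamp \<mu>p" and m: "one_sided_tempered_stable \<alpha>m \<beta>m lamm \<mu>m"
    and \<mu>: "\<mu> = distr (\<mu>p \<Otimes>\<^sub>M \<mu>m) borel (\<lambda>(x, y). x - y)"
    unfolding tempered_stable_def by blast
  interpret P: real_distribution \<mu>p using p by (simp add: one_sided_tempered_stable_def)
  interpret M: real_distribution \<mu>m using m by (simp add: one_sided_tempered_stable_def)
  interpret PM: pair_prob_space \<mu>p \<mu>m ..
  have [measurable]: "(\<lambda>(x, y). x - y :: real) \<in> borel_measurable (\<mu>p \<Otimes>\<^sub>M \<mu>m)"
    "fst \<in> borel_measurable (\<mu>p \<Otimes>\<^sub>M \<mu>m)" "snd \<in> borel_measurable (\<mu>p \<Otimes>\<^sub>M \<mu>m)"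
    by measurable
  have "char \<mu> z = (CLINT w|\<mu>p \<Otimes>\<^sub>M \<mu>m. iexp (z * fst w) * iexp (- z * snd w))"
    unfolding \<mu> char_def
    by (subst integral_distr) (auto simp: exp_add[symmetric] algebra_simps split_beta intro!: Bochner_Integration.integral_cong)
  also have "\<dots> = (CLINT x|\<mu>p. CLINT y|\<mu>m. iexp (z * x) * iexp (- z * y))"
  proof (subst PM.integral_fst'[symmetric])
    show "integrable (\<mu>p \<Otimes>\<^sub>M \<mu>m) (\<lambda>w. iexp (z * fst w) * iexp (- z * snd w))"
      by (rule PM.P.integrable_const_bound[where B=1]) (auto simp: norm_mult)
  qed simp
  also have "\<dots> = char \<mu>p z * char \<mu>m (- z)" by (simp add: char_def)
  also have "\<dots> = exp (CLINT x|ts_levy_measure \<alpha>p \<beta>p lamp. iexp (z * x) - 1) * exp (CLINT x|ts_levy_measure \<alpha>m \<beta>m lamm. iexp (- z * x) - 1)"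
    using p m by (simp add: one_sided_tempered_stable_def)
  also have "\<dots> = exp ((CLINT x|ts_levy_measure \<alpha>p \<beta>p lamp. iexp (z * x) - 1) + (CLINT x|ts_levy_measure \<alpha>m \<beta>m lamm. iexp (z * - x) - 1))"
    by (simp add: exp_add)
  also have "(CLINT x|ts_levy_measure \<alpha>p \<beta>p lamp. iexp (z * x) - 1) + (CLINT x|ts_levy_measure \<alpha>m \<beta>m lamm. iexp (z * - x) - 1) =
     (CLINT x|bilateral_levy_measure \<alpha>p \<beta>p lamp \<alpha>m \<beta>m lamm. (iexp (z * x) - 1))"
  proof (rule bilateral_levy_measure_integral[OF ap am, symmetric])
    show "cmod (iexp (z * x) - 1) \<le> \<bar>z\<bar> * \<bar>x\<bar>" for x
      using norm_iexp_minus_1_le[of "z * x"] by (simp add: abs_mult)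
  qed measurable
  finally show ?thesis .
qed

lemma tempered_stable_fv_levy:
  assumes ts: "tempered_stable_process \<alpha>p \<beta>p lamp \<alpha>m \<beta>m lamm M X"
    and ap: "0 \<le> \<alpha>p" "\<beta>p < 1" "0 < lamp" and am: "0 \<le> \<alpha>m" "\<beta>m < 1" "0 < lamm"
  shows "fv_levy M X (bilateral_levy_measure \<alpha>p \<beta>p lamp \<alpha>m \<beta>m lamm)"
proof -
  have levy: "levy_process M X" and ts1: "tempered_stable \<alpha>p \<beta>p lamp \<alpha>m \<beta>m lamm (distr M borel (X 1))"
    using ts by (auto simp: tempered_stable_process_def)
  then interpret prob_space M by (simp add: levy_process_def)
  show ?thesis
  proof
    show "sets (bilateral_levy_measure \<alpha>p \<beta>p lamp \<alpha>m \<beta>m lamm) = sets borel"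
      by (simp add: bilateral_levy_measure_def)
  qed (use levy tempered_stable_char[OF ts1 ap am] integrable_bilateral_levy_measure[OF ap am] in auto)
qed

text \<open>On each half line only one of the two densities is nonzero and \<open>bislope\<close> is
  linear with a single slope, so \<open>ts_density_exp\<close> applies to the two sides
  separately.\<close>

lemma tilted_exponent_bilateral:
  assumes L: "fv_levy M X (bilateral_levy_measure \<alpha>p \<beta>p lamp \<alpha>m \<beta>m lamm)"
    and "0 \<le> \<alpha>p" "0 \<le> \<alpha>m"
  shows "fv_levy.tilted_exponent (bilateral_levy_measure \<alpha>p \<beta>p lamp \<alpha>m \<beta>m lamm) p p' z w w' =
    (CLINT x|bilateral_levy_measure \<alpha>p \<beta>p (lamp + p) \<alpha>m \<beta>m (lamm + p'). (iexp (z * x + bislope w w' x) - 1))"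
proof -
  note [measurable] = borel_measurable_continuous_onI[OF continuous_on_bislope]
  have tilt: "(ts_density \<alpha>p \<beta>p lamp x + ts_density \<alpha>m \<beta>m lamm (- x)) * exp (- bislope p p' x) =
     ts_density \<alpha>p \<beta>p (lamp + p) x + ts_density \<alpha>m \<beta>m (lamm + p') (- x)" for x
  proof (cases "0 \<le> x")
    case True
    then have "bislope p p' x = p * x" by (simp add: bislope_def)
    then show ?thesis using True ts_density_exp[of \<alpha>p \<beta>p lamp x p] by (simp add: ts_density_nonpos)
  next
    case False
    then have "bislope p p' x = p' * (- x)" by (simp add: bislope_def)
    then show ?thesis using False ts_density_exp[of \<alpha>m \<beta>m lamm "- x" p'] by (simp add: ts_density_nonpos)
  qed
  show ?thesis
    unfolding fv_levy.tilted_exponent_def[OF L] unfolding bilateral_levy_measure_def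
    by (subst (1 2) integral_density)
      (auto simp: ts_density_nonneg assms scaleR_conv_of_real tilt[symmetric] mult_ac intro!: Bochner_Integration.integral_cong)
qed

text \<open>For the cumulant of one jump sum the parameters of the other side have to drop out. They
  do so already in the integrand: where the negative density is nonzero, \<open>f\<close> is
  0.\<close>

lemma bilateral_levy_measure_integral_pos:
  fixes f :: "real \<Rightarrow> complex"
  assumes "0 \<le> \<alpha>p" "0 \<le> \<alpha>m" and [measurable]: "f \<in> borel_measurable borel" and "\<And>x. x \<le> 0 \<Longrightarrow> f x = 0"
  shows "(CLINT x|bilateral_levy_measure \<alpha>p \<beta>p lamp \<alpha>m \<beta>m lamm. f x) = (CLINT x|ts_levy_measure \<alpha>p \<beta>p lamp. f x)"
proof -
  have eq: "(ts_density \<alpha>p \<beta>p lamp x + ts_density \<alpha>m \<beta>m lamm (- x)) *\<^sub>R f x = ts_density \<alpha>p \<beta>p lamp x *\<^sub>R f x" for x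
    using assms(4)[of x] by (cases "x \<le> 0") (simp_all add: ts_density_nonpos)
  have "(CLINT x|bilateral_levy_measure \<alpha>p \<beta>p lamp \<alpha>m \<beta>m lamm. f x) =
    (CLINT x|lborel. (ts_density \<alpha>p \<beta>p lamp x + ts_density \<alpha>m \<beta>m lamm (- x)) *\<^sub>R f x)"
    unfolding bilateral_levy_measure_def by (subst integral_density) (simp_all add: ts_density_nonneg assms)
  also have "\<dots> = (CLINT x|ts_levy_measure \<alpha>p \<beta>p lamp. f x)"
    unfolding eq ts_levy_measure_eq by (subst integral_density) (simp_all add: ts_density_nonneg assms)
  finally show ?thesis .
qed

lemma bilateral_levy_measure_integral_neg:
  fixes f :: "real \<Rightarrow> complex"
  assumes "0 \<le> \<alpha>p" "0 \<le> \<alpha>m" and [measurable]: "f \<in> borel_measurable borel" and "\<And>x. 0 \<le> x \<Longrightarrow> f x = 0"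
  shows "(CLINT x|bilateral_levy_measure \<alpha>p \<beta>p lamp \<alpha>m \<beta>m lamm. f x) = (CLINT x|ts_levy_measure \<alpha>m \<beta>m lamm. f (- x))"
proof -
  have eq: "(ts_density \<alpha>p \<beta>p lamp (- x) + ts_density \<alpha>m \<beta>m lamm x) *\<^sub>R f (- x) = ts_density \<alpha>m \<beta>m lamm x *\<^sub>R f (- x)" for x
    using assms(4)[of "- x"] by (cases "x \<le> 0") (simp_all add: ts_density_nonpos)
  have "(CLINT x|bilateral_levy_measure \<alpha>p \<beta>p lamp \<alpha>m \<beta>m lamm. f x) =
    (CLINT x|lborel. (ts_density \<alpha>p \<beta>p lamp x + ts_density \<alpha>m \<beta>m lamm (- x)) *\<^sub>R f x)"
    unfolding bilateral_levy_measure_def by (subst integral_density) (simp_all add: ts_density_nonneg assms)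
  also have "\<dots> = (CLINT x|lborel. (ts_density \<alpha>p \<beta>p lamp (- x) + ts_density \<alpha>m \<beta>m lamm x) *\<^sub>R f (- x))"
    by (subst lborel_integral_real_affine[where c="-1" and t=0]) simp_all
  also have "\<dots> = (CLINT x|ts_levy_measure \<alpha>m \<beta>m lamm. f (- x))"
    unfolding eq ts_levy_measure_eq by (subst integral_density) (simp_all add: ts_density_nonneg assms)
  finally show ?thesis .
qed

section \<open>Path space, filtration and uniqueness of the Esscher transform\<close>

lemma space_path_sigma: "space path_sigma = skorokhod_space"
  unfolding path_sigma_def by (subst space_measure_of) auto

lemma space_path_filtration: "space (path_filtration t) = skorokhod_space"
  unfolding path_filtration_def by (subst space_measure_of) auto

lemma sets_path_filtration:
  "sets (path_filtration t) = sigma_sets skorokhod_space {canonical s -` B \<inter> skorokhod_space | s B. s \<in> {0..t} \<and> B \<in> sets borel}"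
  unfolding path_filtration_def by (subst sets_measure_of) auto

lemma sets_path_sigma:
  "sets path_sigma = sigma_sets skorokhod_space {canonical s -` B \<inter> skorokhod_space | s B. 0 \<le> s \<and> B \<in> sets borel}"
  unfolding path_sigma_def by (subst sets_measure_of) auto

lemma sets_path_filtration_mono: "s \<le> t \<Longrightarrow> sets (path_filtration s) \<subseteq> sets (path_filtration t)"
  unfolding sets_path_filtration by (intro sigma_sets_mono') force

lemma subalgebra_path_filtration:
  assumes "sets Q = sets path_sigma"
  shows "subalgebra Q (path_filtration t)"
proof -
  have "space Q = skorokhod_space" using sets_eq_imp_space_eq[OF assms] by (simp add: space_path_sigma)
  moreover have "sets (path_filtration t) \<subseteq> sets path_sigma"
    unfolding sets_path_filtration sets_path_sigma by (intro sigma_sets_mono') auto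
  ultimately show ?thesis using assms by (simp add: subalgebra_def space_path_filtration)
qed

lemma sets_path_sigma_Union:
  "sets path_sigma = sigma_sets skorokhod_space (\<Union>t\<in>{0..}. sets (path_filtration t))"
  unfolding sets_path_sigma
proof (rule sigma_sets_eqI)
  fix a assume "a \<in> {canonical s -` B \<inter> skorokhod_space | s B. 0 \<le> s \<and> B \<in> sets borel}"
  then obtain s B where "a = canonical s -` B \<inter> skorokhod_space" "0 \<le> s" "B \<in> sets borel" by blast
  then have "a \<in> sets (path_filtration s)"
    unfolding sets_path_filtration by (intro sigma_sets.Basic) force
  then show "a \<in> sigma_sets skorokhod_space (\<Union>t\<in>{0..}. sets (path_filtration t))"
    using \<open>0 \<le> s\<close> by (intro sigma_sets.Basic) auto
next
  fix b assume "b \<in> (\<Union>t\<in>{0..}. sets (path_filtration t))"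
  then show "b \<in> sigma_sets skorokhod_space {canonical s -` B \<inter> skorokhod_space | s B. 0 \<le> s \<and> B \<in> sets borel}"
    using subalgebra_path_filtration[OF refl] unfolding subalgebra_def sets_path_sigma by blast
qed

lemma has_density_on_unique:
  assumes Q: "prob_space Q" "sets Q = sets path_sigma" "\<And>t. 0 \<le> t \<Longrightarrow> has_density_on (path_filtration t) P Q (Z t)"
    and Q': "prob_space Q'" "sets Q' = sets path_sigma" "\<And>t. 0 \<le> t \<Longrightarrow> has_density_on (path_filtration t) P Q' (Z t)"
  shows "Q' = Q"
proof (rule measure_eqI_generator_eq[where E="\<Union>t\<in>{0..}. sets (path_filtration t)" and \<Omega>=skorokhod_space
      and A="\<lambda>_::nat. skorokhod_space"])
  show "Int_stable (\<Union>t\<in>{0..}. sets (path_filtration t))"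
  proof (rule Int_stableI)
    fix a b assume "a \<in> (\<Union>t\<in>{0..}. sets (path_filtration t))" "b \<in> (\<Union>t\<in>{0..}. sets (path_filtration t))"
    then obtain s t where st: "0 \<le> s" "0 \<le> t" "a \<in> sets (path_filtration s)" "b \<in> sets (path_filtration t)" by auto
    then have "a \<in> sets (path_filtration (max s t))" "b \<in> sets (path_filtration (max s t))"
      using sets_path_filtration_mono[of s "max s t"] sets_path_filtration_mono[of t "max s t"] by auto
    then show "a \<inter> b \<in> (\<Union>t\<in>{0..}. sets (path_filtration t))" using st(1) by (intro UN_I[of "max s t"]) auto
  qed
  show "(\<Union>t\<in>{0..}. sets (path_filtration t)) \<subseteq> Pow skorokhod_space"
    using sets.space_closed[of "path_filtration _"] by (auto simp: space_path_filtration)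
  show "sets Q = sigma_sets skorokhod_space (\<Union>t\<in>{0..}. sets (path_filtration t))"
    "sets Q' = sigma_sets skorokhod_space (\<Union>t\<in>{0..}. sets (path_filtration t))"
    using Q(2) Q'(2) sets_path_sigma_Union by auto
  have "skorokhod_space \<in> sets (path_filtration 0)"
    using sets.top[of "path_filtration 0"] by (simp add: space_path_filtration)
  then show "range (\<lambda>_::nat. skorokhod_space) \<subseteq> (\<Union>t\<in>{0..}. sets (path_filtration t))" by auto
  show "emeasure Q' skorokhod_space \<noteq> \<infinity>"
  proof -
    interpret prob_space Q' by fact
    show ?thesis by simp
  qed
  fix A assume "A \<in> (\<Union>t\<in>{0..}. sets (path_filtration t))"
  then obtain t where t: "0 \<le> t" "A \<in> sets (path_filtration t)" by auto
  from Q(3)[OF t(1)] Q'(3)[OF t(1)] have "restr_to_subalg Q' (path_filtration t) = restr_to_subalg Q (path_filtration t)"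
    by (simp add: has_density_on_def)
  then show "emeasure Q' A = emeasure Q A"
    using emeasure_restr_to_subalg[OF subalgebra_path_filtration[OF Q(2)] t(2)]
      emeasure_restr_to_subalg[OF subalgebra_path_filtration[OF Q'(2)] t(2)] by simp
qed auto

lemma bislope_jumps_eq_jumps: "bislope_jumps c c' 0 t \<omega> = jumps_pos t \<omega> * c + jumps_neg t \<omega> * c'"
  by (simp add: bislope_jumps_def jump_sum_def jumps_pos_def jumps_neg_def)

theorem proposition8p3:
  fixes \<alpha>p \<alpha>m \<beta>p \<beta>m lam1p lam1m lam2p lam2m :: real
    and P Q :: "(real \<Rightarrow> real) measure"
  assumes "\<alpha>p > 0" "\<alpha>m > 0" "lam1p > 0" "lam1m > 0" "lam2p > 0" "lam2m > 0"
    and "\<beta>p \<in> {0..<1}" "\<beta>m \<in> {0..<1}"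
    and "prob_space P" "sets P = sets path_sigma"
    and "prob_space Q" "sets Q = sets path_sigma"
    and "tempered_stable_process \<alpha>p \<beta>p lam1p \<alpha>m \<beta>m lam1m P canonical"
    and "tempered_stable_process \<alpha>p \<beta>p lam2p \<alpha>m \<beta>m lam2m Q canonical"
  shows "Q = bilateral_esscher P (lam1p - lam2p) (lam1m - lam2m) \<and>
    (\<forall>t\<ge>0. has_density_on (path_filtration t) P Q
       (\<lambda>\<omega>. exp ((lam1p - lam2p) * jumps_pos t \<omega> - cumulant_gen P (jumps_pos 1) (lam1p - lam2p) * t) *
             exp ((lam1m - lam2m) * jumps_neg t \<omega> - cumulant_gen P (jumps_neg 1) (lam1m - lam2m) * t)))"
proof -
  define lp lm where "lp = max lam1p lam2p" and "lm = max lam1m lam2m"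
  \<comment> \<open>Chosen so that \<open>lam1p + p = lam2p + q = lp\<close>, while
    \<open>q - p = lam1p - lam2p\<close> is the Esscher parameter; likewise for the minus
    side.\<close>
  define p p' q q' where "p = lp - lam1p" and "p' = lm - lam1m" and "q = lp - lam2p" and "q' = lm - lam2m"
  have nonneg: "0 \<le> p" "0 \<le> p'" "0 \<le> q" "0 \<le> q'"
    by (auto simp: p_def p'_def q_def q'_def lp_def lm_def)
  define F1 where "F1 = bilateral_levy_measure \<alpha>p \<beta>p lam1p \<alpha>m \<beta>m lam1m"
  define F2 where "F2 = bilateral_levy_measure \<alpha>p \<beta>p lam2p \<alpha>m \<beta>m lam2m"
  have LP: "fv_levy P canonical F1" and LQ: "fv_levy Q canonical F2"
    unfolding F1_def F2_def using assms by (auto intro: tempered_stable_fv_levy)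
  have expo: "fv_levy.tilted_exponent F1 c c' z w w' =
      (CLINT x|bilateral_levy_measure \<alpha>p \<beta>p (lam1p + c) \<alpha>m \<beta>m (lam1m + c'). (iexp (z * x + bislope w w' x) - 1))"
    "fv_levy.tilted_exponent F2 c c' z w w' =
      (CLINT x|bilateral_levy_measure \<alpha>p \<beta>p (lam2p + c) \<alpha>m \<beta>m (lam2m + c'). (iexp (z * x + bislope w w' x) - 1))"
    for c c' z w w'
    using tilted_exponent_bilateral[OF LP[unfolded F1_def]] tilted_exponent_bilateral[OF LQ[unfolded F2_def]] assms(1,2)
    by (auto simp: F1_def F2_def)
  interpret pair: fv_levy_pair P Q canonical F1 F2 p p' q q'
    unfolding fv_levy_pair_def fv_levy_pair_axioms_def
    using LP LQ nonneg assms(10,12) by (auto simp: expo p_def p'_def q_def q'_def)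
  note [measurable] = borel_measurable_continuous_onI[OF continuous_on_bislope]
  have path: "(\<lambda>t. canonical t \<omega>) = \<omega>" for \<omega> by (simp add: canonical_def)
  \<comment> \<open>The slopes 1 and 0 single out the positive jumps. The minus side is left
    untilted, so there \<open>F1\<close> and \<open>F2\<close> still differ; the exponents
    nevertheless agree, because the integrand vanishes for \<open>x \<le> 0\<close>.\<close>
  have "(LINT \<omega>|P. exp ((q - p) * bislope_jumps 1 0 0 1 (\<lambda>t. canonical t \<omega>))) =
     exp (fv_levy.tilt_rate F2 (q * 1) (q * 0) - fv_levy.tilt_rate F1 (p * 1) (p * 0))"
  proof (rule esscher_moment[OF LP LQ])
    fix w
    have "iexp (0 * x + bislope (w * 1) (w * 0) x) - 1 = 0" if "x \<le> 0" for x using that by (simp add: bislope_def)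
    then show "fv_levy.tilted_exponent F1 (p * 1) (p * 0) 0 (w * 1) (w * 0) = fv_levy.tilted_exponent F2 (q * 1) (q * 0) 0 (w * 1) (w * 0)"
      unfolding expo using assms(1,2) by (subst (1 2) bilateral_levy_measure_integral_pos) (auto simp: p_def q_def)
  qed (use nonneg in auto)
  then have cp: "cumulant_gen P (jumps_pos 1) (lam1p - lam2p) = pair.Q.tilt_rate q 0 - pair.P.tilt_rate p 0"
    by (simp add: cumulant_gen_def path bislope_jumps_eq_jumps p_def q_def)
  have "(LINT \<omega>|P. exp ((q' - p') * bislope_jumps 0 1 0 1 (\<lambda>t. canonical t \<omega>))) =
     exp (fv_levy.tilt_rate F2 (q' * 0) (q' * 1) - fv_levy.tilt_rate F1 (p' * 0) (p' * 1))"
  proof (rule esscher_moment[OF LP LQ])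
    fix w
    have "iexp (0 * x + bislope (w * 0) (w * 1) x) - 1 = 0" if "0 \<le> x" for x using that by (simp add: bislope_def)
    then show "fv_levy.tilted_exponent F1 (p' * 0) (p' * 1) 0 (w * 0) (w * 1) = fv_levy.tilted_exponent F2 (q' * 0) (q' * 1) 0 (w * 0) (w * 1)"
      unfolding expo using assms(1,2) by (subst (1 2) bilateral_levy_measure_integral_neg) (auto simp: p'_def q'_def)
  qed (use nonneg in auto)
  then have cm: "cumulant_gen P (jumps_neg 1) (lam1m - lam2m) = pair.Q.tilt_rate 0 q' - pair.P.tilt_rate 0 p'"
    by (simp add: cumulant_gen_def path bislope_jumps_eq_jumps p'_def q'_def)
  have filt: "pair.natural_filtration t = path_filtration t" for t
    using sets_eq_imp_space_eq[OF assms(10)]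
    by (simp add: pair.natural_filtration_def path_filtration_def space_path_sigma)
  have dens: "has_density_on (path_filtration t) P Q (esscher_density P (lam1p - lam2p) (lam1m - lam2m) t)" if t: "0 \<le> t" for t
  proof -
    \<comment> \<open>\<open>tilt_rate_split\<close> breaks both joint rates into one-sided ones,
      whose differences are the two cumulants just computed.\<close>
    have "esscher_density P (lam1p - lam2p) (lam1m - lam2m) t =
      (\<lambda>\<omega>. exp (bislope_jumps (q - p) (q' - p') 0 t (\<lambda>t. canonical t \<omega>) - t * (pair.Q.tilt_rate q q' - pair.P.tilt_rate p p')))"
      unfolding esscher_density_def cp cm path bislope_jumps_eq_jumps
        pair.Q.tilt_rate_split[OF nonneg(3,4)] pair.P.tilt_rate_split[OF nonneg(1,2)] exp_add[symmetric]
      by (simp add: p_def q_def p'_def q'_def algebra_simps)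
    then show ?thesis
      using pair.density_natural_filtration[OF t] by (simp only: has_density_on_def filt simp_thms)
  qed
  have "bilateral_esscher P (lam1p - lam2p) (lam1m - lam2m) = Q"
    unfolding bilateral_esscher_def
  proof (rule the_equality)
    show "prob_space Q \<and> sets Q = sets path_sigma \<and>
       (\<forall>t\<ge>0. has_density_on (path_filtration t) P Q (esscher_density P (lam1p - lam2p) (lam1m - lam2m) t))"
      using assms(11,12) dens by blast
    show "Q' = Q" if "prob_space Q' \<and> sets Q' = sets path_sigma \<and>
       (\<forall>t\<ge>0. has_density_on (path_filtration t) P Q' (esscher_density P (lam1p - lam2p) (lam1m - lam2m) t))" for Q'
      by (rule has_density_on_unique[OF assms(11,12) dens]) (use that in auto)
  qed
  with dens show ?thesis by (auto simp: esscher_density_def[abs_def])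
qed

end
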